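(* Let $\mathcal{V}$ be an adequate monoidal model category with cofibrant unit and let $\mathbb{H}$ be a cofibrant $\mathcal{V}$-category on $\{0,1\}$, i.e. a cofibrant object of $\mathcal{V}\text{-}\mathrm{Cat}_{\{0,1\}}$. Then (i) the endomorphism-monoids $\mathbb{H}(0,0)$ and $\mathbb{H}(1,1)$ are cofibrant monoids; (ii) $\mathbb{H}(0,1)$ is cofibrant as a left $\mathbb{H}(1,1)$-module and as a right $\mathbb{H}(0,0)$-module; (iii) $\mathbb{H}(1,0)$ is cofibrant as a left $\mathbb{H}(0,0)$-module and as a right $\mathbb{H}(1,1)$-module.
   Context: A monoidal model category is a closed symmetric monoidal category $(\mathcal{V},\otimes,I_{\mathcal V})$ with a Quillen model structure satisfying the pushout-product and unit axioms (in the sense of Hovey); it is always assumed cofibrantly generated. Compact generation: a class of maps of $\mathcal V$ is monoidally saturated if it is closed under cobase change, transfinite composition, retract, and tensoring with arbitrary objects. A $\otimes$-cofibration is a map in the least monoidally saturated class containing the cofibrations. An object is $\otimes$-small if it is small with respect to $\otimes$-cofibrations. The class of weak equivalences is $\otimes$-perfect if it is closed under filtered colimits along $\otimes$-cofibrations. $\mathcal V$ is compactly generated if every object is $\otimes$-small and the class of weak equivalences is $\otimes$-perfect. $\mathcal V$ is adequate if it is compactly generated and, for any non-symmetric coloured operad $P$ in sets, the category of $P$-algebras in $\mathcal V$ carries a transferred model structure, i.e. one whose fibrations and weak equivalences are those maps which are fibrations, resp. weak equivalences, in $\mathcal V$ on each colour. $\mathcal{V}\text{-}\mathrm{Cat}_{\{0,1\}}$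 is the category of $\mathcal V$-enriched categories with object set $\{0,1\}$ and $\mathcal V$-functors which are the identity on objects, with the transferred model structure: weak equivalences and fibrations are defined hom-object-wise. $\mathbb H(i,j)$ is the hom-object of maps from $i$ to $j$. Monoids in $\mathcal V$, and left and right modules over a monoid whose unit $I_{\mathcal V}\to R$ is a cofibration in $\mathcal V$, carry the transferred model structures, in which weak equivalences and fibrations are those of the underlying objects in $\mathcal V$; cofibrancy of monoids and modules refers to these. *)

theory Defs
  imports Main "HOL-Library.FuncSet"
begin

unbundle cardinal_syntax

section \<open>Universes and smallness\<close>

text \<open>
  The type \<open>'u\<close> plays the role of a Grothendieck universe: a set (of any type) is small if its
  cardinality is less than that of \<open>'u\<close>, and the cardinality of \<open>'u\<close> is strongly inaccessible.
  Every small set is in bijection with a subset of \<open>'u\<close>, so small index categories, small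
  ordinals and small operads are taken with elements in \<open>'u\<close>.
\<close>

definition small :: "'u itself \<Rightarrow> 'x set \<Rightarrow> bool" where
  "small U A \<longleftrightarrow> |A| <o |UNIV :: 'u set|"

definition universe :: "'u itself \<Rightarrow> bool" where
  "universe U \<longleftrightarrow>
     natLeq <o |UNIV :: 'u set| \<and>
     regularCard |UNIV :: 'u set| \<and>
     (\<forall>A :: 'u set. small U A \<longrightarrow> small U (Pow A))"


section \<open>Categories\<close>

record ('o, 'm) cat =
  Obj :: "'o set"
  Arr :: "'m set"
  Dom :: "'m \<Rightarrow> 'o"
  Cod :: "'m \<Rightarrow> 'o"
  Ident :: "'o \<Rightarrow> 'm"
  Comp :: "'m \<Rightarrow> 'm \<Rightarrow> 'm"  (infixr "\<cdot>\<index>" 65)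

definition homs :: "('o, 'm, 'z) cat_scheme \<Rightarrow> 'o \<Rightarrow> 'o \<Rightarrow> 'm set" where
  "homs C X Y = {f \<in> Arr C. Dom C f = X \<and> Cod C f = Y}"

locale category =
  fixes C :: "('o, 'm, 'z) cat_scheme" (structure)
  assumes Dom_Obj: "f \<in> Arr C \<Longrightarrow> Dom C f \<in> Obj C"
    and Cod_Obj: "f \<in> Arr C \<Longrightarrow> Cod C f \<in> Obj C"
    and Ident_homs: "X \<in> Obj C \<Longrightarrow> Ident C X \<in> homs C X X"
    and Comp_homs: "f \<in> homs C X Y \<Longrightarrow> g \<in> homs C Y Z \<Longrightarrow> g \<cdot> f \<in> homs C X Z"
    and Comp_Ident: "f \<in> homs C X Y \<Longrightarrow> f \<cdot> Ident C X = f"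
    and Ident_Comp: "f \<in> homs C X Y \<Longrightarrow> Ident C Y \<cdot> f = f"
    and Comp_assoc: "f \<in> homs C W X \<Longrightarrow> g \<in> homs C X Y \<Longrightarrow> h \<in> homs C Y Z \<Longrightarrow>
      (h \<cdot> g) \<cdot> f = h \<cdot> (g \<cdot> f)"

definition locally_small :: "'u itself \<Rightarrow> ('o, 'm, 'z) cat_scheme \<Rightarrow> bool" where
  "locally_small U C \<longleftrightarrow> (\<forall>X \<in> Obj C. \<forall>Y \<in> Obj C. small U (homs C X Y))"

definition opp :: "('o, 'm, 'z) cat_scheme \<Rightarrow> ('o, 'm) cat" where
  "opp C = \<lparr>Obj = Obj C, Arr = Arr C, Dom = Cod C, Cod = Dom C, Ident = Ident C,
            Comp = (\<lambda>g f. f \<cdot>\<^bsub>C\<^esub> g)\<rparr>"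

definition is_iso :: "('o, 'm, 'z) cat_scheme \<Rightarrow> 'm \<Rightarrow> bool" where
  "is_iso C f \<longleftrightarrow> f \<in> Arr C \<and>
     (\<exists>g \<in> homs C (Cod C f) (Dom C f).
        g \<cdot>\<^bsub>C\<^esub> f = Ident C (Dom C f) \<and> f \<cdot>\<^bsub>C\<^esub> g = Ident C (Cod C f))"

definition initial :: "('o, 'm, 'z) cat_scheme \<Rightarrow> 'o \<Rightarrow> bool" where
  "initial C X \<longleftrightarrow> X \<in> Obj C \<and> (\<forall>Y \<in> Obj C. \<exists>!f. f \<in> homs C X Y)"

text \<open>A functor is given by its object part and its arrow part.\<close>

definition is_functor ::
  "('a, 'b, 'y) cat_scheme \<Rightarrow> ('o, 'm, 'z) cat_scheme \<Rightarrow> ('a \<Rightarrow> 'o) \<Rightarrow> ('b \<Rightarrow> 'm) \<Rightarrow> bool" where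
  "is_functor J C X x \<longleftrightarrow>
     (\<forall>j \<in> Obj J. X j \<in> Obj C \<and> x (Ident J j) = Ident C (X j)) \<and>
     (\<forall>f \<in> Arr J. x f \<in> homs C (X (Dom J f)) (X (Cod J f))) \<and>
     (\<forall>f \<in> Arr J. \<forall>g \<in> Arr J. Dom J g = Cod J f \<longrightarrow> x (g \<cdot>\<^bsub>J\<^esub> f) = x g \<cdot>\<^bsub>C\<^esub> x f)"

definition is_cocone ::
  "('a, 'b, 'y) cat_scheme \<Rightarrow> ('o, 'm, 'z) cat_scheme \<Rightarrow> ('a \<Rightarrow> 'o) \<Rightarrow> ('b \<Rightarrow> 'm) \<Rightarrow>
   'o \<Rightarrow> ('a \<Rightarrow> 'm) \<Rightarrow> bool" where
  "is_cocone J C X x Z \<iota> \<longleftrightarrow>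
     Z \<in> Obj C \<and> (\<forall>j \<in> Obj J. \<iota> j \<in> homs C (X j) Z) \<and>
     (\<forall>f \<in> Arr J. \<iota> (Cod J f) \<cdot>\<^bsub>C\<^esub> x f = \<iota> (Dom J f))"

definition is_colimit ::
  "('a, 'b, 'y) cat_scheme \<Rightarrow> ('o, 'm, 'z) cat_scheme \<Rightarrow> ('a \<Rightarrow> 'o) \<Rightarrow> ('b \<Rightarrow> 'm) \<Rightarrow>
   'o \<Rightarrow> ('a \<Rightarrow> 'm) \<Rightarrow> bool" where
  "is_colimit J C X x Z \<iota> \<longleftrightarrow>
     is_cocone J C X x Z \<iota> \<and>
     (\<forall>Y \<kappa>. is_cocone J C X x Y \<kappa> \<longrightarrow>
        (\<exists>!h. h \<in> homs C Z Y \<and> (\<forall>j \<in> Obj J. h \<cdot>\<^bsub>C\<^esub> \<iota> j = \<kappa> j)))"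

definition cocomplete :: "'u itself \<Rightarrow> ('o, 'm, 'z) cat_scheme \<Rightarrow> bool" where
  "cocomplete U C \<longleftrightarrow>
     (\<forall>(J :: ('u, 'u) cat) X x.
        category J \<and> small U (Obj J) \<and> small U (Arr J) \<and> is_functor J C X x \<longrightarrow>
        (\<exists>Z \<iota>. is_colimit J C X x Z \<iota>))"

definition complete :: "'u itself \<Rightarrow> ('o, 'm, 'z) cat_scheme \<Rightarrow> bool" where
  "complete U C \<longleftrightarrow> cocomplete U (opp C)"

text \<open>The square with sides \<open>f\<close>, \<open>g\<close> (common domain) and \<open>i\<close>, \<open>j\<close> (common codomain),
  \<open>i \<circ> f = j \<circ> g\<close>, is a pushout; \<open>j\<close> is the cobase change of \<open>f\<close> along \<open>g\<close>.\<close>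

definition is_pushout :: "('o, 'm, 'z) cat_scheme \<Rightarrow> 'm \<Rightarrow> 'm \<Rightarrow> 'm \<Rightarrow> 'm \<Rightarrow> bool" where
  "is_pushout C f g i j \<longleftrightarrow>
     f \<in> Arr C \<and> g \<in> Arr C \<and> Dom C f = Dom C g \<and>
     i \<in> homs C (Cod C f) (Cod C i) \<and> j \<in> homs C (Cod C g) (Cod C i) \<and>
     i \<cdot>\<^bsub>C\<^esub> f = j \<cdot>\<^bsub>C\<^esub> g \<and>
     (\<forall>Y. \<forall>i' \<in> homs C (Cod C f) Y. \<forall>j' \<in> homs C (Cod C g) Y.
        i' \<cdot>\<^bsub>C\<^esub> f = j' \<cdot>\<^bsub>C\<^esub> g \<longrightarrow>
        (\<exists>!h. h \<in> homs C (Cod C i) Y \<and> h \<cdot>\<^bsub>C\<^esub> i = i' \<and> h \<cdot>\<^bsub>C\<^esub> j = j'))"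

definition is_retract :: "('o, 'm, 'z) cat_scheme \<Rightarrow> 'm \<Rightarrow> 'm \<Rightarrow> bool" where
  "is_retract C f g \<longleftrightarrow>
     f \<in> Arr C \<and> g \<in> Arr C \<and>
     (\<exists>s \<in> homs C (Dom C f) (Dom C g). \<exists>r \<in> homs C (Dom C g) (Dom C f).
      \<exists>s' \<in> homs C (Cod C f) (Cod C g). \<exists>r' \<in> homs C (Cod C g) (Cod C f).
        r \<cdot>\<^bsub>C\<^esub> s = Ident C (Dom C f) \<and> r' \<cdot>\<^bsub>C\<^esub> s' = Ident C (Cod C f) \<and>
        g \<cdot>\<^bsub>C\<^esub> s = s' \<cdot>\<^bsub>C\<^esub> f \<and> f \<cdot>\<^bsub>C\<^esub> r = r' \<cdot>\<^bsub>C\<^esub> g)"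


section \<open>Transfinite compositions and small objects\<close>

text \<open>Ordinals are represented by well-orders \<open>r :: 'u rel\<close> with small field.\<close>

definition ord_cat :: "'u rel \<Rightarrow> ('u, 'u \<times> 'u) cat" where
  "ord_cat r = \<lparr>Obj = Field r, Arr = r, Dom = fst, Cod = snd, Ident = (\<lambda>a. (a, a)),
                Comp = (\<lambda>g f. (fst f, snd g))\<rparr>"

definition is_ordinal :: "'u rel \<Rightarrow> bool" where
  "is_ordinal r \<longleftrightarrow> Well_order r \<and> small TYPE('u) (Field r)"

definition is_succ :: "'u rel \<Rightarrow> 'u \<Rightarrow> 'u \<Rightarrow> bool" where
  "is_succ r \<beta> \<gamma> \<longleftrightarrow> \<beta> \<in> underS r \<gamma> \<and> (\<forall>\<alpha> \<in> underS r \<gamma>. (\<alpha>, \<beta>) \<in> r)"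

definition is_limit_elem :: "'u rel \<Rightarrow> 'u \<Rightarrow> bool" where
  "is_limit_elem r \<gamma> \<longleftrightarrow> \<gamma> \<in> Field r \<and> underS r \<gamma> \<noteq> {} \<and> \<not> (\<exists>\<beta>. is_succ r \<beta> \<gamma>)"

text \<open>A colimit-preserving functor from the ordinal \<open>r\<close> to \<open>C\<close>; its value on \<open>\<beta> \<le> \<gamma>\<close> is \<open>x (\<beta>, \<gamma>)\<close>.\<close>

definition is_sequence ::
  "'u rel \<Rightarrow> ('o, 'm, 'z) cat_scheme \<Rightarrow> ('u \<Rightarrow> 'o) \<Rightarrow> ('u \<times> 'u \<Rightarrow> 'm) \<Rightarrow> bool" where
  "is_sequence r C X x \<longleftrightarrow>
     is_functor (ord_cat r) C X x \<and>
     (\<forall>\<gamma>. is_limit_elem r \<gamma> \<longrightarrow>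
        is_colimit (ord_cat (Restr r (underS r \<gamma>))) C X x (X \<gamma>) (\<lambda>\<beta>. x (\<beta>, \<gamma>)))"

definition sequence_in ::
  "'u rel \<Rightarrow> ('o, 'm, 'z) cat_scheme \<Rightarrow> 'm set \<Rightarrow> ('u \<Rightarrow> 'o) \<Rightarrow> ('u \<times> 'u \<Rightarrow> 'm) \<Rightarrow> bool" where
  "sequence_in r C D X x \<longleftrightarrow>
     is_sequence r C X x \<and> (\<forall>\<beta> \<gamma>. is_succ r \<beta> \<gamma> \<longrightarrow> x (\<beta>, \<gamma>) \<in> D)"

definition transfinite_comps :: "'u itself \<Rightarrow> ('o, 'm, 'z) cat_scheme \<Rightarrow> 'm set \<Rightarrow> 'm set" where
  "transfinite_comps U C D =
     {\<iota> b | \<iota> b. \<exists>(r :: 'u rel) X x Z.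
        is_ordinal r \<and> sequence_in r C D X x \<and> is_colimit (ord_cat r) C X x Z \<iota> \<and>
        b \<in> Field r \<and> (\<forall>\<beta> \<in> Field r. (b, \<beta>) \<in> r)}"

definition cobase_changes :: "('o, 'm, 'z) cat_scheme \<Rightarrow> 'm set \<Rightarrow> 'm set" where
  "cobase_changes C D = {j. \<exists>f \<in> D. \<exists>g i. is_pushout C f g i j}"

definition rel_cells :: "'u itself \<Rightarrow> ('o, 'm, 'z) cat_scheme \<Rightarrow> 'm set \<Rightarrow> 'm set" where
  "rel_cells U C D = transfinite_comps U C (cobase_changes C D)"

text \<open>For a cardinal \<open>\<kappa> = |K|\<close>, the ordinal \<open>r\<close> is \<open>\<kappa>\<close>-filtered: a (nonzero) limit ordinal in which
  every subset of cardinality at most \<open>\<kappa>\<close> is bounded.\<close>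

definition filtered_ordinal :: "'u set \<Rightarrow> 'u rel \<Rightarrow> bool" where
  "filtered_ordinal K r \<longleftrightarrow>
     is_ordinal r \<and> Field r \<noteq> {} \<and> (\<forall>\<alpha> \<in> Field r. \<exists>\<beta>. \<alpha> \<in> underS r \<beta>) \<and>
     (\<forall>A \<subseteq> Field r. |A| \<le>o |K| \<longrightarrow> (\<exists>\<beta> \<in> Field r. \<forall>\<alpha> \<in> A. (\<alpha>, \<beta>) \<in> r))"

text \<open>\<open>A\<close> is small relative to \<open>D\<close>: for some \<open>\<kappa>\<close> and all sequences in \<open>D\<close> indexed by \<open>\<kappa>\<close>-filtered
  ordinals, the map \<open>colim C(A, X \<beta>) \<rightarrow> C(A, colim X)\<close> is a bijection. The two conjuncts say
  that it is surjective and injective, the colimit of sets being directed.\<close>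

definition small_rel :: "'u itself \<Rightarrow> ('o, 'm, 'z) cat_scheme \<Rightarrow> 'm set \<Rightarrow> 'o \<Rightarrow> bool" where
  "small_rel U C D A \<longleftrightarrow>
     A \<in> Obj C \<and>
     (\<exists>K :: 'u set. small U K \<and>
       (\<forall>r X x Z \<iota>.
          filtered_ordinal K r \<and> sequence_in r C D X x \<and> is_colimit (ord_cat r) C X x Z \<iota> \<longrightarrow>
          (\<forall>f \<in> homs C A Z. \<exists>\<beta> \<in> Field r. \<exists>g \<in> homs C A (X \<beta>). f = \<iota> \<beta> \<cdot>\<^bsub>C\<^esub> g) \<and>
          (\<forall>\<beta> \<in> Field r. \<forall>g \<in> homs C A (X \<beta>). \<forall>g' \<in> homs C A (X \<beta>).
             \<iota> \<beta> \<cdot>\<^bsub>C\<^esub> g = \<iota> \<beta> \<cdot>\<^bsub>C\<^esub> g' \<longrightarrow>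
             (\<exists>\<gamma>. (\<beta>, \<gamma>) \<in> r \<and> x (\<beta>, \<gamma>) \<cdot>\<^bsub>C\<^esub> g = x (\<beta>, \<gamma>) \<cdot>\<^bsub>C\<^esub> g'))))"

definition filtered_cat :: "('a, 'b, 'y) cat_scheme \<Rightarrow> bool" where
  "filtered_cat J \<longleftrightarrow>
     category J \<and> Obj J \<noteq> {} \<and>
     (\<forall>i \<in> Obj J. \<forall>j \<in> Obj J. \<exists>k \<in> Obj J. homs J i k \<noteq> {} \<and> homs J j k \<noteq> {}) \<and>
     (\<forall>i \<in> Obj J. \<forall>j \<in> Obj J. \<forall>f \<in> homs J i j. \<forall>g \<in> homs J i j.
        \<exists>k \<in> Obj J. \<exists>h \<in> homs J j k. h \<cdot>\<^bsub>J\<^esub> f = h \<cdot>\<^bsub>J\<^esub> g)"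


section \<open>Model categories\<close>

record 'm model_str =
  Weq :: "'m set"
  Cof :: "'m set"
  Fib :: "'m set"

definition lifts_against :: "('o, 'm, 'z) cat_scheme \<Rightarrow> 'm \<Rightarrow> 'm \<Rightarrow> bool" where
  "lifts_against C i p \<longleftrightarrow>
     (\<forall>f \<in> homs C (Dom C i) (Dom C p). \<forall>g \<in> homs C (Cod C i) (Cod C p).
        p \<cdot>\<^bsub>C\<^esub> f = g \<cdot>\<^bsub>C\<^esub> i \<longrightarrow>
        (\<exists>h \<in> homs C (Cod C i) (Dom C p). h \<cdot>\<^bsub>C\<^esub> i = f \<and> p \<cdot>\<^bsub>C\<^esub> h = g))"

definition llp :: "('o, 'm, 'z) cat_scheme \<Rightarrow> 'm set \<Rightarrow> 'm set" where
  "llp C S = {i \<in> Arr C. \<forall>p \<in> S. lifts_against C i p}"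

definition rlp :: "('o, 'm, 'z) cat_scheme \<Rightarrow> 'm set \<Rightarrow> 'm set" where
  "rlp C S = {p \<in> Arr C. \<forall>i \<in> S. lifts_against C i p}"

definition retract_closed :: "('o, 'm, 'z) cat_scheme \<Rightarrow> 'm set \<Rightarrow> bool" where
  "retract_closed C S \<longleftrightarrow> (\<forall>f g. g \<in> S \<and> is_retract C f g \<longrightarrow> f \<in> S)"

definition two_out_of_three :: "('o, 'm, 'z) cat_scheme \<Rightarrow> 'm set \<Rightarrow> bool" where
  "two_out_of_three C W \<longleftrightarrow>
     (\<forall>f \<in> Arr C. \<forall>g \<in> Arr C. Dom C g = Cod C f \<longrightarrow>
        (f \<in> W \<and> g \<in> W \<longrightarrow> g \<cdot>\<^bsub>C\<^esub> f \<in> W) \<and>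
        (f \<in> W \<and> g \<cdot>\<^bsub>C\<^esub> f \<in> W \<longrightarrow> g \<in> W) \<and>
        (g \<in> W \<and> g \<cdot>\<^bsub>C\<^esub> f \<in> W \<longrightarrow> f \<in> W))"

definition model_category ::
  "'u itself \<Rightarrow> ('o, 'm, 'z) cat_scheme \<Rightarrow> 'm model_str \<Rightarrow> bool" where
  "model_category U C M \<longleftrightarrow>
     category C \<and> complete U C \<and> cocomplete U C \<and>
     Weq M \<subseteq> Arr C \<and> Cof M \<subseteq> Arr C \<and> Fib M \<subseteq> Arr C \<and>
     two_out_of_three C (Weq M) \<and>
     retract_closed C (Weq M) \<and> retract_closed C (Cof M) \<and> retract_closed C (Fib M) \<and>
     (\<forall>i \<in> Cof M \<inter> Weq M. \<forall>p \<in> Fib M. lifts_against C i p) \<and>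
     (\<forall>i \<in> Cof M. \<forall>p \<in> Fib M \<inter> Weq M. lifts_against C i p) \<and>
     (\<forall>f \<in> Arr C. \<exists>i \<in> Cof M \<inter> Weq M. \<exists>p \<in> Fib M. Dom C p = Cod C i \<and> f = p \<cdot>\<^bsub>C\<^esub> i) \<and>
     (\<forall>f \<in> Arr C. \<exists>i \<in> Cof M. \<exists>p \<in> Fib M \<inter> Weq M. Dom C p = Cod C i \<and> f = p \<cdot>\<^bsub>C\<^esub> i)"

definition cofibrantly_generated ::
  "'u itself \<Rightarrow> ('o, 'm, 'z) cat_scheme \<Rightarrow> 'm model_str \<Rightarrow> bool" where
  "cofibrantly_generated U C M \<longleftrightarrow>
     (\<exists>I J. I \<subseteq> Arr C \<and> J \<subseteq> Arr C \<and> small U I \<and> small U J \<and>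
        (\<forall>f \<in> I. small_rel U C (rel_cells U C I) (Dom C f)) \<and>
        (\<forall>f \<in> J. small_rel U C (rel_cells U C J) (Dom C f)) \<and>
        Fib M = rlp C J \<and> Fib M \<inter> Weq M = rlp C I)"

definition cofibrant :: "('o, 'm, 'z) cat_scheme \<Rightarrow> 'm model_str \<Rightarrow> 'o \<Rightarrow> bool" where
  "cofibrant C M X \<longleftrightarrow> (\<exists>X0 f. initial C X0 \<and> f \<in> homs C X0 X \<and> f \<in> Cof M)"


section \<open>Monoidal model categories\<close>

record ('o, 'm) smcat = "('o, 'm) cat" +
  Tens :: "'o \<Rightarrow> 'o \<Rightarrow> 'o"  (infixr "\<otimes>\<index>" 70)
  TensA :: "'m \<Rightarrow> 'm \<Rightarrow> 'm"  (infixr "\<boxtimes>\<index>" 70)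
  Unit :: 'o
  Assoc :: "'o \<Rightarrow> 'o \<Rightarrow> 'o \<Rightarrow> 'm"
  LUnit :: "'o \<Rightarrow> 'm"
  RUnit :: "'o \<Rightarrow> 'm"
  Braid :: "'o \<Rightarrow> 'o \<Rightarrow> 'm"

locale closed_symmetric_monoidal_category =
  category V for V :: "('o, 'm) smcat" (structure) +
  assumes Unit_Obj: "Unit V \<in> Obj V"
    and Tens_Obj: "X \<in> Obj V \<Longrightarrow> Y \<in> Obj V \<Longrightarrow> X \<otimes> Y \<in> Obj V"
    and TensA_homs: "f \<in> homs V X X' \<Longrightarrow> g \<in> homs V Y Y' \<Longrightarrow>
      f \<boxtimes> g \<in> homs V (X \<otimes> Y) (X' \<otimes> Y')"
    and TensA_Ident: "X \<in> Obj V \<Longrightarrow> Y \<in> Obj V \<Longrightarrow>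
      Ident V X \<boxtimes> Ident V Y = Ident V (X \<otimes> Y)"
    and TensA_Comp: "f \<in> homs V X X' \<Longrightarrow> f' \<in> homs V X' X'' \<Longrightarrow>
      g \<in> homs V Y Y' \<Longrightarrow> g' \<in> homs V Y' Y'' \<Longrightarrow>
      (f' \<cdot> f) \<boxtimes> (g' \<cdot> g) = (f' \<boxtimes> g') \<cdot> (f \<boxtimes> g)"
    and Assoc_homs: "X \<in> Obj V \<Longrightarrow> Y \<in> Obj V \<Longrightarrow> Z \<in> Obj V \<Longrightarrow>
      Assoc V X Y Z \<in> homs V ((X \<otimes> Y) \<otimes> Z) (X \<otimes> (Y \<otimes> Z))"
    and Assoc_iso: "X \<in> Obj V \<Longrightarrow> Y \<in> Obj V \<Longrightarrow> Z \<in> Obj V \<Longrightarrow> is_iso V (Assoc V X Y Z)"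
    and Assoc_nat: "f \<in> homs V X X' \<Longrightarrow> g \<in> homs V Y Y' \<Longrightarrow> h \<in> homs V Z Z' \<Longrightarrow>
      Assoc V X' Y' Z' \<cdot> ((f \<boxtimes> g) \<boxtimes> h) = (f \<boxtimes> (g \<boxtimes> h)) \<cdot> Assoc V X Y Z"
    and LUnit_homs: "X \<in> Obj V \<Longrightarrow> LUnit V X \<in> homs V (Unit V \<otimes> X) X"
    and LUnit_iso: "X \<in> Obj V \<Longrightarrow> is_iso V (LUnit V X)"
    and LUnit_nat: "f \<in> homs V X Y \<Longrightarrow>
      LUnit V Y \<cdot> (Ident V (Unit V) \<boxtimes> f) = f \<cdot> LUnit V X"
    and RUnit_homs: "X \<in> Obj V \<Longrightarrow> RUnit V X \<in> homs V (X \<otimes> Unit V) X"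
    and RUnit_iso: "X \<in> Obj V \<Longrightarrow> is_iso V (RUnit V X)"
    and RUnit_nat: "f \<in> homs V X Y \<Longrightarrow>
      RUnit V Y \<cdot> (f \<boxtimes> Ident V (Unit V)) = f \<cdot> RUnit V X"
    and Braid_homs: "X \<in> Obj V \<Longrightarrow> Y \<in> Obj V \<Longrightarrow> Braid V X Y \<in> homs V (X \<otimes> Y) (Y \<otimes> X)"
    and Braid_nat: "f \<in> homs V X X' \<Longrightarrow> g \<in> homs V Y Y' \<Longrightarrow>
      Braid V X' Y' \<cdot> (f \<boxtimes> g) = (g \<boxtimes> f) \<cdot> Braid V X Y"
    and pentagon: "W \<in> Obj V \<Longrightarrow> X \<in> Obj V \<Longrightarrow> Y \<in> Obj V \<Longrightarrow> Z \<in> Obj V \<Longrightarrow>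
      (Ident V W \<boxtimes> Assoc V X Y Z) \<cdot> Assoc V W (X \<otimes> Y) Z \<cdot> (Assoc V W X Y \<boxtimes> Ident V Z)
      = Assoc V W X (Y \<otimes> Z) \<cdot> Assoc V (W \<otimes> X) Y Z"
    and triangle: "X \<in> Obj V \<Longrightarrow> Y \<in> Obj V \<Longrightarrow>
      (Ident V X \<boxtimes> LUnit V Y) \<cdot> Assoc V X (Unit V) Y = RUnit V X \<boxtimes> Ident V Y"
    and hexagon: "X \<in> Obj V \<Longrightarrow> Y \<in> Obj V \<Longrightarrow> Z \<in> Obj V \<Longrightarrow>
      Assoc V Y Z X \<cdot> Braid V X (Y \<otimes> Z) \<cdot> Assoc V X Y Z
      = (Ident V Y \<boxtimes> Braid V X Z) \<cdot> Assoc V Y X Z \<cdot> (Braid V X Y \<boxtimes> Ident V Z)"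
    and symmetry: "X \<in> Obj V \<Longrightarrow> Y \<in> Obj V \<Longrightarrow>
      Braid V Y X \<cdot> Braid V X Y = Ident V (X \<otimes> Y)"
    and closed: "X \<in> Obj V \<Longrightarrow> Y \<in> Obj V \<Longrightarrow>
      \<exists>E \<in> Obj V. \<exists>ev \<in> homs V (E \<otimes> X) Y. \<forall>Z \<in> Obj V. \<forall>f \<in> homs V (Z \<otimes> X) Y.
        \<exists>!g. g \<in> homs V Z E \<and> ev \<cdot> (g \<boxtimes> Ident V X) = f"

text \<open>Here \<open>h : A \<otimes> L \<squnion>\<^bsub>A \<otimes> K\<^esub> B \<otimes> K \<rightarrow> B \<otimes> L\<close> is the pushout-product of \<open>f : A \<rightarrow> B\<close> and
  \<open>g : K \<rightarrow> L\<close>.\<close>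

definition is_pushout_product :: "('o, 'm) smcat \<Rightarrow> 'm \<Rightarrow> 'm \<Rightarrow> 'm \<Rightarrow> bool" where
  "is_pushout_product V f g h \<longleftrightarrow>
     (\<exists>i j. is_pushout V (Ident V (Dom V f) \<boxtimes>\<^bsub>V\<^esub> g) (f \<boxtimes>\<^bsub>V\<^esub> Ident V (Dom V g)) i j \<and>
        h \<in> homs V (Cod V i) (Cod V f \<otimes>\<^bsub>V\<^esub> Cod V g) \<and>
        h \<cdot>\<^bsub>V\<^esub> i = f \<boxtimes>\<^bsub>V\<^esub> Ident V (Cod V g) \<and>
        h \<cdot>\<^bsub>V\<^esub> j = Ident V (Cod V f) \<boxtimes>\<^bsub>V\<^esub> g)"

definition pushout_product_axiom :: "('o, 'm) smcat \<Rightarrow> 'm model_str \<Rightarrow> bool" where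
  "pushout_product_axiom V M \<longleftrightarrow>
     (\<forall>f \<in> Cof M. \<forall>g \<in> Cof M. \<forall>h. is_pushout_product V f g h \<longrightarrow>
        h \<in> Cof M \<and> (f \<in> Weq M \<or> g \<in> Weq M \<longrightarrow> h \<in> Weq M))"

definition unit_axiom :: "('o, 'm) smcat \<Rightarrow> 'm model_str \<Rightarrow> bool" where
  "unit_axiom V M \<longleftrightarrow>
     (\<forall>Q X q. cofibrant V M Q \<and> q \<in> homs V Q (Unit V) \<and> q \<in> Fib M \<inter> Weq M \<and> cofibrant V M X \<longrightarrow>
        q \<boxtimes>\<^bsub>V\<^esub> Ident V X \<in> Weq M \<and> Ident V X \<boxtimes>\<^bsub>V\<^esub> q \<in> Weq M)"

definition monoidal_model_category ::
  "'u itself \<Rightarrow> ('o, 'm) smcat \<Rightarrow> 'm model_str \<Rightarrow> bool" where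
  "monoidal_model_category U V M \<longleftrightarrow>
     closed_symmetric_monoidal_category V \<and> locally_small U V \<and>
     model_category U V M \<and> cofibrantly_generated U V M \<and>
     pushout_product_axiom V M \<and> unit_axiom V M"


section \<open>Compact generation\<close>

definition monoidally_saturated :: "'u itself \<Rightarrow> ('o, 'm) smcat \<Rightarrow> 'm set \<Rightarrow> bool" where
  "monoidally_saturated U V D \<longleftrightarrow>
     D \<subseteq> Arr V \<and>
     cobase_changes V D \<subseteq> D \<and> transfinite_comps U V D \<subseteq> D \<and> retract_closed V D \<and>
     (\<forall>f \<in> D. \<forall>X \<in> Obj V. f \<boxtimes>\<^bsub>V\<^esub> Ident V X \<in> D \<and> Ident V X \<boxtimes>\<^bsub>V\<^esub> f \<in> D)"

definition tensor_cofs :: "'u itself \<Rightarrow> ('o, 'm) smcat \<Rightarrow> 'm model_str \<Rightarrow> 'm set" where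
  "tensor_cofs U V M = \<Inter> {D. monoidally_saturated U V D \<and> Cof M \<subseteq> D}"

text \<open>Closure of \<open>W\<close> under filtered colimits along \<open>D\<close>: a filtered colimit, in the category of
  arrows, of maps in \<open>W\<close>, where the transition maps on domains and codomains lie in \<open>D\<close>.\<close>

definition perfect_along ::
  "'u itself \<Rightarrow> ('o, 'm, 'z) cat_scheme \<Rightarrow> 'm set \<Rightarrow> 'm set \<Rightarrow> bool" where
  "perfect_along U C D W \<longleftrightarrow>
     (\<forall>(J :: ('u, 'u) cat) X x Y y \<tau> Z \<iota> Z' \<iota>' h.
        filtered_cat J \<and> small U (Obj J) \<and> small U (Arr J) \<and>
        is_functor J C X x \<and> is_functor J C Y y \<and>
        (\<forall>f \<in> Arr J. x f \<in> D \<and> y f \<in> D) \<and>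
        (\<forall>j \<in> Obj J. \<tau> j \<in> homs C (X j) (Y j) \<and> \<tau> j \<in> W) \<and>
        (\<forall>f \<in> Arr J. \<tau> (Cod J f) \<cdot>\<^bsub>C\<^esub> x f = y f \<cdot>\<^bsub>C\<^esub> \<tau> (Dom J f)) \<and>
        is_colimit J C X x Z \<iota> \<and> is_colimit J C Y y Z' \<iota>' \<and>
        h \<in> homs C Z Z' \<and> (\<forall>j \<in> Obj J. h \<cdot>\<^bsub>C\<^esub> \<iota> j = \<iota>' j \<cdot>\<^bsub>C\<^esub> \<tau> j) \<longrightarrow>
        h \<in> W)"

definition compactly_generated ::
  "'u itself \<Rightarrow> ('o, 'm) smcat \<Rightarrow> 'm model_str \<Rightarrow> bool" where
  "compactly_generated U V M \<longleftrightarrow>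
     (\<forall>X \<in> Obj V. small_rel U V (tensor_cofs U V M) X) \<and>
     perfect_along U V (tensor_cofs U V M) (Weq M)"


section \<open>Categories of structured objects and transferred model structures\<close>

text \<open>The category with set of objects \<open>S\<close> and with sets of maps \<open>h A B\<close>; an arrow records its
  domain and codomain.\<close>

definition struct_cat ::
  "'x set \<Rightarrow> ('x \<Rightarrow> 'x \<Rightarrow> 'f set) \<Rightarrow> ('x \<Rightarrow> 'f) \<Rightarrow> ('f \<Rightarrow> 'f \<Rightarrow> 'f) \<Rightarrow> ('x, 'x \<times> 'x \<times> 'f) cat" where
  "struct_cat S h e c =
     \<lparr>Obj = S,
      Arr = {(A, B, f) | A B f. A \<in> S \<and> B \<in> S \<and> f \<in> h A B},
      Dom = (\<lambda>(A, B, f). A),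
      Cod = (\<lambda>(A, B, f). B),
      Ident = (\<lambda>A. (A, A, e A)),
      Comp = (\<lambda>(B', D, g) (A, B, f). (A, D, c g f))\<rparr>"

text \<open>The model structure on \<open>C\<close> (if it exists) with the given weak equivalences and fibrations;
  its cofibrations are then necessarily the maps with the left lifting property with respect to
  trivial fibrations. The argument \<open>u f\<close> is the set of maps of \<open>V\<close> underlying \<open>f\<close>.\<close>

definition transferred ::
  "('x, 'f, 'z) cat_scheme \<Rightarrow> ('f \<Rightarrow> 'm set) \<Rightarrow> 'm model_str \<Rightarrow> 'f model_str" where
  "transferred C u M =
     (let W = {f \<in> Arr C. u f \<subseteq> Weq M}; F = {f \<in> Arr C. u f \<subseteq> Fib M}
      in \<lparr>Weq = W, Cof = llp C (W \<inter> F), Fib = F\<rparr>)"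


section \<open>Non-symmetric coloured operads in sets and their algebras\<close>

text \<open>\<open>Opns P\<close> is the disjoint union of the sets \<open>P(c\<^sub>1,\<dots>,c\<^sub>n;c)\<close>; an operation has a list \<open>Src\<close> of input
  colours and an output colour \<open>Tgt\<close>. \<open>Plug p [q\<^sub>1,\<dots>,q\<^sub>n]\<close> is the simultaneous composition.\<close>

record 'u operad =
  Colours :: "'u set"
  Opns :: "'u set"
  Src :: "'u \<Rightarrow> 'u list"
  Tgt :: "'u \<Rightarrow> 'u"
  OpId :: "'u \<Rightarrow> 'u"
  Plug :: "'u \<Rightarrow> 'u list \<Rightarrow> 'u"

definition pluggable :: "'u operad \<Rightarrow> 'u \<Rightarrow> 'u list \<Rightarrow> bool" where
  "pluggable P p qs \<longleftrightarrow> p \<in> Opns P \<and> set qs \<subseteq> Opns P \<and> map (Tgt P) qs = Src P p"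

locale small_operad =
  fixes P :: "'u operad"
  assumes small_Colours: "small TYPE('u) (Colours P)"
    and small_Opns: "small TYPE('u) (Opns P)"
    and Src_Colours: "p \<in> Opns P \<Longrightarrow> set (Src P p) \<subseteq> Colours P"
    and Tgt_Colours: "p \<in> Opns P \<Longrightarrow> Tgt P p \<in> Colours P"
    and OpId_Opns: "c \<in> Colours P \<Longrightarrow>
      OpId P c \<in> Opns P \<and> Src P (OpId P c) = [c] \<and> Tgt P (OpId P c) = c"
    and Plug_Opns: "pluggable P p qs \<Longrightarrow>
      Plug P p qs \<in> Opns P \<and> Src P (Plug P p qs) = concat (map (Src P) qs) \<and>
      Tgt P (Plug P p qs) = Tgt P p"
    and Plug_OpId_left: "p \<in> Opns P \<Longrightarrow> Plug P (OpId P (Tgt P p)) [p] = p"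
    and Plug_OpId_right: "p \<in> Opns P \<Longrightarrow> Plug P p (map (OpId P) (Src P p)) = p"
    and Plug_assoc: "pluggable P p qs \<Longrightarrow> list_all2 (pluggable P) qs rss \<Longrightarrow>
      Plug P (Plug P p qs) (concat rss) = Plug P p (map2 (Plug P) qs rss)"

text \<open>Iterated tensor products \<open>X\<^sub>1 \<otimes> (X\<^sub>2 \<otimes> (\<dots> \<otimes> (X\<^sub>n \<otimes> I)))\<close> of objects and of arrows, with the
  canonical isomorphisms for concatenation of lists.\<close>

definition tens_list :: "('o, 'm) smcat \<Rightarrow> 'o list \<Rightarrow> 'o" where
  "tens_list V Xs = foldr (Tens V) Xs (Unit V)"

definition tensA_list :: "('o, 'm) smcat \<Rightarrow> 'm list \<Rightarrow> 'm" where
  "tensA_list V fs = foldr (TensA V) fs (Ident V (Unit V))"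

primrec tens_append :: "('o, 'm) smcat \<Rightarrow> 'o list \<Rightarrow> 'o list \<Rightarrow> 'm" where
  "tens_append V [] Ys = LUnit V (tens_list V Ys)"
| "tens_append V (X # Xs) Ys =
     (Ident V X \<boxtimes>\<^bsub>V\<^esub> tens_append V Xs Ys) \<cdot>\<^bsub>V\<^esub> Assoc V X (tens_list V Xs) (tens_list V Ys)"

primrec tens_concat :: "('o, 'm) smcat \<Rightarrow> 'o list list \<Rightarrow> 'm" where
  "tens_concat V [] = Ident V (Unit V)"
| "tens_concat V (Xs # Xss) =
     tens_append V Xs (concat Xss) \<cdot>\<^bsub>V\<^esub> (Ident V (tens_list V Xs) \<boxtimes>\<^bsub>V\<^esub> tens_concat V Xss)"

text \<open>A \<open>P\<close>-algebra \<open>(A, a)\<close>: objects \<open>A c\<close> and action maps \<open>a p : A c\<^sub>1 \<otimes> \<dots> \<otimes> A c\<^sub>n \<rightarrow> A c\<close>,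
  i.e. a map of coloured operads from \<open>P\<close> to the endomorphism operad of \<open>A\<close>.\<close>

definition is_algebra ::
  "('o, 'm) smcat \<Rightarrow> 'u operad \<Rightarrow> ('u \<Rightarrow> 'o) \<times> ('u \<Rightarrow> 'm) \<Rightarrow> bool" where
  "is_algebra V P = (\<lambda>(A, a).
     A \<in> Colours P \<rightarrow>\<^sub>E Obj V \<and> a \<in> extensional (Opns P) \<and>
     (\<forall>p \<in> Opns P. a p \<in> homs V (tens_list V (map A (Src P p))) (A (Tgt P p))) \<and>
     (\<forall>c \<in> Colours P. a (OpId P c) = RUnit V (A c)) \<and>
     (\<forall>p qs. pluggable P p qs \<longrightarrow>
        a (Plug P p qs) \<cdot>\<^bsub>V\<^esub> tens_concat V (map (\<lambda>q. map A (Src P q)) qs)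
        = a p \<cdot>\<^bsub>V\<^esub> tensA_list V (map a qs)))"

definition algebra_homs ::
  "('o, 'm) smcat \<Rightarrow> 'u operad \<Rightarrow> ('u \<Rightarrow> 'o) \<times> ('u \<Rightarrow> 'm) \<Rightarrow> ('u \<Rightarrow> 'o) \<times> ('u \<Rightarrow> 'm) \<Rightarrow>
   ('u \<Rightarrow> 'm) set" where
  "algebra_homs V P = (\<lambda>(A, a) (B, b).
     {f \<in> extensional (Colours P).
        (\<forall>c \<in> Colours P. f c \<in> homs V (A c) (B c)) \<and>
        (\<forall>p \<in> Opns P. f (Tgt P p) \<cdot>\<^bsub>V\<^esub> a p = b p \<cdot>\<^bsub>V\<^esub> tensA_list V (map f (Src P p)))})"

definition Alg ::
  "('o, 'm) smcat \<Rightarrow> 'u operad \<Rightarrow>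
   (('u \<Rightarrow> 'o) \<times> ('u \<Rightarrow> 'm),
    (('u \<Rightarrow> 'o) \<times> ('u \<Rightarrow> 'm)) \<times> (('u \<Rightarrow> 'o) \<times> ('u \<Rightarrow> 'm)) \<times> ('u \<Rightarrow> 'm)) cat" where
  "Alg V P = struct_cat {A. is_algebra V P A} (algebra_homs V P)
     (\<lambda>(A, a). \<lambda>c \<in> Colours P. Ident V (A c)) (\<lambda>g f. \<lambda>c \<in> Colours P. g c \<cdot>\<^bsub>V\<^esub> f c)"

definition Alg_model where
  "Alg_model V M P = transferred (Alg V P) (\<lambda>(A, B, f). f ` Colours P) M"

definition adequate :: "'u itself \<Rightarrow> ('o, 'm) smcat \<Rightarrow> 'm model_str \<Rightarrow> bool" where
  "adequate U V M \<longleftrightarrow>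
     compactly_generated U V M \<and>
     (\<forall>P :: 'u operad. small_operad P \<longrightarrow> model_category U (Alg V P) (Alg_model V M P))"


section \<open>Enriched categories with a fixed object set\<close>

text \<open>The object set is the type \<open>'s\<close>. Composition is
  \<open>VComp H x y z : H(y,z) \<otimes> H(x,y) \<rightarrow> H(x,z)\<close>.\<close>

record ('s, 'o, 'm) vcat =
  Hom :: "'s \<Rightarrow> 's \<Rightarrow> 'o"
  VComp :: "'s \<Rightarrow> 's \<Rightarrow> 's \<Rightarrow> 'm"
  VUnit :: "'s \<Rightarrow> 'm"

definition is_vcat :: "('o, 'm) smcat \<Rightarrow> ('s, 'o, 'm) vcat \<Rightarrow> bool" where
  "is_vcat V H \<longleftrightarrow>
     (\<forall>x y. Hom H x y \<in> Obj V) \<and>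
     (\<forall>x y z. VComp H x y z \<in> homs V (Hom H y z \<otimes>\<^bsub>V\<^esub> Hom H x y) (Hom H x z)) \<and>
     (\<forall>x. VUnit H x \<in> homs V (Unit V) (Hom H x x)) \<and>
     (\<forall>w x y z.
        VComp H w x z \<cdot>\<^bsub>V\<^esub> (VComp H x y z \<boxtimes>\<^bsub>V\<^esub> Ident V (Hom H w x))
        = VComp H w y z \<cdot>\<^bsub>V\<^esub> (Ident V (Hom H y z) \<boxtimes>\<^bsub>V\<^esub> VComp H w x y)
            \<cdot>\<^bsub>V\<^esub> Assoc V (Hom H y z) (Hom H x y) (Hom H w x)) \<and>
     (\<forall>x y. VComp H x y y \<cdot>\<^bsub>V\<^esub> (VUnit H y \<boxtimes>\<^bsub>V\<^esub> Ident V (Hom H x y)) = LUnit V (Hom H x y)) \<and>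
     (\<forall>x y. VComp H x x y \<cdot>\<^bsub>V\<^esub> (Ident V (Hom H x y) \<boxtimes>\<^bsub>V\<^esub> VUnit H x) = RUnit V (Hom H x y))"

definition vfunctors ::
  "('o, 'm) smcat \<Rightarrow> ('s, 'o, 'm) vcat \<Rightarrow> ('s, 'o, 'm) vcat \<Rightarrow> ('s \<Rightarrow> 's \<Rightarrow> 'm) set" where
  "vfunctors V H K =
     {F. (\<forall>x y. F x y \<in> homs V (Hom H x y) (Hom K x y)) \<and>
         (\<forall>x y z. F x z \<cdot>\<^bsub>V\<^esub> VComp H x y z = VComp K x y z \<cdot>\<^bsub>V\<^esub> (F y z \<boxtimes>\<^bsub>V\<^esub> F x y)) \<and>
         (\<forall>x. F x x \<cdot>\<^bsub>V\<^esub> VUnit H x = VUnit K x)}"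

definition VCat ::
  "('o, 'm) smcat \<Rightarrow>
   (('s, 'o, 'm) vcat, ('s, 'o, 'm) vcat \<times> ('s, 'o, 'm) vcat \<times> ('s \<Rightarrow> 's \<Rightarrow> 'm)) cat" where
  "VCat V = struct_cat {H. is_vcat V H} (vfunctors V)
     (\<lambda>H x y. Ident V (Hom H x y)) (\<lambda>G F x y. G x y \<cdot>\<^bsub>V\<^esub> F x y)"

definition VCat_model where
  "VCat_model V M = transferred (VCat V) (\<lambda>(H, K, F). {F x y | x y. True}) M"

text \<open>The object set \<open>{0, 1}\<close>.\<close>

datatype two = Zero | One


section \<open>Monoids and modules\<close>

record ('o, 'm) mon =
  MCar :: 'o
  MMul :: 'm
  MOne :: 'm

definition is_monoid :: "('o, 'm) smcat \<Rightarrow> ('o, 'm) mon \<Rightarrow> bool" where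
  "is_monoid V R \<longleftrightarrow>
     MCar R \<in> Obj V \<and>
     MMul R \<in> homs V (MCar R \<otimes>\<^bsub>V\<^esub> MCar R) (MCar R) \<and>
     MOne R \<in> homs V (Unit V) (MCar R) \<and>
     MMul R \<cdot>\<^bsub>V\<^esub> (MMul R \<boxtimes>\<^bsub>V\<^esub> Ident V (MCar R))
       = MMul R \<cdot>\<^bsub>V\<^esub> (Ident V (MCar R) \<boxtimes>\<^bsub>V\<^esub> MMul R) \<cdot>\<^bsub>V\<^esub> Assoc V (MCar R) (MCar R) (MCar R) \<and>
     MMul R \<cdot>\<^bsub>V\<^esub> (MOne R \<boxtimes>\<^bsub>V\<^esub> Ident V (MCar R)) = LUnit V (MCar R) \<and>
     MMul R \<cdot>\<^bsub>V\<^esub> (Ident V (MCar R) \<boxtimes>\<^bsub>V\<^esub> MOne R) = RUnit V (MCar R)"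

definition monoid_homs :: "('o, 'm) smcat \<Rightarrow> ('o, 'm) mon \<Rightarrow> ('o, 'm) mon \<Rightarrow> 'm set" where
  "monoid_homs V R S =
     {f \<in> homs V (MCar R) (MCar S).
        f \<cdot>\<^bsub>V\<^esub> MMul R = MMul S \<cdot>\<^bsub>V\<^esub> (f \<boxtimes>\<^bsub>V\<^esub> f) \<and> f \<cdot>\<^bsub>V\<^esub> MOne R = MOne S}"

definition Mon ::
  "('o, 'm) smcat \<Rightarrow> (('o, 'm) mon, ('o, 'm) mon \<times> ('o, 'm) mon \<times> 'm) cat" where
  "Mon V = struct_cat {R. is_monoid V R} (monoid_homs V) (\<lambda>R. Ident V (MCar R)) (Comp V)"

definition Mon_model where
  "Mon_model V M = transferred (Mon V) (\<lambda>(R, S, f). {f}) M"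

record ('o, 'm) module =
  Car :: 'o
  Act :: 'm

definition is_left_module :: "('o, 'm) smcat \<Rightarrow> ('o, 'm) mon \<Rightarrow> ('o, 'm) module \<Rightarrow> bool" where
  "is_left_module V R N \<longleftrightarrow>
     Car N \<in> Obj V \<and>
     Act N \<in> homs V (MCar R \<otimes>\<^bsub>V\<^esub> Car N) (Car N) \<and>
     Act N \<cdot>\<^bsub>V\<^esub> (MMul R \<boxtimes>\<^bsub>V\<^esub> Ident V (Car N))
       = Act N \<cdot>\<^bsub>V\<^esub> (Ident V (MCar R) \<boxtimes>\<^bsub>V\<^esub> Act N) \<cdot>\<^bsub>V\<^esub> Assoc V (MCar R) (MCar R) (Car N) \<and>
     Act N \<cdot>\<^bsub>V\<^esub> (MOne R \<boxtimes>\<^bsub>V\<^esub> Ident V (Car N)) = LUnit V (Car N)"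

definition left_module_homs ::
  "('o, 'm) smcat \<Rightarrow> ('o, 'm) mon \<Rightarrow> ('o, 'm) module \<Rightarrow> ('o, 'm) module \<Rightarrow> 'm set" where
  "left_module_homs V R N N' =
     {f \<in> homs V (Car N) (Car N'). f \<cdot>\<^bsub>V\<^esub> Act N = Act N' \<cdot>\<^bsub>V\<^esub> (Ident V (MCar R) \<boxtimes>\<^bsub>V\<^esub> f)}"

definition LMod ::
  "('o, 'm) smcat \<Rightarrow> ('o, 'm) mon \<Rightarrow>
   (('o, 'm) module, ('o, 'm) module \<times> ('o, 'm) module \<times> 'm) cat" where
  "LMod V R = struct_cat {N. is_left_module V R N} (left_module_homs V R)
     (\<lambda>N. Ident V (Car N)) (Comp V)"

definition LMod_model where
  "LMod_model V M R = transferred (LMod V R) (\<lambda>(N, N', f). {f}) M"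

definition is_right_module :: "('o, 'm) smcat \<Rightarrow> ('o, 'm) mon \<Rightarrow> ('o, 'm) module \<Rightarrow> bool" where
  "is_right_module V R N \<longleftrightarrow>
     Car N \<in> Obj V \<and>
     Act N \<in> homs V (Car N \<otimes>\<^bsub>V\<^esub> MCar R) (Car N) \<and>
     Act N \<cdot>\<^bsub>V\<^esub> (Act N \<boxtimes>\<^bsub>V\<^esub> Ident V (MCar R))
       = Act N \<cdot>\<^bsub>V\<^esub> (Ident V (Car N) \<boxtimes>\<^bsub>V\<^esub> MMul R) \<cdot>\<^bsub>V\<^esub> Assoc V (Car N) (MCar R) (MCar R) \<and>
     Act N \<cdot>\<^bsub>V\<^esub> (Ident V (Car N) \<boxtimes>\<^bsub>V\<^esub> MOne R) = RUnit V (Car N)"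

definition right_module_homs ::
  "('o, 'm) smcat \<Rightarrow> ('o, 'm) mon \<Rightarrow> ('o, 'm) module \<Rightarrow> ('o, 'm) module \<Rightarrow> 'm set" where
  "right_module_homs V R N N' =
     {f \<in> homs V (Car N) (Car N'). f \<cdot>\<^bsub>V\<^esub> Act N = Act N' \<cdot>\<^bsub>V\<^esub> (f \<boxtimes>\<^bsub>V\<^esub> Ident V (MCar R))}"

definition RMod ::
  "('o, 'm) smcat \<Rightarrow> ('o, 'm) mon \<Rightarrow>
   (('o, 'm) module, ('o, 'm) module \<times> ('o, 'm) module \<times> 'm) cat" where
  "RMod V R = struct_cat {N. is_right_module V R N} (right_module_homs V R)
     (\<lambda>N. Ident V (Car N)) (Comp V)"

definition RMod_model where
  "RMod_model V M R = transferred (RMod V R) (\<lambda>(N, N', f). {f}) M"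

definition endo_monoid :: "('s, 'o, 'm) vcat \<Rightarrow> 's \<Rightarrow> ('o, 'm) mon" where
  "endo_monoid H x = \<lparr>MCar = Hom H x x, MMul = VComp H x x x, MOne = VUnit H x\<rparr>"

text \<open>\<open>H(x,y)\<close> as a left \<open>H(y,y)\<close>-module and as a right \<open>H(x,x)\<close>-module.\<close>

definition hom_left_module :: "('s, 'o, 'm) vcat \<Rightarrow> 's \<Rightarrow> 's \<Rightarrow> ('o, 'm) module" where
  "hom_left_module H x y = \<lparr>Car = Hom H x y, Act = VComp H x y y\<rparr>"

definition hom_right_module :: "('s, 'o, 'm) vcat \<Rightarrow> 's \<Rightarrow> 's \<Rightarrow> ('o, 'm) module" where
  "hom_right_module H x y = \<lparr>Car = Hom H x y, Act = VComp H x x y\<rparr>"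

end

(*
  No filtration of cofibrant objects is needed. Fix an object b of H and regard the hom-objects
  H(x,b) as a monoid R = H(b,b) with left modules; such families are the algebras of an operad in
  sets, so by adequacy there is a cofibrant family L with a trivial fibration e onto (H(x,b)). Its
  monoid is A = L(b), and the L(x) are cofibrant left A-modules (for x = b because the unit is
  cofibrant). Put

    K(x,y) = Hom_A(L(y), L(x)) x H(x,y), fibred over Hom_A(L(y), H(x,b)).

  This is an enriched category over H, and by the pushout-product axiom K -> H is a trivial
  fibration on each hom-object. As H is cofibrant, K -> H has a section; evaluating at the unit of
  A = L(b) maps K(x,b) to L(x), so that the section of K -> H induces one of e. Thus the family
  (H(x,b)) is a retract of a cofibrant family, which says that H(b,b) is a cofibrant monoid and the
  other H(x,b) are cofibrant left modules. Right modules are left modules for the opposite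
  enriched category.
*)
theory Submission
  imports Defs "HOL-Library.Countable"
begin

text \<open>A family sees only the maps into \<open>b\<close>, while cofibrancy of \<open>H\<close>
  is tested against enriched functors on all hom-objects, so a lifting problem of families is not
  directly a lifting problem for \<open>H\<close>. The category \<open>K\<close> bridges the two: it
  is the universal enriched category over \<open>H\<close> that acts on \<open>L\<close> compatibly
  with \<open>e\<close>. The arguments are reversed because precomposition with
  \<open>H(x,y)\<close> sends \<open>H(y,b)\<close> to \<open>H(x,b)\<close>. At \<open>b\<close> no
  information is lost: \<open>L(b)\<close> is free on one generator, so Hom_A(L(b), L(x)) is
  \<open>L(x)\<close>, and the projection \<open>K(x,b) -> H(x,b)\<close> is \<open>e x\<close> up
  to isomorphism. Hence a section of enriched functors contains a section of families. For general
  \<open>y\<close> the projection is a pullback of Hom_A(L(y), L(x)) -> Hom_A(L(y), H(x,b)), a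
  trivial fibration by the lifting property of the single module \<open>L(y)\<close>; this is why
  every \<open>L(y)\<close>, that at \<open>b\<close> included, has to be cofibrant over
  \<open>A\<close>. Adequacy enters at one point: the factorization of a map out of the initial
  algebra of an operad with one colour per object.\<close>

context category
begin

section \<open>Composition and isomorphisms in a category\<close>

lemma in_homs: "f \<in> homs C X Y \<longleftrightarrow> f \<in> Arr C \<and> Dom C f = X \<and> Cod C f = Y"
  by (simp add: homs_def)

lemma Dom_in [simp]: "f \<in> Arr C \<Longrightarrow> Dom C f \<in> Obj C"
  by (rule Dom_Obj)

lemma Cod_in [simp]: "f \<in> Arr C \<Longrightarrow> Cod C f \<in> Obj C"
  by (rule Cod_Obj)

lemma homs_Obj: "f \<in> homs C X Y \<Longrightarrow> X \<in> Obj C \<and> Y \<in> Obj C"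
  by (auto simp: in_homs)

lemma Ident_arr [simp]:
  "X \<in> Obj C \<Longrightarrow> Ident C X \<in> Arr C"
  "X \<in> Obj C \<Longrightarrow> Dom C (Ident C X) = X"
  "X \<in> Obj C \<Longrightarrow> Cod C (Ident C X) = X"
  using Ident_homs[of X] by (simp_all add: in_homs)

lemma Comp_arr [simp]:
  assumes "f \<in> Arr C" "g \<in> Arr C" "Dom C g = Cod C f"
  shows "g \<cdot> f \<in> Arr C" "Dom C (g \<cdot> f) = Dom C f" "Cod C (g \<cdot> f) = Cod C g"
  using Comp_homs[of f "Dom C f" "Cod C f" g "Cod C g"] assms by (simp_all add: in_homs)

lemma Comp_Ident' [simp]: "f \<in> Arr C \<Longrightarrow> X = Dom C f \<Longrightarrow> f \<cdot> Ident C X = f"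
  using Comp_Ident[of f] by (simp add: in_homs)

lemma Ident_Comp' [simp]: "f \<in> Arr C \<Longrightarrow> X = Cod C f \<Longrightarrow> Ident C X \<cdot> f = f"
  using Ident_Comp[of f] by (simp add: in_homs)

lemma Comp_assoc' [simp]:
  "f \<in> Arr C \<Longrightarrow> g \<in> Arr C \<Longrightarrow> h \<in> Arr C \<Longrightarrow> Dom C g = Cod C f \<Longrightarrow> Dom C h = Cod C g \<Longrightarrow>
    (h \<cdot> g) \<cdot> f = h \<cdot> (g \<cdot> f)"
  using Comp_assoc[of f _ _ g _ h] by (simp add: in_homs)

text \<open>Composites are normalised to the right, so an equation for \<open>a \<cdot> b\<close>
  has to be applied inside \<open>a \<cdot> (b \<cdot> k)\<close>, where \<open>a \<cdot> b\<close>
  does not occur as a subterm.\<close>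

lemma Comp_cong_left:
  "a \<cdot> b = c \<Longrightarrow> a \<in> Arr C \<Longrightarrow> b \<in> Arr C \<Longrightarrow> k \<in> Arr C \<Longrightarrow> Dom C a = Cod C b \<Longrightarrow> Dom C b = Cod C k \<Longrightarrow>
    a \<cdot> (b \<cdot> k) = c \<cdot> k"
  by (subst Comp_assoc'[symmetric]) auto

text \<open>The value is unspecified when \<open>f\<close> is not an isomorphism.\<close>

definition inverse_arr where
  "inverse_arr f = (SOME g. g \<in> homs C (Cod C f) (Dom C f) \<and>
     g \<cdot> f = Ident C (Dom C f) \<and> f \<cdot> g = Ident C (Cod C f))"

lemma inverse_arr [simp]:
  assumes "is_iso C f"
  shows "inverse_arr f \<in> Arr C" "Dom C (inverse_arr f) = Cod C f" "Cod C (inverse_arr f) = Dom C f"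
    "inverse_arr f \<cdot> f = Ident C (Dom C f)" "f \<cdot> inverse_arr f = Ident C (Cod C f)"
proof -
  have "\<exists>g. g \<in> homs C (Cod C f) (Dom C f) \<and>
     g \<cdot> f = Ident C (Dom C f) \<and> f \<cdot> g = Ident C (Cod C f)"
    using assms by (auto simp: is_iso_def)
  from someI_ex[OF this] show "inverse_arr f \<in> Arr C" "Dom C (inverse_arr f) = Cod C f"
    "Cod C (inverse_arr f) = Dom C f"
    "inverse_arr f \<cdot> f = Ident C (Dom C f)" "f \<cdot> inverse_arr f = Ident C (Cod C f)"
    by (auto simp: inverse_arr_def in_homs)
qed

lemma inverse_arr_cancel [simp]:
  assumes "is_iso C f" "k \<in> Arr C"
  shows "Cod C k = Dom C f \<Longrightarrow> inverse_arr f \<cdot> (f \<cdot> k) = k"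
    and "Cod C k = Cod C f \<Longrightarrow> f \<cdot> (inverse_arr f \<cdot> k) = k"
proof -
  have f: "f \<in> Arr C" using assms by (simp add: is_iso_def)
  show "Cod C k = Dom C f \<Longrightarrow> inverse_arr f \<cdot> (f \<cdot> k) = k"
    using assms f Comp_cong_left[OF inverse_arr(4)[OF assms(1)], of k] by simp
  show "Cod C k = Cod C f \<Longrightarrow> f \<cdot> (inverse_arr f \<cdot> k) = k"
    using assms f Comp_cong_left[OF inverse_arr(5)[OF assms(1)], of k] by simp
qed

text \<open>Equations between maps out of tensor products are proved below after composing with an
  associator or a unit isomorphism, so that inverses need not be moved through naturality
  squares.\<close>

lemma iso_epi:
  assumes eq: "g \<cdot> f = h \<cdot> f" and i: "is_iso C f"
    and gh: "g \<in> Arr C" "h \<in> Arr C" "Dom C g = Cod C f" "Dom C h = Cod C f"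
  shows "g = h"
proof -
  have f: "f \<in> Arr C" using i by (simp add: is_iso_def)
  have "g \<cdot> (f \<cdot> inverse_arr f) = h \<cdot> (f \<cdot> inverse_arr f)"
    using gh f i Comp_cong_left[OF eq, of "inverse_arr f"] by (simp del: inverse_arr(5))
  then show ?thesis using gh f i by simp
qed

lemma iso_mono:
  assumes eq: "f \<cdot> g = f \<cdot> h" and i: "is_iso C f"
    and gh: "g \<in> Arr C" "h \<in> Arr C" "Cod C g = Dom C f" "Cod C h = Dom C f"
  shows "g = h"
proof -
  have f: "f \<in> Arr C" using i by (simp add: is_iso_def)
  have "inverse_arr f \<cdot> (f \<cdot> g) = inverse_arr f \<cdot> (f \<cdot> h)" by (simp only: eq)
  then show ?thesis using gh f i by simp
qed

lemma isoI:
  "f \<in> homs C X Y \<Longrightarrow> g \<in> homs C Y X \<Longrightarrow> g \<cdot> f = Ident C X \<Longrightarrow> f \<cdot> g = Ident C Y \<Longrightarrow> is_iso C f"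
  by (auto simp: is_iso_def in_homs)

lemma iso_Comp:
  assumes "is_iso C f" "is_iso C g" "Dom C g = Cod C f"
  shows "is_iso C (g \<cdot> f)"
proof (rule isoI)
  have [simp]: "f \<in> Arr C" "g \<in> Arr C" using assms by (simp_all add: is_iso_def)
  show "g \<cdot> f \<in> homs C (Dom C f) (Cod C g)"
    "inverse_arr f \<cdot> inverse_arr g \<in> homs C (Cod C g) (Dom C f)"
    "(inverse_arr f \<cdot> inverse_arr g) \<cdot> (g \<cdot> f) = Ident C (Dom C f)"
    "(g \<cdot> f) \<cdot> (inverse_arr f \<cdot> inverse_arr g) = Ident C (Cod C g)"
    using assms by (simp_all add: in_homs)
qed

end

section \<open>Monoidal categories\<close>

context closed_symmetric_monoidal_category
begin

abbreviation idt ("\<iota>") where "idt X \<equiv> Ident V X"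

lemma Unit_in [simp]: "Unit V \<in> Obj V" by (rule Unit_Obj)

lemma Tens_in [simp]: "X \<in> Obj V \<Longrightarrow> Y \<in> Obj V \<Longrightarrow> X \<otimes> Y \<in> Obj V" by (rule Tens_Obj)

lemma TensA_arr [simp]:
  assumes "f \<in> Arr V" "g \<in> Arr V"
  shows "f \<boxtimes> g \<in> Arr V" "Dom V (f \<boxtimes> g) = Dom V f \<otimes> Dom V g" "Cod V (f \<boxtimes> g) = Cod V f \<otimes> Cod V g"
  using TensA_homs[of f _ _ g] assms by (simp_all add: in_homs)

lemma TensA_Ident' [simp]: "X \<in> Obj V \<Longrightarrow> Y \<in> Obj V \<Longrightarrow> \<iota> X \<boxtimes> \<iota> Y = \<iota> (X \<otimes> Y)"
  by (rule TensA_Ident)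

text \<open>Oriented towards a single tensor product of composites: simplification merges adjacent
  tensor products of maps, and the calculations split them by hand where only one factor is to be
  rewritten.\<close>

lemma TensA_Comp' [simp]:
  assumes "f \<in> Arr V" "f' \<in> Arr V" "g \<in> Arr V" "g' \<in> Arr V" "Dom V f' = Cod V f" "Dom V g' = Cod V g"
  shows "(f' \<boxtimes> g') \<cdot> (f \<boxtimes> g) = (f' \<cdot> f) \<boxtimes> (g' \<cdot> g)"
  using TensA_Comp[of f _ _ f' _ g _ _ g'] assms by (simp add: in_homs)

lemma TensA_Comp_assoc [simp]:
  assumes "f \<in> Arr V" "f' \<in> Arr V" "g \<in> Arr V" "g' \<in> Arr V" "Dom V f' = Cod V f" "Dom V g' = Cod V g"
    "k \<in> Arr V" "Cod V k = Dom V f \<otimes> Dom V g"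
  shows "(f' \<boxtimes> g') \<cdot> ((f \<boxtimes> g) \<cdot> k) = ((f' \<cdot> f) \<boxtimes> (g' \<cdot> g)) \<cdot> k"
  using assms by (subst Comp_assoc'[symmetric]) auto

lemma Assoc_arr [simp]:
  assumes "X \<in> Obj V" "Y \<in> Obj V" "Z \<in> Obj V"
  shows "Assoc V X Y Z \<in> Arr V" "Dom V (Assoc V X Y Z) = (X \<otimes> Y) \<otimes> Z"
    "Cod V (Assoc V X Y Z) = X \<otimes> (Y \<otimes> Z)" "is_iso V (Assoc V X Y Z)"
  using Assoc_homs[OF assms] Assoc_iso[OF assms] by (simp_all add: in_homs)

lemma LUnit_arr [simp]:
  assumes "X \<in> Obj V"
  shows "LUnit V X \<in> Arr V" "Dom V (LUnit V X) = Unit V \<otimes> X"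
    "Cod V (LUnit V X) = X" "is_iso V (LUnit V X)"
  using LUnit_homs[OF assms] LUnit_iso[OF assms] by (simp_all add: in_homs)

lemma RUnit_arr [simp]:
  assumes "X \<in> Obj V"
  shows "RUnit V X \<in> Arr V" "Dom V (RUnit V X) = X \<otimes> Unit V"
    "Cod V (RUnit V X) = X" "is_iso V (RUnit V X)"
  using RUnit_homs[OF assms] RUnit_iso[OF assms] by (simp_all add: in_homs)

lemma Braid_arr [simp]:
  assumes "X \<in> Obj V" "Y \<in> Obj V"
  shows "Braid V X Y \<in> Arr V" "Dom V (Braid V X Y) = X \<otimes> Y"
    "Cod V (Braid V X Y) = Y \<otimes> X" "is_iso V (Braid V X Y)"
  using Braid_homs[OF assms] isoI[OF Braid_homs Braid_homs symmetry symmetry, OF assms assms(2,1)] assms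
  by (simp_all add: in_homs)

text \<open>The calculations need the naturality square in both directions, so it is applied by
  hand. An identity of \<open>X \<otimes> Y\<close> that has to pass an associator is written as a
  tensor product of two identities for this purpose.\<close>

lemma Assoc_nat':
  "f \<in> Arr V \<Longrightarrow> g \<in> Arr V \<Longrightarrow> h \<in> Arr V \<Longrightarrow> X' = Cod V f \<Longrightarrow> Y' = Cod V g \<Longrightarrow> Z' = Cod V h \<Longrightarrow>
    Assoc V X' Y' Z' \<cdot> ((f \<boxtimes> g) \<boxtimes> h)
      = (f \<boxtimes> (g \<boxtimes> h)) \<cdot> Assoc V (Dom V f) (Dom V g) (Dom V h)"
  using Assoc_nat[of f _ _ g _ _ h] by (simp add: in_homs)

lemma Assoc_nat_assoc:
  "f \<in> Arr V \<Longrightarrow> g \<in> Arr V \<Longrightarrow> h \<in> Arr V \<Longrightarrow> k \<in> Arr V \<Longrightarrow>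
    Cod V k = (Dom V f \<otimes> Dom V g) \<otimes> Dom V h \<Longrightarrow> X' = Cod V f \<Longrightarrow> Y' = Cod V g \<Longrightarrow> Z' = Cod V h \<Longrightarrow>
    Assoc V X' Y' Z' \<cdot> (((f \<boxtimes> g) \<boxtimes> h) \<cdot> k)
      = (f \<boxtimes> (g \<boxtimes> h)) \<cdot> (Assoc V (Dom V f) (Dom V g) (Dom V h) \<cdot> k)"
  by (subst Comp_cong_left[OF Assoc_nat']) auto

lemma LUnit_nat':
  "f \<in> Arr V \<Longrightarrow> Y = Cod V f \<Longrightarrow> LUnit V Y \<cdot> (\<iota> (Unit V) \<boxtimes> f) = f \<cdot> LUnit V (Dom V f)"
  using LUnit_nat[of f] by (simp add: in_homs)

lemma RUnit_nat':
  "f \<in> Arr V \<Longrightarrow> Y = Cod V f \<Longrightarrow> RUnit V Y \<cdot> (f \<boxtimes> \<iota> (Unit V)) = f \<cdot> RUnit V (Dom V f)"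
  using RUnit_nat[of f] by (simp add: in_homs)

lemma Braid_nat':
  "f \<in> Arr V \<Longrightarrow> g \<in> Arr V \<Longrightarrow> X = Cod V f \<Longrightarrow> Y = Cod V g \<Longrightarrow>
    Braid V X Y \<cdot> (f \<boxtimes> g) = (g \<boxtimes> f) \<cdot> Braid V (Dom V f) (Dom V g)"
  using Braid_nat[of f _ _ g] by (simp add: in_homs)

lemma iso_TensA [simp]:
  assumes "is_iso V f" "is_iso V g"
  shows "is_iso V (f \<boxtimes> g)"
proof -
  have "f \<in> Arr V" "g \<in> Arr V" using assms by (auto simp: is_iso_def)
  then show ?thesis using assms
    by (intro isoI[of _ "Dom V f \<otimes> Dom V g" "Cod V f \<otimes> Cod V g" "inverse_arr f \<boxtimes> inverse_arr g"])
      (auto simp: in_homs)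
qed

lemma iso_Ident [simp]: "X \<in> Obj V \<Longrightarrow> is_iso V (\<iota> X)"
  by (rule isoI[of _ X X "\<iota> X"]) (auto simp: in_homs)

text \<open>\<open>LUnit\<close> is a natural isomorphism from tensoring with the unit to the
  identity functor, so that functor is faithful. The coherence laws below are proved after tensoring
  with the unit.\<close>

lemma tensor_unit_faithful_left:
  assumes "f \<in> Arr V" "g \<in> Arr V" "Dom V f = Dom V g" "Cod V f = Cod V g"
    "\<iota> (Unit V) \<boxtimes> f = \<iota> (Unit V) \<boxtimes> g"
  shows "f = g"
proof (rule iso_epi[where f = "LUnit V (Dom V f)"])
  show "f \<cdot> LUnit V (Dom V f) = g \<cdot> LUnit V (Dom V f)"
    using LUnit_nat'[of f "Cod V f"] LUnit_nat'[of g "Cod V g"] assms by simp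
qed (use assms in auto)

lemma tensor_unit_faithful_right:
  assumes "f \<in> Arr V" "g \<in> Arr V" "Dom V f = Dom V g" "Cod V f = Cod V g"
    "f \<boxtimes> \<iota> (Unit V) = g \<boxtimes> \<iota> (Unit V)"
  shows "f = g"
proof (rule iso_epi[where f = "RUnit V (Dom V f)"])
  show "f \<cdot> RUnit V (Dom V f) = g \<cdot> RUnit V (Dom V f)"
    using RUnit_nat'[of f "Cod V f"] RUnit_nat'[of g "Cod V g"] assms by simp
qed (use assms in auto)

text \<open>Kelly's argument: tensored with the unit on the left, the law follows from the pentagon
  for I, I, X, Y, the naturality of the associator and two triangles. \<open>?p\<close> is the side
  of the pentagon that remains on both ends and is cancelled.\<close>

lemma LUnit_Tens:
  assumes [simp]: "X \<in> Obj V" "Y \<in> Obj V"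
  shows "LUnit V (X \<otimes> Y) \<cdot> Assoc V (Unit V) X Y = LUnit V X \<boxtimes> \<iota> Y"
proof (rule tensor_unit_faithful_left)
  let ?I = "Unit V"
  let ?p = "Assoc V ?I (?I \<otimes> X) Y \<cdot> (Assoc V ?I ?I X \<boxtimes> \<iota> Y)"
  have i: "is_iso V ?p"
    by (rule isoI[of _ "((?I \<otimes> ?I) \<otimes> X) \<otimes> Y" "?I \<otimes> ((?I \<otimes> X) \<otimes> Y)"
        "(inverse_arr (Assoc V ?I ?I X) \<boxtimes> \<iota> Y) \<cdot> inverse_arr (Assoc V ?I (?I \<otimes> X) Y)"])
      (simp_all add: in_homs Comp_cong_left[OF TensA_Comp'])
  have "(\<iota> ?I \<boxtimes> (LUnit V (X \<otimes> Y) \<cdot> Assoc V ?I X Y)) \<cdot> ?p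
      = (\<iota> ?I \<boxtimes> LUnit V (X \<otimes> Y)) \<cdot> ((\<iota> ?I \<boxtimes> Assoc V ?I X Y) \<cdot> ?p)" by simp
  also have "\<dots> = (\<iota> ?I \<boxtimes> LUnit V (X \<otimes> Y)) \<cdot> (Assoc V ?I ?I (X \<otimes> Y) \<cdot> Assoc V (?I \<otimes> ?I) X Y)"
    by (simp only: pentagon[of ?I ?I X Y] Unit_in assms)
  also have "\<dots> = (RUnit V ?I \<boxtimes> \<iota> (X \<otimes> Y)) \<cdot> Assoc V (?I \<otimes> ?I) X Y"
    using Comp_cong_left[OF triangle[of ?I "X \<otimes> Y"], of "Assoc V (?I \<otimes> ?I) X Y"] by simp
  also have "\<dots> = Assoc V ?I X Y \<cdot> ((RUnit V ?I \<boxtimes> \<iota> X) \<boxtimes> \<iota> Y)"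
    using Assoc_nat'[of "RUnit V ?I" "\<iota> X" "\<iota> Y"] by simp
  also have "\<dots> = Assoc V ?I X Y \<cdot> ((\<iota> ?I \<boxtimes> LUnit V X) \<boxtimes> \<iota> Y) \<cdot> (Assoc V ?I ?I X \<boxtimes> \<iota> Y)"
    by (simp add: triangle)
  also have "\<dots> = (\<iota> ?I \<boxtimes> (LUnit V X \<boxtimes> \<iota> Y)) \<cdot> ?p"
    by (subst Assoc_nat_assoc) auto
  finally show "\<iota> ?I \<boxtimes> (LUnit V (X \<otimes> Y) \<cdot> Assoc V ?I X Y) = \<iota> ?I \<boxtimes> (LUnit V X \<boxtimes> \<iota> Y)"
    by (rule iso_epi) (use i in auto)
qed auto

text \<open>The mirror image, from the pentagon for X, Y, I, I and two triangles; here an associator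
  is cancelled on the left.\<close>

lemma RUnit_Tens:
  assumes [simp]: "X \<in> Obj V" "Y \<in> Obj V"
  shows "(\<iota> X \<boxtimes> RUnit V Y) \<cdot> Assoc V X Y (Unit V) = RUnit V (X \<otimes> Y)"
proof (rule tensor_unit_faithful_right)
  let ?I = "Unit V"
  have "Assoc V X Y ?I \<cdot> (((\<iota> X \<boxtimes> RUnit V Y) \<cdot> Assoc V X Y ?I) \<boxtimes> \<iota> ?I)
     = Assoc V X Y ?I \<cdot> (((\<iota> X \<boxtimes> RUnit V Y) \<boxtimes> \<iota> ?I) \<cdot> (Assoc V X Y ?I \<boxtimes> \<iota> ?I))" by simp
  also have "\<dots> = (\<iota> X \<boxtimes> (RUnit V Y \<boxtimes> \<iota> ?I)) \<cdot> (Assoc V X (Y \<otimes> ?I) ?I \<cdot> (Assoc V X Y ?I \<boxtimes> \<iota> ?I))"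
    by (subst Assoc_nat_assoc) auto
  also have "\<dots> = (\<iota> X \<boxtimes> (\<iota> Y \<boxtimes> LUnit V ?I)) \<cdot> ((\<iota> X \<boxtimes> Assoc V Y ?I ?I) \<cdot> Assoc V X (Y \<otimes> ?I) ?I \<cdot> (Assoc V X Y ?I \<boxtimes> \<iota> ?I))"
    by (simp add: triangle)
  also have "\<dots> = (\<iota> X \<boxtimes> (\<iota> Y \<boxtimes> LUnit V ?I)) \<cdot> (Assoc V X Y (?I \<otimes> ?I) \<cdot> Assoc V (X \<otimes> Y) ?I ?I)"
    by (simp only: pentagon[of X Y ?I ?I] Unit_in assms)
  also have "\<dots> = Assoc V X Y ?I \<cdot> (\<iota> (X \<otimes> Y) \<boxtimes> LUnit V ?I) \<cdot> Assoc V (X \<otimes> Y) ?I ?I"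
    using Assoc_nat_assoc[of "\<iota> X" "\<iota> Y" "LUnit V ?I" "Assoc V (X \<otimes> Y) ?I ?I"] by simp
  also have "\<dots> = Assoc V X Y ?I \<cdot> (RUnit V (X \<otimes> Y) \<boxtimes> \<iota> ?I)" by (simp add: triangle)
  finally show "((\<iota> X \<boxtimes> RUnit V Y) \<cdot> Assoc V X Y ?I) \<boxtimes> \<iota> ?I = RUnit V (X \<otimes> Y) \<boxtimes> \<iota> ?I"
    by (rule iso_mono) auto
qed auto

text \<open>Naturality of \<open>LUnit\<close> at \<open>LUnit V (Unit V)\<close> identifies the
  left unit of I \<otimes> I with the tensor product of I and the left unit of I; then
  \<open>LUnit_Tens\<close> and the triangle have the same right-hand factor.\<close>

lemma LUnit_Unit: "LUnit V (Unit V) = RUnit V (Unit V)"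
proof (rule tensor_unit_faithful_right)
  let ?I = "Unit V"
  have "LUnit V (?I \<otimes> ?I) = \<iota> ?I \<boxtimes> LUnit V ?I"
    by (rule iso_mono[where f = "LUnit V ?I"]) (auto simp: LUnit_nat')
  then have "LUnit V ?I \<boxtimes> \<iota> ?I = (\<iota> ?I \<boxtimes> LUnit V ?I) \<cdot> Assoc V ?I ?I ?I"
    using LUnit_Tens[of ?I ?I] by simp
  also have "\<dots> = RUnit V ?I \<boxtimes> \<iota> ?I" by (simp add: triangle)
  finally show "LUnit V ?I \<boxtimes> \<iota> ?I = RUnit V ?I \<boxtimes> \<iota> ?I" .
qed auto

text \<open>Compatibility of the braiding with units is not among the axioms. It comes from the
  hexagon for X, I, I, compared after tensoring with I on the right and cancelling a braiding on the
  left.\<close>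

lemma LUnit_Braid:
  assumes [simp]: "X \<in> Obj V"
  shows "LUnit V X \<cdot> Braid V X (Unit V) = RUnit V X"
proof (rule tensor_unit_faithful_right)
  let ?I = "Unit V"
  have "Braid V X ?I \<cdot> ((LUnit V X \<cdot> Braid V X ?I) \<boxtimes> \<iota> ?I)
      = Braid V X ?I \<cdot> (LUnit V X \<boxtimes> \<iota> ?I) \<cdot> (Braid V X ?I \<boxtimes> \<iota> ?I)" by simp
  also have "\<dots> = Braid V X ?I \<cdot> (LUnit V (X \<otimes> ?I) \<cdot> Assoc V ?I X ?I) \<cdot> (Braid V X ?I \<boxtimes> \<iota> ?I)"
    by (simp only: LUnit_Tens assms Unit_in)
  also have "\<dots> = (Braid V X ?I \<cdot> LUnit V (X \<otimes> ?I)) \<cdot> Assoc V ?I X ?I \<cdot> (Braid V X ?I \<boxtimes> \<iota> ?I)" by simp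
  also have "\<dots> = (LUnit V (?I \<otimes> X) \<cdot> (\<iota> ?I \<boxtimes> Braid V X ?I)) \<cdot> Assoc V ?I X ?I \<cdot> (Braid V X ?I \<boxtimes> \<iota> ?I)"
    using LUnit_nat'[of "Braid V X ?I"] by simp
  also have "\<dots> = LUnit V (?I \<otimes> X) \<cdot> ((\<iota> ?I \<boxtimes> Braid V X ?I) \<cdot> Assoc V ?I X ?I \<cdot> (Braid V X ?I \<boxtimes> \<iota> ?I))" by simp
  also have "\<dots> = LUnit V (?I \<otimes> X) \<cdot> (Assoc V ?I ?I X \<cdot> Braid V X (?I \<otimes> ?I) \<cdot> Assoc V X ?I ?I)"
    by (simp only: hexagon[of X ?I ?I] assms Unit_in)
  also have "\<dots> = (LUnit V (?I \<otimes> X) \<cdot> Assoc V ?I ?I X) \<cdot> Braid V X (?I \<otimes> ?I) \<cdot> Assoc V X ?I ?I" by simp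
  also have "\<dots> = ((LUnit V ?I \<boxtimes> \<iota> X) \<cdot> Braid V X (?I \<otimes> ?I)) \<cdot> Assoc V X ?I ?I"
    by (simp add: LUnit_Tens)
  also have "\<dots> = (Braid V X ?I \<cdot> (\<iota> X \<boxtimes> LUnit V ?I)) \<cdot> Assoc V X ?I ?I"
    using Braid_nat'[of "\<iota> X" "LUnit V ?I" X ?I] by simp
  also have "\<dots> = Braid V X ?I \<cdot> (RUnit V X \<boxtimes> \<iota> ?I)" by (simp add: triangle)
  finally show "(LUnit V X \<cdot> Braid V X ?I) \<boxtimes> \<iota> ?I = RUnit V X \<boxtimes> \<iota> ?I"
    by (rule iso_mono) auto
qed auto

lemma RUnit_Braid:
  assumes [simp]: "X \<in> Obj V"
  shows "RUnit V X \<cdot> Braid V (Unit V) X = LUnit V X"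
proof -
  have "RUnit V X \<cdot> Braid V (Unit V) X = LUnit V X \<cdot> (Braid V X (Unit V) \<cdot> Braid V (Unit V) X)"
    by (simp add: LUnit_Braid[symmetric])
  then show ?thesis by (simp add: symmetry)
qed

end

section \<open>Limits and colimits of finite shape\<close>

lemma universe_infinite: "universe TYPE('u) \<Longrightarrow> infinite (UNIV :: 'u set)"
  unfolding universe_def
  using infinite_iff_natLeq_ordLeq ordLess_imp_ordLeq by blast

lemma universe_code: "universe TYPE('u) \<Longrightarrow> \<exists>c :: nat \<Rightarrow> 'u. inj c"
  using universe_infinite infinite_countable_subset by blast

lemma small_countable:
  fixes A :: "'x set"
  assumes "universe TYPE('u)" and "inj_on f A" and "range (h :: nat \<Rightarrow> 'y) \<supseteq> f ` A"
  shows "small TYPE('u) A"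
proof -
  have "|A| =o |f ` A|"
    using assms(2) card_of_ordIso inj_on_imp_bij_betw by blast
  also have "|f ` A| \<le>o |range h|" using assms(3) by (rule card_of_mono1)
  also have "|range h| \<le>o |UNIV :: nat set|" by (rule card_of_image)
  also have "|UNIV :: nat set| =o natLeq" by (rule card_of_nat)
  also have "natLeq <o |UNIV :: 'u set|" using assms(1) by (simp add: universe_def)
  finally show ?thesis by (simp add: small_def)
qed

lemma small_range: "universe TYPE('u) \<Longrightarrow> A \<subseteq> range (h :: nat \<Rightarrow> 'x) \<Longrightarrow> small TYPE('u) A"
  using small_countable[where f = id and A = A and h = h] by auto

lemma cocomplete_initial:
  fixes C :: "('o, 'm, 'z) cat_scheme"
  assumes "universe TYPE('u)" "cocomplete TYPE('u) C"
  obtains Z where "initial C Z"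
proof -
  let ?J = "\<lparr>Obj = {}, Arr = {}, Dom = id, Cod = id, Ident = id, Comp = (\<lambda>g f. f)\<rparr> :: ('u, 'u) cat"
  have "category ?J" by unfold_locales (auto simp: homs_def)
  moreover have "small TYPE('u) ({} :: 'u set)" using assms(1) by (rule small_range) auto
  ultimately obtain Z \<iota> where "is_colimit ?J C undefined undefined Z \<iota>"
    using assms(2) unfolding cocomplete_def by (fastforce simp: is_functor_def)
  then have "initial C Z"
    by (auto simp: is_colimit_def is_cocone_def initial_def)
  then show thesis by (rule that)
qed

lemma category_opp: "category C \<Longrightarrow> category (opp C)"
proof -
  assume "category C"
  then interpret category C .
  show ?thesis by unfold_locales (auto simp: opp_def homs_def)
qed

lemma homs_opp: "homs (opp C) X Y = homs C Y X"
  by (auto simp: opp_def homs_def)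

lemma Comp_opp: "g \<cdot>\<^bsub>opp C\<^esub> f = f \<cdot>\<^bsub>C\<^esub> g"
  by (simp add: opp_def)

lemma Obj_opp: "Obj (opp C) = Obj C"
  by (simp add: opp_def)

lemma complete_terminal:
  fixes C :: "('o, 'm, 'z) cat_scheme"
  assumes "universe TYPE('u)" "complete TYPE('u) C"
  obtains Z where "Z \<in> Obj C" "\<And>Y. Y \<in> Obj C \<Longrightarrow> \<exists>!f. f \<in> homs C Y Z"
proof -
  obtain Z where "initial (opp C) Z"
    using cocomplete_initial assms unfolding complete_def by blast
  then show thesis using that by (auto simp: initial_def homs_opp Obj_opp)
qed

text \<open>This one shape of diagram covers pushouts (when the two parallel maps agree) and, dually, both
  pullbacks and objects of linear maps.\<close>

lemma cocomplete_colimit: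
  fixes C :: "('o, 'm, 'z) cat_scheme" (structure)
  assumes U: "universe TYPE('u)" "cocomplete TYPE('u) C" "category C"
    and p: "p \<in> homs C F G" and q: "q \<in> homs C F E"
    and d: "d1 \<in> homs C L E" "d2 \<in> homs C L E"
  obtains Z g e where "g \<in> homs C G Z" "e \<in> homs C E Z" "g \<cdot> p = e \<cdot> q" "e \<cdot> d1 = e \<cdot> d2"
    "\<And>Y g' e'. g' \<in> homs C G Y \<Longrightarrow> e' \<in> homs C E Y \<Longrightarrow> g' \<cdot> p = e' \<cdot> q \<Longrightarrow> e' \<cdot> d1 = e' \<cdot> d2 \<Longrightarrow>
      \<exists>!h. h \<in> homs C Z Y \<and> h \<cdot> g = g' \<and> h \<cdot> e = e'"
proof -
  interpret category C by fact
  obtain c :: "nat \<Rightarrow> 'u" where c: "inj c" using universe_code[OF U(1)] by blast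
  define n where "n = inv c"
  have n [simp]: "n (c i) = i" for i using c by (simp add: n_def)
  have c_eq [simp]: "c i = c j \<longleftrightarrow> i = j" for i j using c by (simp add: inj_eq)
  \<comment> \<open>Vertices 0, 1, 2, 3 stand for \<open>F\<close>, \<open>G\<close>,
    \<open>E\<close>, \<open>L\<close>, arrows 0 to 3 are their identities, and arrows 4 to 7 are
    \<open>p\<close> from 0 to 1, \<open>q\<close> from 0 to 2, and \<open>d1\<close>,
    \<open>d2\<close> from 3 to 2. No two of the last four are composable, so a composite is
    whichever factor is not an identity.\<close>
  define dn :: "nat \<Rightarrow> nat" where "dn i = (if i < 4 then i else if i < 6 then 0 else 3)" for i
  define cn :: "nat \<Rightarrow> nat" where "cn i = (if i < 4 then i else if i = 4 then 1 else 2)" for i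
  define J :: "('u, 'u) cat" where "J = \<lparr>Obj = c ` {..<4}, Arr = c ` {..<8}, Dom = (\<lambda>a. c (dn (n a))),
    Cod = (\<lambda>a. c (cn (n a))), Ident = (\<lambda>a. a), Comp = (\<lambda>g f. if n f < 4 then g else f)\<rparr>"
  have J: "category J"
    by unfold_locales (auto simp: J_def homs_def dn_def cn_def split: if_splits)
  define X where "X a = (if n a = 0 then F else if n a = 1 then G else if n a = 2 then E else L)" for a
  define x where "x a = (if n a < 4 then Ident C (X a) else if n a = 4 then p else if n a = 5 then q
    else if n a = 6 then d1 else d2)" for a
  note hs = p[unfolded in_homs] q[unfolded in_homs] d[unfolded in_homs]
  have obs: "F \<in> Obj C" "G \<in> Obj C" "E \<in> Obj C" "L \<in> Obj C"
    using homs_Obj[OF p] homs_Obj[OF q] homs_Obj[OF d(1)] by auto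
  have four: "i < 4 \<longleftrightarrow> i = 0 \<or> i = 1 \<or> i = 2 \<or> i = 3" for i :: nat by auto
  have eight: "i < 8 \<longleftrightarrow> i < 4 \<or> i = 4 \<or> i = 5 \<or> i = 6 \<or> i = 7" for i :: nat by auto
  have Arr_cases: "f = c 0 \<or> f = c 1 \<or> f = c 2 \<or> f = c 3 \<or> f = c 4 \<or> f = c 5 \<or> f = c 6 \<or> f = c 7"
    if "f \<in> Arr J" for f
    using that by (auto simp: J_def eight four)
  have Obj_cases: "j = c 0 \<or> j = c 1 \<or> j = c 2 \<or> j = c 3" if "j \<in> Obj J" for j
    using that by (auto simp: J_def four)
  note defs = J_def x_def X_def dn_def cn_def
  have func: "is_functor J C X x"
    unfolding is_functor_def
  proof (intro conjI ballI impI)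
    fix f g assume f: "f \<in> Arr J" and g: "g \<in> Arr J" and fg: "Dom J g = Cod J f"
    show "x (g \<cdot>\<^bsub>J\<^esub> f) = x g \<cdot> x f"
      using Arr_cases[OF f] Arr_cases[OF g] fg
      by (elim disjE; simp add: defs hs obs)
  next
    fix f assume f: "f \<in> Arr J"
    show "x f \<in> homs C (X (Dom J f)) (X (Cod J f))"
      using Arr_cases[OF f] by (elim disjE; simp add: defs hs obs in_homs)
  next
    fix j assume j: "j \<in> Obj J"
    show "X j \<in> Obj C" "x (Ident J j) = Ident C (X j)"
      using Obj_cases[OF j] by (elim disjE; simp add: defs hs obs)+
  qed
  have "small TYPE('u) (Obj J)" "small TYPE('u) (Arr J)"
    using U(1) by (auto intro!: small_range[of _ c] simp: J_def)
  with J func U(2) obtain Z \<iota> where Z: "is_colimit J C X x Z \<iota>"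
    unfolding cocomplete_def by blast
  have Arr_J: "c i \<in> Arr J" if "i < 8" for i using that by (auto simp: J_def)
  have Obj_J: "c i \<in> Obj J" if "i < 4" for i using that by (auto simp: J_def)
  have co: "\<iota> j \<in> homs C (X j) Z" if "j \<in> Obj J" for j
    using Z that by (auto simp: is_colimit_def is_cocone_def)
  have eq: "\<iota> (Cod J f) \<cdot> x f = \<iota> (Dom J f)" if "f \<in> Arr J" for f
    using Z that by (auto simp: is_colimit_def is_cocone_def)
  show thesis
  proof
    show g: "\<iota> (c 1) \<in> homs C G Z" and e: "\<iota> (c 2) \<in> homs C E Z"
      using co[of "c 1"] co[of "c 2"] Obj_J by (auto simp: X_def)
    have "\<iota> (c 1) \<cdot> p = \<iota> (c 0)" "\<iota> (c 2) \<cdot> q = \<iota> (c 0)" "\<iota> (c 2) \<cdot> d1 = \<iota> (c 3)" "\<iota> (c 2) \<cdot> d2 = \<iota> (c 3)"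
      using eq[of "c 4"] eq[of "c 5"] eq[of "c 6"] eq[of "c 7"] Arr_J
      by (auto simp: J_def x_def dn_def cn_def)
    then show "\<iota> (c 1) \<cdot> p = \<iota> (c 2) \<cdot> q" "\<iota> (c 2) \<cdot> d1 = \<iota> (c 2) \<cdot> d2" by simp_all
    fix Y g' e' assume a: "g' \<in> homs C G Y" "e' \<in> homs C E Y" "g' \<cdot> p = e' \<cdot> q" "e' \<cdot> d1 = e' \<cdot> d2"
    define \<kappa> where "\<kappa> j = (if n j = 0 then g' \<cdot> p else if n j = 1 then g' else if n j = 2 then e' else e' \<cdot> d1)" for j
    have "is_cocone J C X x Y \<kappa>"
      unfolding is_cocone_def
    proof (intro conjI ballI)
      show "Y \<in> Obj C" using homs_Obj[OF a(1)] by simp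
      fix j assume j: "j \<in> Obj J"
      show "\<kappa> j \<in> homs C (X j) Y"
        using Obj_cases[OF j] a(1,2) by (elim disjE; simp add: defs \<kappa>_def hs obs in_homs)
    next
      fix f assume f: "f \<in> Arr J"
      show "\<kappa> (Cod J f) \<cdot> x f = \<kappa> (Dom J f)"
        using Arr_cases[OF f] a by (elim disjE; simp add: defs \<kappa>_def hs obs in_homs)
    qed
    then have ex: "\<exists>!h. h \<in> homs C Z Y \<and> (\<forall>j \<in> Obj J. h \<cdot> \<iota> j = \<kappa> j)"
      using Z by (auto simp: is_colimit_def)
    \<comment> \<open>A cocone is determined by its legs at the vertices 1 and 2: the legs at 0 and
      3 are their composites with \<open>p\<close> and \<open>d1\<close>.\<close>
    have eqv: "(\<forall>j \<in> Obj J. h \<cdot> \<iota> j = \<kappa> j) \<longleftrightarrow> h \<cdot> \<iota> (c 1) = g' \<and> h \<cdot> \<iota> (c 2) = e'"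
      if h: "h \<in> homs C Z Y" for h
    proof
      assume "\<forall>j \<in> Obj J. h \<cdot> \<iota> j = \<kappa> j"
      then show "h \<cdot> \<iota> (c 1) = g' \<and> h \<cdot> \<iota> (c 2) = e'"
        using Obj_J[of 1] Obj_J[of 2] by (auto simp: \<kappa>_def)
    next
      assume h': "h \<cdot> \<iota> (c 1) = g' \<and> h \<cdot> \<iota> (c 2) = e'"
      have "h \<cdot> \<iota> (c 0) = g' \<cdot> p"
        using eq[of "c 4"] Arr_J[of 4] h' h hs g Comp_assoc'[of p "\<iota> (c 1)" h]
        by (auto simp: J_def x_def dn_def cn_def in_homs)
      moreover have "h \<cdot> \<iota> (c 3) = e' \<cdot> d1"
        using eq[of "c 6"] Arr_J[of 6] h' h hs e Comp_assoc'[of d1 "\<iota> (c 2)" h]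
        by (auto simp: J_def x_def dn_def cn_def in_homs)
      ultimately show "\<forall>j \<in> Obj J. h \<cdot> \<iota> j = \<kappa> j"
        using h' by (auto simp: J_def \<kappa>_def four)
    qed
    have "(\<lambda>h. h \<in> homs C Z Y \<and> (\<forall>j \<in> Obj J. h \<cdot> \<iota> j = \<kappa> j))
      = (\<lambda>h. h \<in> homs C Z Y \<and> h \<cdot> \<iota> (c 1) = g' \<and> h \<cdot> \<iota> (c 2) = e')"
      using eqv by (intro ext conj_cong refl)
    then show "\<exists>!h. h \<in> homs C Z Y \<and> h \<cdot> \<iota> (c 1) = g' \<and> h \<cdot> \<iota> (c 2) = e'"
      using ex by (rule subst[where P = Ex1])
  qed
qed

lemma cocomplete_pushout:
  fixes C :: "('o, 'm, 'z) cat_scheme"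
  assumes "universe TYPE('u)" "cocomplete TYPE('u) C" "category C"
    and "f \<in> Arr C" "g \<in> Arr C" "Dom C f = Dom C g"
  obtains i j where "is_pushout C f g i j"
proof -
  have f: "f \<in> homs C (Dom C f) (Cod C f)" and g: "g \<in> homs C (Dom C f) (Cod C g)"
    using assms by (auto simp: homs_def)
  obtain Z i j where *: "i \<in> homs C (Cod C f) Z" "j \<in> homs C (Cod C g) Z" "i \<cdot>\<^bsub>C\<^esub> f = j \<cdot>\<^bsub>C\<^esub> g"
    "\<And>Y i' j'. i' \<in> homs C (Cod C f) Y \<Longrightarrow> j' \<in> homs C (Cod C g) Y \<Longrightarrow> i' \<cdot>\<^bsub>C\<^esub> f = j' \<cdot>\<^bsub>C\<^esub> g \<Longrightarrow>
      \<exists>!h. h \<in> homs C Z Y \<and> h \<cdot>\<^bsub>C\<^esub> i = i' \<and> h \<cdot>\<^bsub>C\<^esub> j = j'"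
  proof (rule cocomplete_colimit[OF assms(1-3) f g g g])
    fix Z i j
    assume "i \<in> homs C (Cod C f) Z" "j \<in> homs C (Cod C g) Z" "i \<cdot>\<^bsub>C\<^esub> f = j \<cdot>\<^bsub>C\<^esub> g"
      "\<And>Y i' j'. i' \<in> homs C (Cod C f) Y \<Longrightarrow> j' \<in> homs C (Cod C g) Y \<Longrightarrow> i' \<cdot>\<^bsub>C\<^esub> f = j' \<cdot>\<^bsub>C\<^esub> g \<Longrightarrow>
        j' \<cdot>\<^bsub>C\<^esub> g = j' \<cdot>\<^bsub>C\<^esub> g \<Longrightarrow> \<exists>!h. h \<in> homs C Z Y \<and> h \<cdot>\<^bsub>C\<^esub> i = i' \<and> h \<cdot>\<^bsub>C\<^esub> j = j'"
    then show thesis by (intro that) simp_all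
  qed
  then have "is_pushout C f g i j"
    using assms homs_def[of C "Cod C f" Z] homs_def[of C "Cod C g" Z]
    unfolding is_pushout_def by auto
  then show thesis by (rule that)
qed

lemma complete_limit:
  fixes C :: "('o, 'm, 'z) cat_scheme" (structure)
  assumes U: "universe TYPE('u)" "complete TYPE('u) C" "category C"
    and p: "p \<in> homs C G F" and q: "q \<in> homs C E F"
    and d: "d1 \<in> homs C E L" "d2 \<in> homs C E L"
  obtains Z g e where "g \<in> homs C Z G" "e \<in> homs C Z E" "p \<cdot> g = q \<cdot> e" "d1 \<cdot> e = d2 \<cdot> e"
    "\<And>Y g' e'. g' \<in> homs C Y G \<Longrightarrow> e' \<in> homs C Y E \<Longrightarrow> p \<cdot> g' = q \<cdot> e' \<Longrightarrow> d1 \<cdot> e' = d2 \<cdot> e' \<Longrightarrow>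
      \<exists>!h. h \<in> homs C Y Z \<and> g \<cdot> h = g' \<and> e \<cdot> h = e'"
proof (rule cocomplete_colimit[OF U(1) U(2)[unfolded complete_def] category_opp[OF U(3)],
      unfolded homs_opp Comp_opp, OF p q d])
  fix Z g e
  assume "g \<in> homs C Z G" "e \<in> homs C Z E" "p \<cdot> g = q \<cdot> e" "d1 \<cdot> e = d2 \<cdot> e"
    "\<And>Y g' e'. g' \<in> homs C Y G \<Longrightarrow> e' \<in> homs C Y E \<Longrightarrow> p \<cdot> g' = q \<cdot> e' \<Longrightarrow> d1 \<cdot> e' = d2 \<cdot> e' \<Longrightarrow>
      \<exists>!h. h \<in> homs C Y Z \<and> g \<cdot> h = g' \<and> e \<cdot> h = e'"
  then show thesis by (rule that)
qed

section \<open>Linear maps and modules of maps\<close>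

context closed_symmetric_monoidal_category
begin

lemma closed_right:
  assumes "X \<in> Obj V" "Y \<in> Obj V"
  obtains E ev where "E \<in> Obj V" "ev \<in> homs V (E \<otimes> X) Y"
    "\<And>Z f. Z \<in> Obj V \<Longrightarrow> f \<in> homs V (Z \<otimes> X) Y \<Longrightarrow> \<exists>!g. g \<in> homs V Z E \<and> ev \<cdot> (g \<boxtimes> \<iota> X) = f"
  using closed[OF assms] by blast

text \<open>The internal hom is given for a fixed right factor. The braiding moves it to the left,
  where the linear maps \<open>L \<otimes> T \<rightarrow> X\<close> have their module
  factor.\<close>

lemma closed_left:
  assumes X [simp]: "X \<in> Obj V" and Y: "Y \<in> Obj V"
  obtains E ev where "E \<in> Obj V" "ev \<in> homs V (X \<otimes> E) Y"
    "\<And>Z f. Z \<in> Obj V \<Longrightarrow> f \<in> homs V (X \<otimes> Z) Y \<Longrightarrow> \<exists>!g. g \<in> homs V Z E \<and> ev \<cdot> (\<iota> X \<boxtimes> g) = f"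
proof -
  obtain E ev where E [simp]: "E \<in> Obj V" and ev: "ev \<in> homs V (E \<otimes> X) Y"
    and un: "\<And>Z f. Z \<in> Obj V \<Longrightarrow> f \<in> homs V (Z \<otimes> X) Y \<Longrightarrow>
      \<exists>!g. g \<in> homs V Z E \<and> ev \<cdot> (g \<boxtimes> \<iota> X) = f"
    using closed_right[OF assms] by blast
  note [simp] = ev[unfolded in_homs]
  have eq: "(ev \<cdot> Braid V X E) \<cdot> (\<iota> X \<boxtimes> g) = f \<longleftrightarrow> ev \<cdot> (g \<boxtimes> \<iota> X) = f \<cdot> Braid V Z X"
    if "Z \<in> Obj V" "f \<in> homs V (X \<otimes> Z) Y" "g \<in> homs V Z E" for Z f g
  proof -
    note [simp] = that(1) that(2,3)[unfolded in_homs]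
    have *: "(ev \<cdot> Braid V X E) \<cdot> (\<iota> X \<boxtimes> g) = (ev \<cdot> (g \<boxtimes> \<iota> X)) \<cdot> Braid V X Z"
      by (simp add: Braid_nat')
    show ?thesis
    proof
      assume "(ev \<cdot> Braid V X E) \<cdot> (\<iota> X \<boxtimes> g) = f"
      then have "f \<cdot> Braid V Z X = ((ev \<cdot> (g \<boxtimes> \<iota> X)) \<cdot> Braid V X Z) \<cdot> Braid V Z X"
        by (simp only: *)
      then show "ev \<cdot> (g \<boxtimes> \<iota> X) = f \<cdot> Braid V Z X" by (simp add: symmetry)
    next
      assume "ev \<cdot> (g \<boxtimes> \<iota> X) = f \<cdot> Braid V Z X"
      then have "(ev \<cdot> Braid V X E) \<cdot> (\<iota> X \<boxtimes> g) = (f \<cdot> Braid V Z X) \<cdot> Braid V X Z"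
        by (simp only: *)
      then show "(ev \<cdot> Braid V X E) \<cdot> (\<iota> X \<boxtimes> g) = f" by (simp add: symmetry)
    qed
  qed
  show thesis
  proof (rule that)
    fix Z f assume Z: "Z \<in> Obj V" "f \<in> homs V (X \<otimes> Z) Y"
    have "(\<lambda>g. g \<in> homs V Z E \<and> (ev \<cdot> Braid V X E) \<cdot> (\<iota> X \<boxtimes> g) = f)
        = (\<lambda>g. g \<in> homs V Z E \<and> ev \<cdot> (g \<boxtimes> \<iota> X) = f \<cdot> Braid V Z X)"
      using eq[OF Z] by (intro ext conj_cong refl)
    then show "\<exists>!g. g \<in> homs V Z E \<and> (ev \<cdot> Braid V X E) \<cdot> (\<iota> X \<boxtimes> g) = f"
      using un[of Z "f \<cdot> Braid V Z X"] Z by (simp add: in_homs)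
  qed (simp_all add: in_homs)
qed

text \<open>These maps are the generalised elements, at stage \<open>T\<close>, of the object of
  \<open>R\<close>-linear maps from \<open>N\<close> to \<open>X\<close>. They allow its universal
  properties to be stated without naming it.\<close>

definition linear :: "('o, 'm) mon \<Rightarrow> ('o, 'm) module \<Rightarrow> 'o \<Rightarrow> ('o, 'm) module \<Rightarrow> 'm \<Rightarrow> bool" where
  "linear R N T X f \<longleftrightarrow> f \<in> homs V (Car N \<otimes> T) (Car X) \<and>
     f \<cdot> (Act N \<boxtimes> \<iota> T) = Act X \<cdot> (\<iota> (MCar R) \<boxtimes> f) \<cdot> Assoc V (MCar R) (Car N) T"

lemma is_monoidD:
  assumes "is_monoid V R"
  shows "MCar R \<in> Obj V" "MMul R \<in> Arr V" "Dom V (MMul R) = MCar R \<otimes> MCar R" "Cod V (MMul R) = MCar R"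
    "MOne R \<in> Arr V" "Dom V (MOne R) = Unit V" "Cod V (MOne R) = MCar R"
  using assms by (simp_all add: is_monoid_def in_homs)

lemma is_left_moduleD:
  assumes "is_left_module V R N"
  shows "Car N \<in> Obj V" "Act N \<in> Arr V" "Dom V (Act N) = MCar R \<otimes> Car N" "Cod V (Act N) = Car N"
  using assms by (simp_all add: is_left_module_def in_homs)

lemma left_module_assoc:
  "is_left_module V R N \<Longrightarrow> Act N \<cdot> (MMul R \<boxtimes> \<iota> (Car N))
       = Act N \<cdot> (\<iota> (MCar R) \<boxtimes> Act N) \<cdot> Assoc V (MCar R) (MCar R) (Car N)"
  by (simp add: is_left_module_def)

lemma left_module_unit:
  "is_left_module V R N \<Longrightarrow> Act N \<cdot> (MOne R \<boxtimes> \<iota> (Car N)) = LUnit V (Car N)"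
  by (simp add: is_left_module_def)

lemma left_module_homsD:
  assumes "f \<in> left_module_homs V R N N'"
  shows "f \<in> Arr V" "Dom V f = Car N" "Cod V f = Car N'"
    "f \<cdot> Act N = Act N' \<cdot> (\<iota> (MCar R) \<boxtimes> f)"
  using assms by (simp_all add: left_module_homs_def in_homs)

text \<open>If a family of linear maps out of \<open>W\<close> is jointly monic, the module axioms for \<open>W\<close>
  follow from the next two lemmas.\<close>

lemma linear_assoc:
  assumes R: "is_monoid V R" and X: "is_left_module V R X" and [simp]: "A \<in> Obj V"
    and w: "linear R W A X w" and W: "Car W \<in> Obj V" "Act W \<in> homs V (MCar R \<otimes> Car W) (Car W)"
  shows "w \<cdot> ((Act W \<cdot> (MMul R \<boxtimes> \<iota> (Car W))) \<boxtimes> \<iota> A)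
       = w \<cdot> ((Act W \<cdot> (\<iota> (MCar R) \<boxtimes> Act W) \<cdot> Assoc V (MCar R) (MCar R) (Car W)) \<boxtimes> \<iota> A)"
proof -
  let ?R = "MCar R" and ?W = "Car W" and ?X = "Car X" and ?m = "MMul R" and ?x = "Act X" and ?a = "Act W"
  note [simp] = is_monoidD[OF R] is_left_moduleD[OF X] W(1) W(2)[unfolded in_homs]
  have w': "w \<in> homs V (?W \<otimes> A) ?X" and wa: "w \<cdot> (?a \<boxtimes> \<iota> A) = ?x \<cdot> (\<iota> ?R \<boxtimes> w) \<cdot> Assoc V ?R ?W A"
    using w by (simp_all add: linear_def)
  note [simp] = w'[unfolded in_homs]
  have "w \<cdot> ((?a \<cdot> (?m \<boxtimes> \<iota> ?W)) \<boxtimes> \<iota> A) = (w \<cdot> (?a \<boxtimes> \<iota> A)) \<cdot> ((?m \<boxtimes> \<iota> ?W) \<boxtimes> \<iota> A)" by simp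
  also have "\<dots> = ?x \<cdot> (\<iota> ?R \<boxtimes> w) \<cdot> (Assoc V ?R ?W A \<cdot> ((?m \<boxtimes> \<iota> ?W) \<boxtimes> \<iota> A))" by (simp add: wa)
  also have "\<dots> = (?x \<cdot> (?m \<boxtimes> \<iota> ?X)) \<cdot> (\<iota> (?R \<otimes> ?R) \<boxtimes> w) \<cdot> Assoc V (?R \<otimes> ?R) ?W A"
    by (simp add: Assoc_nat')
  also have "\<dots> = ?x \<cdot> (\<iota> ?R \<boxtimes> ?x) \<cdot> (Assoc V ?R ?R ?X \<cdot> ((\<iota> ?R \<boxtimes> \<iota> ?R) \<boxtimes> w)) \<cdot> Assoc V (?R \<otimes> ?R) ?W A"
    by (simp add: left_module_assoc[OF X])
  also have "\<dots> = ?x \<cdot> (\<iota> ?R \<boxtimes> (?x \<cdot> (\<iota> ?R \<boxtimes> w))) \<cdot> (Assoc V ?R ?R (?W \<otimes> A) \<cdot> Assoc V (?R \<otimes> ?R) ?W A)"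
    by (subst Assoc_nat') auto
  \<comment> \<open>The pentagon restores the associators to the shape in which the linearity of
    \<open>w\<close> applies a second time.\<close>
  also have "\<dots> = ?x \<cdot> (\<iota> ?R \<boxtimes> (?x \<cdot> (\<iota> ?R \<boxtimes> w))) \<cdot> ((\<iota> ?R \<boxtimes> Assoc V ?R ?W A) \<cdot> Assoc V ?R (?R \<otimes> ?W) A \<cdot> (Assoc V ?R ?R ?W \<boxtimes> \<iota> A))"
    by (subst pentagon) auto
  also have "\<dots> = ?x \<cdot> (\<iota> ?R \<boxtimes> (?x \<cdot> (\<iota> ?R \<boxtimes> w) \<cdot> Assoc V ?R ?W A)) \<cdot> Assoc V ?R (?R \<otimes> ?W) A \<cdot> (Assoc V ?R ?R ?W \<boxtimes> \<iota> A)"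
    by simp
  also have "\<dots> = ?x \<cdot> (\<iota> ?R \<boxtimes> w) \<cdot> (Assoc V ?R ?W A \<cdot> ((\<iota> ?R \<boxtimes> ?a) \<boxtimes> \<iota> A)) \<cdot> (Assoc V ?R ?R ?W \<boxtimes> \<iota> A)"
    by (simp add: wa[symmetric] Assoc_nat' del: TensA_Ident')
  also have "\<dots> = (w \<cdot> (?a \<boxtimes> \<iota> A)) \<cdot> ((\<iota> ?R \<boxtimes> ?a) \<boxtimes> \<iota> A) \<cdot> (Assoc V ?R ?R ?W \<boxtimes> \<iota> A)"
    by (simp only: wa) simp
  also have "\<dots> = w \<cdot> ((?a \<cdot> (\<iota> ?R \<boxtimes> ?a) \<cdot> Assoc V ?R ?R ?W) \<boxtimes> \<iota> A)" by simp
  finally show ?thesis .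
qed

lemma linear_unit:
  assumes R: "is_monoid V R" and X: "is_left_module V R X" and [simp]: "A \<in> Obj V"
    and w: "linear R W A X w" and W: "Car W \<in> Obj V" "Act W \<in> homs V (MCar R \<otimes> Car W) (Car W)"
  shows "w \<cdot> ((Act W \<cdot> (MOne R \<boxtimes> \<iota> (Car W))) \<boxtimes> \<iota> A) = w \<cdot> (LUnit V (Car W) \<boxtimes> \<iota> A)"
proof -
  let ?R = "MCar R" and ?W = "Car W" and ?X = "Car X" and ?u = "MOne R" and ?x = "Act X" and ?a = "Act W"
  note [simp] = is_monoidD[OF R] is_left_moduleD[OF X] W(1) W(2)[unfolded in_homs]
  have w': "w \<in> homs V (?W \<otimes> A) ?X" and wa: "w \<cdot> (?a \<boxtimes> \<iota> A) = ?x \<cdot> (\<iota> ?R \<boxtimes> w) \<cdot> Assoc V ?R ?W A"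
    using w by (simp_all add: linear_def)
  note [simp] = w'[unfolded in_homs]
  have "w \<cdot> ((?a \<cdot> (?u \<boxtimes> \<iota> ?W)) \<boxtimes> \<iota> A) = (w \<cdot> (?a \<boxtimes> \<iota> A)) \<cdot> ((?u \<boxtimes> \<iota> ?W) \<boxtimes> \<iota> A)" by simp
  also have "\<dots> = ?x \<cdot> (\<iota> ?R \<boxtimes> w) \<cdot> (Assoc V ?R ?W A \<cdot> ((?u \<boxtimes> \<iota> ?W) \<boxtimes> \<iota> A))" by (simp add: wa)
  also have "\<dots> = (?x \<cdot> (?u \<boxtimes> \<iota> ?X)) \<cdot> (\<iota> (Unit V) \<boxtimes> w) \<cdot> Assoc V (Unit V) ?W A"
    by (simp add: Assoc_nat')
  also have "\<dots> = (LUnit V ?X \<cdot> (\<iota> (Unit V) \<boxtimes> w)) \<cdot> Assoc V (Unit V) ?W A"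
    by (simp add: left_module_unit[OF X])
  also have "\<dots> = w \<cdot> (LUnit V (?W \<otimes> A) \<cdot> Assoc V (Unit V) ?W A)" by (simp add: LUnit_nat')
  also have "\<dots> = w \<cdot> (LUnit V ?W \<boxtimes> \<iota> A)" by (simp add: LUnit_Tens)
  finally show ?thesis .
qed

end

lemma ex1_eqI: "\<exists>!x. P x \<Longrightarrow> P a \<Longrightarrow> P b \<Longrightarrow> a = b"
  by blast

section \<open>Lifting against trivial fibrations\<close>

locale monoidal_model =
  closed_symmetric_monoidal_category V
  for V :: "('o, 'm) smcat" (structure) and U :: "'u itself" and M :: "'m model_str" +
  assumes univ: "universe TYPE('u)"
    and mmc: "monoidal_model_category TYPE('u) V M"
begin

abbreviation TF :: "'m set" where "TF \<equiv> Weq M \<inter> Fib M"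

lemma model: "model_category TYPE('u) V M"
  using mmc by (simp add: monoidal_model_category_def)

lemma V_complete: "complete TYPE('u) V" and V_cocomplete: "cocomplete TYPE('u) V"
  using model by (simp_all add: model_category_def)

lemma Cof_arr: "i \<in> Cof M \<Longrightarrow> i \<in> Arr V"
  and TF_arr: "p \<in> TF \<Longrightarrow> p \<in> Arr V"
  using model by (auto simp: model_category_def)

lemma TF_lift:
  assumes "i \<in> Cof M" "p \<in> TF" "f \<in> homs V (Dom V i) (Dom V p)" "g \<in> homs V (Cod V i) (Cod V p)"
    "p \<cdot> f = g \<cdot> i"
  obtains h where "h \<in> homs V (Cod V i) (Dom V p)" "h \<cdot> i = f" "p \<cdot> h = g"
  using assms model unfolding model_category_def lifts_against_def by blast

text \<open>The retract argument.\<close>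

lemma TFI:
  assumes p: "p \<in> Arr V" and lift: "\<And>i. i \<in> Cof M \<Longrightarrow> lifts_against V i p"
  shows "p \<in> TF"
proof -
  obtain i q where i: "i \<in> Cof M" and q: "q \<in> TF" and qi: "Dom V q = Cod V i" "p = q \<cdot> i"
    using model p unfolding model_category_def by blast
  note [simp] = Cof_arr[OF i] TF_arr[OF q] qi(1)
  have [simp]: "Dom V p = Dom V i" "Cod V p = Cod V q" by (simp_all add: qi(2))
  \<comment> \<open>Lifting \<open>i\<close> against \<open>p\<close>, in the square with an
    identity on top and \<open>q\<close> at the bottom, exhibits \<open>p\<close> as a retract of
    \<open>q\<close>.\<close>
  obtain h where h: "h \<in> homs V (Cod V i) (Dom V p)" "h \<cdot> i = \<iota> (Dom V p)" "p \<cdot> h = q"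
    using lift[OF i, unfolded lifts_against_def, rule_format, of "\<iota> (Dom V p)" q] p
    by (auto simp: in_homs qi(2))
  note [simp] = h(1)[unfolded in_homs]
  have "is_retract V p q"
    unfolding is_retract_def
  proof (intro conjI)
    show "\<exists>s \<in> homs V (Dom V p) (Dom V q). \<exists>r \<in> homs V (Dom V q) (Dom V p).
      \<exists>s' \<in> homs V (Cod V p) (Cod V q). \<exists>r' \<in> homs V (Cod V q) (Cod V p).
        r \<cdot> s = \<iota> (Dom V p) \<and> r' \<cdot> s' = \<iota> (Cod V p) \<and> q \<cdot> s = s' \<cdot> p \<and> p \<cdot> r = r' \<cdot> q"
      by (rule bexI[of _ i], rule bexI[of _ h], rule bexI[of _ "\<iota> (Cod V q)"], rule bexI[of _ "\<iota> (Cod V q)"])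
        (simp_all add: in_homs h(2,3) qi(2)[symmetric] p)
  qed (simp_all add: p)
  then show ?thesis
    using q model unfolding model_category_def retract_closed_def by blast
qed

text \<open>Identities will fill the components of a family that a lifting problem leaves
  unchanged.\<close>

lemma TF_Ident:
  assumes [simp]: "X \<in> Obj V"
  shows "\<iota> X \<in> TF"
proof (rule TFI)
  fix i assume "i \<in> Cof M"
  then show "lifts_against V i (\<iota> X)"
    using Cof_arr[of i] by (auto simp: lifts_against_def in_homs)
qed simp

text \<open>The pushout-product axiom with the pushout eliminated: \<open>a\<close> and
  \<open>b\<close> are the two components of a map out of the pushout, and the cofibration
  \<open>h\<close> is the pushout-product of \<open>j\<close> and \<open>i\<close>. In this form its
  data are transposes of maps into internal homs.\<close>

lemma pushout_product_lift:
  assumes i: "i \<in> Cof M" "i \<in> homs V A B" and j: "j \<in> Cof M" "j \<in> homs V C D"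
    and p: "p \<in> TF" "p \<in> homs V X Y"
    and a: "a \<in> homs V (D \<otimes> A) X" and b: "b \<in> homs V (C \<otimes> B) X" and d: "d \<in> homs V (D \<otimes> B) Y"
    and eq: "a \<cdot> (j \<boxtimes> \<iota> A) = b \<cdot> (\<iota> C \<boxtimes> i)" "p \<cdot> a = d \<cdot> (\<iota> D \<boxtimes> i)" "p \<cdot> b = d \<cdot> (j \<boxtimes> \<iota> B)"
  obtains k where "k \<in> homs V (D \<otimes> B) X" "k \<cdot> (\<iota> D \<boxtimes> i) = a" "k \<cdot> (j \<boxtimes> \<iota> B) = b" "p \<cdot> k = d"
proof -
  note [simp] = i(2)[unfolded in_homs] j(2)[unfolded in_homs] p(2)[unfolded in_homs]
    a[unfolded in_homs] b[unfolded in_homs] d[unfolded in_homs]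
  have [simp]: "A \<in> Obj V" "B \<in> Obj V" "C \<in> Obj V" "D \<in> Obj V"
    using homs_Obj[OF i(2)] homs_Obj[OF j(2)] by auto
  obtain s t where po: "is_pushout V (\<iota> C \<boxtimes> i) (j \<boxtimes> \<iota> A) s t"
    using cocomplete_pushout[OF univ V_cocomplete category_axioms, of "\<iota> C \<boxtimes> i" "j \<boxtimes> \<iota> A"] by auto
  define Q where "Q = Cod V s"
  have s: "s \<in> homs V (C \<otimes> B) Q" and t: "t \<in> homs V (D \<otimes> A) Q"
    using po by (simp_all add: is_pushout_def Q_def)
  have un: "\<exists>!h. h \<in> homs V Q Y \<and> h \<cdot> s = i' \<and> h \<cdot> t = j'"
    if "i' \<in> homs V (C \<otimes> B) Y" "j' \<in> homs V (D \<otimes> A) Y" "i' \<cdot> (\<iota> C \<boxtimes> i) = j' \<cdot> (j \<boxtimes> \<iota> A)" for Y i' j'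
    using po that by (simp add: is_pushout_def Q_def)
  note [simp] = s[unfolded in_homs] t[unfolded in_homs]
  obtain h where h: "h \<in> homs V Q (D \<otimes> B)" "h \<cdot> s = j \<boxtimes> \<iota> B" "h \<cdot> t = \<iota> D \<boxtimes> i"
  proof -
    have "\<exists>!h. h \<in> homs V Q (D \<otimes> B) \<and> h \<cdot> s = j \<boxtimes> \<iota> B \<and> h \<cdot> t = \<iota> D \<boxtimes> i"
      by (rule un) (simp_all add: in_homs)
    then show thesis using that by blast
  qed
  note [simp] = h(1)[unfolded in_homs]
  have "is_pushout_product V j i h"
    unfolding is_pushout_product_def using po h by (intro exI[of _ s] exI[of _ t]) simp
  moreover have "pushout_product_axiom V M" using mmc by (simp add: monoidal_model_category_def)
  ultimately have hC: "h \<in> Cof M" using i(1) j(1) unfolding pushout_product_axiom_def by blast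
  have "\<exists>!f. f \<in> homs V Q X \<and> f \<cdot> s = b \<and> f \<cdot> t = a"
    by (rule un) (simp_all add: a b eq(1))
  then obtain f where f: "f \<in> homs V Q X" "f \<cdot> s = b" "f \<cdot> t = a" by blast
  note [simp] = f(1)[unfolded in_homs]
  have pf: "p \<cdot> f = d \<cdot> h"
  proof -
    have "\<exists>!l. l \<in> homs V Q Y \<and> l \<cdot> s = d \<cdot> (j \<boxtimes> \<iota> B) \<and> l \<cdot> t = d \<cdot> (\<iota> D \<boxtimes> i)"
      by (rule un) (simp_all add: in_homs)
    then show ?thesis by (rule ex1_eqI) (simp_all add: in_homs f h eq)
  qed
  obtain k where k: "k \<in> homs V (D \<otimes> B) X" "k \<cdot> h = f" "p \<cdot> k = d"
    by (rule TF_lift[OF hC p(1), of f d]) (simp_all add: in_homs pf)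
  note [simp] = k(1)[unfolded in_homs]
  have "(k \<cdot> h) \<cdot> t = a" "(k \<cdot> h) \<cdot> s = b" using f k(2) by simp_all
  then have "k \<cdot> (\<iota> D \<boxtimes> i) = a" "k \<cdot> (j \<boxtimes> \<iota> B) = b" by (simp_all add: h)
  then show thesis using that k by blast
qed

text \<open>For module maps \<open>e : X \<rightarrow> Y\<close> and a map \<open>i : A \<rightarrow> B\<close> of \<open>V\<close> there is a module
  \<open>[A, X] \<times>\<^bsub>[A, Y]\<^esub> [B, Y]\<close>, with universal maps \<open>wX\<close> and \<open>wY\<close>.\<close>

lemma ex_hom_module:
  assumes R: "is_monoid V R" and X: "is_left_module V R X" and Y: "is_left_module V R Y"
    and e: "e \<in> left_module_homs V R X Y" and i: "i \<in> homs V A B"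
  obtains W wX wY where "is_left_module V R W" "linear R W A X wX" "linear R W B Y wY"
    "e \<cdot> wX = wY \<cdot> (\<iota> (Car W) \<boxtimes> i)"
    "\<And>T a b. T \<in> Obj V \<Longrightarrow> a \<in> homs V (T \<otimes> A) (Car X) \<Longrightarrow> b \<in> homs V (T \<otimes> B) (Car Y) \<Longrightarrow>
      e \<cdot> a = b \<cdot> (\<iota> T \<boxtimes> i) \<Longrightarrow>
      \<exists>!h. h \<in> homs V T (Car W) \<and> wX \<cdot> (h \<boxtimes> \<iota> A) = a \<and> wY \<cdot> (h \<boxtimes> \<iota> B) = b"
proof -
  let ?R = "MCar R"
  note [simp] = is_monoidD[OF R] is_left_moduleD[OF X] is_left_moduleD[OF Y] left_module_homsD(1-3)[OF e]
    i[unfolded in_homs]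
  have [simp]: "A \<in> Obj V" "B \<in> Obj V" using homs_Obj[OF i] by auto
  \<comment> \<open>\<open>E1\<close>, \<open>E2\<close>, \<open>E3\<close> are the internal homs
    [A,X], [B,Y] and [A,Y]. Below, \<open>p\<close> is restriction along \<open>i\<close>,
    \<open>q\<close> is composition with \<open>e\<close>, and \<open>P\<close> is their
    pullback.\<close>
  obtain E1 ev1 where E1 [simp]: "E1 \<in> Obj V" and ev1: "ev1 \<in> homs V (E1 \<otimes> A) (Car X)"
    and un1: "\<And>Z f. Z \<in> Obj V \<Longrightarrow> f \<in> homs V (Z \<otimes> A) (Car X) \<Longrightarrow> \<exists>!g. g \<in> homs V Z E1 \<and> ev1 \<cdot> (g \<boxtimes> \<iota> A) = f"
    using closed_right[of A "Car X"] by auto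
  obtain E2 ev2 where E2 [simp]: "E2 \<in> Obj V" and ev2: "ev2 \<in> homs V (E2 \<otimes> B) (Car Y)"
    and un2: "\<And>Z f. Z \<in> Obj V \<Longrightarrow> f \<in> homs V (Z \<otimes> B) (Car Y) \<Longrightarrow> \<exists>!g. g \<in> homs V Z E2 \<and> ev2 \<cdot> (g \<boxtimes> \<iota> B) = f"
    using closed_right[of B "Car Y"] by auto
  obtain E3 ev3 where E3 [simp]: "E3 \<in> Obj V" and ev3: "ev3 \<in> homs V (E3 \<otimes> A) (Car Y)"
    and un3: "\<And>Z f. Z \<in> Obj V \<Longrightarrow> f \<in> homs V (Z \<otimes> A) (Car Y) \<Longrightarrow> \<exists>!g. g \<in> homs V Z E3 \<and> ev3 \<cdot> (g \<boxtimes> \<iota> A) = f"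
    using closed_right[of A "Car Y"] by auto
  note [simp] = ev1[unfolded in_homs] ev2[unfolded in_homs] ev3[unfolded in_homs]
  have "\<exists>!p. p \<in> homs V E2 E3 \<and> ev3 \<cdot> (p \<boxtimes> \<iota> A) = ev2 \<cdot> (\<iota> E2 \<boxtimes> i)"
    by (rule un3) (simp_all add: in_homs)
  then obtain p where p: "p \<in> homs V E2 E3" "ev3 \<cdot> (p \<boxtimes> \<iota> A) = ev2 \<cdot> (\<iota> E2 \<boxtimes> i)" by blast
  have "\<exists>!q. q \<in> homs V E1 E3 \<and> ev3 \<cdot> (q \<boxtimes> \<iota> A) = e \<cdot> ev1"
    by (rule un3) (simp_all add: in_homs)
  then obtain q where q: "q \<in> homs V E1 E3" "ev3 \<cdot> (q \<boxtimes> \<iota> A) = e \<cdot> ev1" by blast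
  note [simp] = p(1)[unfolded in_homs] q(1)[unfolded in_homs]
  obtain P g f where g: "g \<in> homs V P E2" and f: "f \<in> homs V P E1" and gf: "p \<cdot> g = q \<cdot> f"
    and un: "\<And>T g' f'. g' \<in> homs V T E2 \<Longrightarrow> f' \<in> homs V T E1 \<Longrightarrow> p \<cdot> g' = q \<cdot> f' \<Longrightarrow>
      \<exists>!h. h \<in> homs V T P \<and> g \<cdot> h = g' \<and> f \<cdot> h = f'"
  proof (rule complete_limit[OF univ V_complete category_axioms p(1) q(1) q(1) q(1)])
    fix Z g e
    assume "g \<in> homs V Z E2" "e \<in> homs V Z E1" "p \<cdot> g = q \<cdot> e"
    "\<And>Y g' e'. g' \<in> homs V Y E2 \<Longrightarrow> e' \<in> homs V Y E1 \<Longrightarrow> p \<cdot> g' = q \<cdot> e' \<Longrightarrow> q \<cdot> e' = q \<cdot> e' \<Longrightarrow>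
      \<exists>!h. h \<in> homs V Y Z \<and> g \<cdot> h = g' \<and> e \<cdot> h = e'"
    then show thesis by (intro that) simp_all
  qed
  have [simp]: "P \<in> Obj V" using homs_Obj[OF g] by auto
  note [simp] = g[unfolded in_homs] f[unfolded in_homs]
  define wX where "wX = ev1 \<cdot> (f \<boxtimes> \<iota> A)"
  define wY where "wY = ev2 \<cdot> (g \<boxtimes> \<iota> B)"
  have wX [simp]: "wX \<in> Arr V" "Dom V wX = P \<otimes> A" "Cod V wX = Car X" by (simp_all add: wX_def)
  have wY [simp]: "wY \<in> Arr V" "Dom V wY = P \<otimes> B" "Cod V wY = Car Y" by (simp_all add: wY_def)
  have "e \<cdot> wX = (ev3 \<cdot> (q \<boxtimes> \<iota> A)) \<cdot> (f \<boxtimes> \<iota> A)" by (simp only: q) (simp add: wX_def)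
  also have "\<dots> = (ev3 \<cdot> (p \<boxtimes> \<iota> A)) \<cdot> (g \<boxtimes> \<iota> A)" by (simp add: gf)
  also have "\<dots> = wY \<cdot> (\<iota> P \<boxtimes> i)" by (simp only: p) (simp add: wY_def)
  finally have ew: "e \<cdot> wX = wY \<cdot> (\<iota> P \<boxtimes> i)" .
  have univ_W: "\<exists>!h. h \<in> homs V T P \<and> wX \<cdot> (h \<boxtimes> \<iota> A) = a \<and> wY \<cdot> (h \<boxtimes> \<iota> B) = b"
    if T: "T \<in> Obj V" and a: "a \<in> homs V (T \<otimes> A) (Car X)" and b: "b \<in> homs V (T \<otimes> B) (Car Y)"
      and eq: "e \<cdot> a = b \<cdot> (\<iota> T \<boxtimes> i)" for T a b
  proof -
    note [simp] = T a[unfolded in_homs] b[unfolded in_homs]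
    obtain f' where f': "f' \<in> homs V T E1" "ev1 \<cdot> (f' \<boxtimes> \<iota> A) = a" using un1[OF T a] by blast
    obtain g' where g': "g' \<in> homs V T E2" "ev2 \<cdot> (g' \<boxtimes> \<iota> B) = b" using un2[OF T b] by blast
    note [simp] = f'(1)[unfolded in_homs] g'(1)[unfolded in_homs]
    have "ev3 \<cdot> ((p \<cdot> g') \<boxtimes> \<iota> A) = (ev3 \<cdot> (p \<boxtimes> \<iota> A)) \<cdot> (g' \<boxtimes> \<iota> A)" by simp
    also have "\<dots> = (ev2 \<cdot> (g' \<boxtimes> \<iota> B)) \<cdot> (\<iota> T \<boxtimes> i)" by (simp only: p) simp
    also have "\<dots> = e \<cdot> (ev1 \<cdot> (f' \<boxtimes> \<iota> A))" by (simp only: f' g' eq)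
    also have "\<dots> = (ev3 \<cdot> (q \<boxtimes> \<iota> A)) \<cdot> (f' \<boxtimes> \<iota> A)" by (simp only: q) simp
    also have "\<dots> = ev3 \<cdot> ((q \<cdot> f') \<boxtimes> \<iota> A)" by simp
    finally have "p \<cdot> g' = q \<cdot> f'"
      by (intro ex1_eqI[OF un3[of T "ev3 \<cdot> ((q \<cdot> f') \<boxtimes> \<iota> A)"]]) (simp_all add: in_homs)
    then obtain h where h: "h \<in> homs V T P" "g \<cdot> h = g'" "f \<cdot> h = f'"
      and h_un: "\<And>k. k \<in> homs V T P \<Longrightarrow> g \<cdot> k = g' \<Longrightarrow> f \<cdot> k = f' \<Longrightarrow> k = h"
      using un[OF g'(1) f'(1)] by blast
    note [simp] = h(1)[unfolded in_homs]
    show ?thesis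
    proof (intro ex1I[of _ h] conjI)
      show "wX \<cdot> (h \<boxtimes> \<iota> A) = a" "wY \<cdot> (h \<boxtimes> \<iota> B) = b"
        using h f' g' by (simp_all add: wX_def wY_def)
      fix k assume k: "k \<in> homs V T P \<and> wX \<cdot> (k \<boxtimes> \<iota> A) = a \<and> wY \<cdot> (k \<boxtimes> \<iota> B) = b"
      note [simp] = k[THEN conjunct1, unfolded in_homs]
      show "k = h"
      proof (rule h_un)
        have "ev1 \<cdot> ((f \<cdot> k) \<boxtimes> \<iota> A) = a" "ev2 \<cdot> ((g \<cdot> k) \<boxtimes> \<iota> B) = b"
          using k by (simp_all add: wX_def wY_def)
        then show "g \<cdot> k = g'" "f \<cdot> k = f'"
          by - (rule ex1_eqI[OF un2[OF T b]] ex1_eqI[OF un1[OF T a]]; simp add: in_homs f'(2) g'(2))+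
      qed (simp add: in_homs)
    qed (rule h(1))
  qed
  have W_eqI: "h = k" if h: "h \<in> homs V T P" and k: "k \<in> homs V T P"
    and eq: "wX \<cdot> (h \<boxtimes> \<iota> A) = wX \<cdot> (k \<boxtimes> \<iota> A)" "wY \<cdot> (h \<boxtimes> \<iota> B) = wY \<cdot> (k \<boxtimes> \<iota> B)" for T h k
  proof -
    have [simp]: "T \<in> Obj V" using homs_Obj[OF h] by auto
    note [simp] = h[unfolded in_homs] k[unfolded in_homs]
    have "e \<cdot> (wX \<cdot> (k \<boxtimes> \<iota> A)) = (e \<cdot> wX) \<cdot> (k \<boxtimes> \<iota> A)" by simp
    also have "\<dots> = (wY \<cdot> (k \<boxtimes> \<iota> B)) \<cdot> (\<iota> T \<boxtimes> i)" by (simp only: ew) simp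
    finally have "\<exists>!h. h \<in> homs V T P \<and> wX \<cdot> (h \<boxtimes> \<iota> A) = wX \<cdot> (k \<boxtimes> \<iota> A) \<and> wY \<cdot> (h \<boxtimes> \<iota> B) = wY \<cdot> (k \<boxtimes> \<iota> B)"
      by (intro univ_W) (simp_all add: in_homs)
    then show ?thesis
      by (rule ex1_eqI) (simp_all only: h k eq simp_thms)
  qed
  \<comment> \<open>\<open>R\<close> acts on maps through their values. The two pointwise actions
    agree in [A,Y] because \<open>e\<close> is linear, so they induce an action on the
    pullback.\<close>
  define aX where "aX = Act X \<cdot> (\<iota> ?R \<boxtimes> wX) \<cdot> Assoc V ?R P A"
  define aY where "aY = Act Y \<cdot> (\<iota> ?R \<boxtimes> wY) \<cdot> Assoc V ?R P B"
  have "e \<cdot> aX = (e \<cdot> Act X) \<cdot> (\<iota> ?R \<boxtimes> wX) \<cdot> Assoc V ?R P A" by (simp add: aX_def)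
  also have "\<dots> = Act Y \<cdot> (\<iota> ?R \<boxtimes> (e \<cdot> wX)) \<cdot> Assoc V ?R P A"
    by (simp add: left_module_homsD(4)[OF e])
  also have "\<dots> = Act Y \<cdot> (\<iota> ?R \<boxtimes> wY) \<cdot> (\<iota> ?R \<boxtimes> (\<iota> P \<boxtimes> i)) \<cdot> Assoc V ?R P A"
    by (simp add: ew)
  also have "\<dots> = Act Y \<cdot> (\<iota> ?R \<boxtimes> wY) \<cdot> (Assoc V ?R P B \<cdot> ((\<iota> ?R \<boxtimes> \<iota> P) \<boxtimes> i))"
    by (subst Assoc_nat') auto
  also have "\<dots> = aY \<cdot> (\<iota> (?R \<otimes> P) \<boxtimes> i)" by (simp add: aY_def)
  finally have "\<exists>!act. act \<in> homs V (?R \<otimes> P) P \<and> wX \<cdot> (act \<boxtimes> \<iota> A) = aX \<and> wY \<cdot> (act \<boxtimes> \<iota> B) = aY"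
    by (intro univ_W) (simp_all add: in_homs aX_def aY_def)
  then obtain act where act: "act \<in> homs V (?R \<otimes> P) P" "wX \<cdot> (act \<boxtimes> \<iota> A) = aX" "wY \<cdot> (act \<boxtimes> \<iota> B) = aY"
    by blast
  define W where "W = \<lparr>Car = P, Act = act\<rparr>"
  have lX: "linear R W A X wX" and lY: "linear R W B Y wY"
    using act by (simp_all add: linear_def W_def in_homs aX_def aY_def)
  have W: "Car W \<in> Obj V" "Act W \<in> homs V (?R \<otimes> Car W) (Car W)" using act by (simp_all add: W_def)
  note [simp] = W(1) W(2)[unfolded in_homs]
  have Car_W: "Car W = P" by (simp add: W_def)
  have "is_left_module V R W"
    unfolding is_left_module_def
  proof (intro conjI W)
    show "Act W \<cdot> (MMul R \<boxtimes> \<iota> (Car W)) = Act W \<cdot> (\<iota> ?R \<boxtimes> Act W) \<cdot> Assoc V ?R ?R (Car W)"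
      by (rule W_eqI[OF _ _ linear_assoc[OF R X _ lX W] linear_assoc[OF R Y _ lY W]])
        (simp_all add: in_homs Car_W[symmetric])
    show "Act W \<cdot> (MOne R \<boxtimes> \<iota> (Car W)) = LUnit V (Car W)"
      by (rule W_eqI[OF _ _ linear_unit[OF R X _ lX W] linear_unit[OF R Y _ lY W]])
        (simp_all add: in_homs Car_W[symmetric])
  qed
  then show thesis
    using lX lY ew univ_W by (intro that[of W wX wY]) (simp_all add: Car_W)
qed

end

section \<open>Objects of linear lifts\<close>

context monoidal_model
begin

text \<open>\<open>P\<close> is the pullback of \<open>G \<rightarrow> Hom\<^sub>R(L, Y) \<leftarrow> Hom\<^sub>R(L, X)\<close>, where \<open>e : X \<rightarrow> Y\<close> and the first map
  is adjoint to \<open>c : L \<otimes> G \<rightarrow> Y\<close>.\<close>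

definition is_lift_object where
  "is_lift_object R L X e G c P \<pi> \<epsilon> \<longleftrightarrow>
     \<pi> \<in> homs V P G \<and> linear R L P X \<epsilon> \<and> e \<cdot> \<epsilon> = c \<cdot> (\<iota> (Car L) \<boxtimes> \<pi>) \<and>
     (\<forall>T g k. g \<in> homs V T G \<longrightarrow> linear R L T X k \<longrightarrow> e \<cdot> k = c \<cdot> (\<iota> (Car L) \<boxtimes> g) \<longrightarrow>
        (\<exists>!h. h \<in> homs V T P \<and> \<pi> \<cdot> h = g \<and> \<epsilon> \<cdot> (\<iota> (Car L) \<boxtimes> h) = k))"

text \<open>One limit imposes two conditions at once: agreement in the internal hom [L,Y], and
  linearity, as an equaliser of two maps out of [L,X]. If \<open>Y\<close> is a module and
  \<open>c\<close> is linear, then agreement in [L,Y] is agreement among linear maps.\<close>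

lemma ex_lift_object:
  assumes R: "is_monoid V R" and L: "is_left_module V R L" and X: "is_left_module V R X"
    and Y: "Car Y \<in> Obj V" and e: "e \<in> homs V (Car X) (Car Y)" and c: "c \<in> homs V (Car L \<otimes> G) (Car Y)"
    and G: "G \<in> Obj V"
  shows "\<exists>P \<pi> \<epsilon>. is_lift_object R L X e G c P \<pi> \<epsilon>"
proof -
  let ?R = "MCar R" and ?L = "Car L"
  note [simp] = is_monoidD[OF R] is_left_moduleD[OF X] is_left_moduleD[OF L] Y e[unfolded in_homs]
    c[unfolded in_homs] G
  \<comment> \<open>\<open>E1\<close>, \<open>E2\<close>, \<open>E3\<close> are the internal homs
    [L,X], [L,Y] and [R \<otimes> L, X]. Below, \<open>p\<close> is the transpose of
    \<open>c\<close> and \<open>q\<close> is composition with \<open>e\<close>.\<close>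
  obtain E1 ev1 where E1 [simp]: "E1 \<in> Obj V" and ev1: "ev1 \<in> homs V (?L \<otimes> E1) (Car X)"
    and un1: "\<And>Z f. Z \<in> Obj V \<Longrightarrow> f \<in> homs V (?L \<otimes> Z) (Car X) \<Longrightarrow> \<exists>!g. g \<in> homs V Z E1 \<and> ev1 \<cdot> (\<iota> ?L \<boxtimes> g) = f"
    using closed_left[of ?L "Car X"] by auto
  obtain E2 ev2 where E2 [simp]: "E2 \<in> Obj V" and ev2: "ev2 \<in> homs V (?L \<otimes> E2) (Car Y)"
    and un2: "\<And>Z f. Z \<in> Obj V \<Longrightarrow> f \<in> homs V (?L \<otimes> Z) (Car Y) \<Longrightarrow> \<exists>!g. g \<in> homs V Z E2 \<and> ev2 \<cdot> (\<iota> ?L \<boxtimes> g) = f"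
    using closed_left[of ?L "Car Y"] by auto
  obtain E3 ev3 where E3 [simp]: "E3 \<in> Obj V" and ev3: "ev3 \<in> homs V ((?R \<otimes> ?L) \<otimes> E3) (Car X)"
    and un3: "\<And>Z f. Z \<in> Obj V \<Longrightarrow> f \<in> homs V ((?R \<otimes> ?L) \<otimes> Z) (Car X) \<Longrightarrow>
      \<exists>!g. g \<in> homs V Z E3 \<and> ev3 \<cdot> (\<iota> (?R \<otimes> ?L) \<boxtimes> g) = f"
    using closed_left[of "?R \<otimes> ?L" "Car X"] by auto
  note [simp] = ev1[unfolded in_homs] ev2[unfolded in_homs] ev3[unfolded in_homs]
  have "\<exists>!p. p \<in> homs V G E2 \<and> ev2 \<cdot> (\<iota> ?L \<boxtimes> p) = c" by (rule un2) (simp_all add: in_homs)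
  then obtain p where p: "p \<in> homs V G E2" "ev2 \<cdot> (\<iota> ?L \<boxtimes> p) = c" by blast
  have "\<exists>!q. q \<in> homs V E1 E2 \<and> ev2 \<cdot> (\<iota> ?L \<boxtimes> q) = e \<cdot> ev1" by (rule un2) (simp_all add: in_homs)
  then obtain q where q: "q \<in> homs V E1 E2" "ev2 \<cdot> (\<iota> ?L \<boxtimes> q) = e \<cdot> ev1" by blast
  have "\<exists>!d. d \<in> homs V E1 E3 \<and> ev3 \<cdot> (\<iota> (?R \<otimes> ?L) \<boxtimes> d) = ev1 \<cdot> (Act L \<boxtimes> \<iota> E1)"
    by (rule un3) (simp_all add: in_homs)
  then obtain d1 where d1: "d1 \<in> homs V E1 E3" "ev3 \<cdot> (\<iota> (?R \<otimes> ?L) \<boxtimes> d1) = ev1 \<cdot> (Act L \<boxtimes> \<iota> E1)" by blast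
  have "\<exists>!d. d \<in> homs V E1 E3 \<and> ev3 \<cdot> (\<iota> (?R \<otimes> ?L) \<boxtimes> d) = Act X \<cdot> (\<iota> ?R \<boxtimes> ev1) \<cdot> Assoc V ?R ?L E1"
    by (rule un3) (simp_all add: in_homs)
  then obtain d2 where d2: "d2 \<in> homs V E1 E3"
    "ev3 \<cdot> (\<iota> (?R \<otimes> ?L) \<boxtimes> d2) = Act X \<cdot> (\<iota> ?R \<boxtimes> ev1) \<cdot> Assoc V ?R ?L E1" by blast
  note [simp] = p(1)[unfolded in_homs] q(1)[unfolded in_homs] d1(1)[unfolded in_homs] d2(1)[unfolded in_homs]
  text \<open>The two parallel maps \<open>d1\<close> and \<open>d2\<close> test linearity of a map out of \<open>L\<close>.\<close>
  have d1': "ev3 \<cdot> (\<iota> (?R \<otimes> ?L) \<boxtimes> (d1 \<cdot> f)) = (ev1 \<cdot> (\<iota> ?L \<boxtimes> f)) \<cdot> (Act L \<boxtimes> \<iota> T)"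
    and d2': "ev3 \<cdot> (\<iota> (?R \<otimes> ?L) \<boxtimes> (d2 \<cdot> f)) = Act X \<cdot> (\<iota> ?R \<boxtimes> (ev1 \<cdot> (\<iota> ?L \<boxtimes> f))) \<cdot> Assoc V ?R ?L T"
    if f: "f \<in> homs V T E1" for T f
  proof -
    have [simp]: "T \<in> Obj V" using homs_Obj[OF f] by simp
    note [simp] = f[unfolded in_homs]
    have "ev3 \<cdot> (\<iota> (?R \<otimes> ?L) \<boxtimes> (d1 \<cdot> f)) = (ev3 \<cdot> (\<iota> (?R \<otimes> ?L) \<boxtimes> d1)) \<cdot> (\<iota> (?R \<otimes> ?L) \<boxtimes> f)" by simp
    then show "ev3 \<cdot> (\<iota> (?R \<otimes> ?L) \<boxtimes> (d1 \<cdot> f)) = (ev1 \<cdot> (\<iota> ?L \<boxtimes> f)) \<cdot> (Act L \<boxtimes> \<iota> T)"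
      by (simp add: d1(2))
    have "ev3 \<cdot> (\<iota> (?R \<otimes> ?L) \<boxtimes> (d2 \<cdot> f)) = (ev3 \<cdot> (\<iota> (?R \<otimes> ?L) \<boxtimes> d2)) \<cdot> (\<iota> (?R \<otimes> ?L) \<boxtimes> f)" by simp
    also have "\<dots> = Act X \<cdot> (\<iota> ?R \<boxtimes> ev1) \<cdot> (Assoc V ?R ?L E1 \<cdot> ((\<iota> ?R \<boxtimes> \<iota> ?L) \<boxtimes> f))"
      by (simp add: d2(2))
    also have "\<dots> = Act X \<cdot> (\<iota> ?R \<boxtimes> (ev1 \<cdot> (\<iota> ?L \<boxtimes> f))) \<cdot> Assoc V ?R ?L T"
      by (subst Assoc_nat') auto
    finally show "ev3 \<cdot> (\<iota> (?R \<otimes> ?L) \<boxtimes> (d2 \<cdot> f)) = Act X \<cdot> (\<iota> ?R \<boxtimes> (ev1 \<cdot> (\<iota> ?L \<boxtimes> f))) \<cdot> Assoc V ?R ?L T" .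
  qed
  obtain P \<pi> \<kappa> where \<pi>: "\<pi> \<in> homs V P G" and \<kappa>: "\<kappa> \<in> homs V P E1"
    and eq: "p \<cdot> \<pi> = q \<cdot> \<kappa>" "d1 \<cdot> \<kappa> = d2 \<cdot> \<kappa>"
    and un: "\<And>T g' f'. g' \<in> homs V T G \<Longrightarrow> f' \<in> homs V T E1 \<Longrightarrow> p \<cdot> g' = q \<cdot> f' \<Longrightarrow> d1 \<cdot> f' = d2 \<cdot> f' \<Longrightarrow>
      \<exists>!h. h \<in> homs V T P \<and> \<pi> \<cdot> h = g' \<and> \<kappa> \<cdot> h = f'"
  proof (rule complete_limit[OF univ V_complete category_axioms p(1) q(1) d1(1) d2(1)])
    fix Z g e
    assume "g \<in> homs V Z G" "e \<in> homs V Z E1" "p \<cdot> g = q \<cdot> e" "d1 \<cdot> e = d2 \<cdot> e"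
    "\<And>Y g' e'. g' \<in> homs V Y G \<Longrightarrow> e' \<in> homs V Y E1 \<Longrightarrow> p \<cdot> g' = q \<cdot> e' \<Longrightarrow> d1 \<cdot> e' = d2 \<cdot> e' \<Longrightarrow>
      \<exists>!h. h \<in> homs V Y Z \<and> g \<cdot> h = g' \<and> e \<cdot> h = e'"
    then show thesis by (rule that)
  qed
  have [simp]: "P \<in> Obj V" using homs_Obj[OF \<pi>] by auto
  note [simp] = \<pi>[unfolded in_homs] \<kappa>[unfolded in_homs]
  define \<epsilon> where "\<epsilon> = ev1 \<cdot> (\<iota> ?L \<boxtimes> \<kappa>)"
  have [simp]: "\<epsilon> \<in> Arr V" "Dom V \<epsilon> = ?L \<otimes> P" "Cod V \<epsilon> = Car X" by (simp_all add: \<epsilon>_def)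
  have lin: "linear R L P X \<epsilon>"
    using d1'[OF \<kappa>] d2'[OF \<kappa>] by (simp add: linear_def in_homs eq \<epsilon>_def)
  have "e \<cdot> \<epsilon> = (ev2 \<cdot> (\<iota> ?L \<boxtimes> q)) \<cdot> (\<iota> ?L \<boxtimes> \<kappa>)" by (simp only: q) (simp add: \<epsilon>_def)
  also have "\<dots> = (ev2 \<cdot> (\<iota> ?L \<boxtimes> p)) \<cdot> (\<iota> ?L \<boxtimes> \<pi>)" by (simp add: eq)
  also have "\<dots> = c \<cdot> (\<iota> ?L \<boxtimes> \<pi>)" by (simp only: p)
  finally have e\<epsilon>: "e \<cdot> \<epsilon> = c \<cdot> (\<iota> ?L \<boxtimes> \<pi>)" .
  have "\<exists>!h. h \<in> homs V T P \<and> \<pi> \<cdot> h = g \<and> \<epsilon> \<cdot> (\<iota> ?L \<boxtimes> h) = k"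
    if g: "g \<in> homs V T G" and k: "linear R L T X k" and ek: "e \<cdot> k = c \<cdot> (\<iota> ?L \<boxtimes> g)" for T g k
  proof -
    have T [simp]: "T \<in> Obj V" using homs_Obj[OF g] by simp
    have k1: "k \<in> homs V (?L \<otimes> T) (Car X)" using k by (simp add: linear_def)
    note [simp] = g[unfolded in_homs] k1[unfolded in_homs]
    obtain f where f: "f \<in> homs V T E1" "ev1 \<cdot> (\<iota> ?L \<boxtimes> f) = k" using un1[OF T k1] by blast
    note [simp] = f(1)[unfolded in_homs]
    have df: "d1 \<cdot> f = d2 \<cdot> f"
    proof (rule ex1_eqI[OF un3])
      show "k \<cdot> (Act L \<boxtimes> \<iota> T) \<in> homs V ((?R \<otimes> ?L) \<otimes> T) (Car X)" by (simp add: in_homs)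
    qed (use d1'[OF f(1)] d2'[OF f(1)] k in \<open>simp_all add: linear_def in_homs f(2)\<close>)
    have pf: "p \<cdot> g = q \<cdot> f"
    proof (rule ex1_eqI[OF un2])
      show "e \<cdot> k \<in> homs V (?L \<otimes> T) (Car Y)" by (simp add: in_homs)
      have "ev2 \<cdot> (\<iota> ?L \<boxtimes> (p \<cdot> g)) = (ev2 \<cdot> (\<iota> ?L \<boxtimes> p)) \<cdot> (\<iota> ?L \<boxtimes> g)" by simp
      then show "p \<cdot> g \<in> homs V T E2 \<and> ev2 \<cdot> (\<iota> ?L \<boxtimes> (p \<cdot> g)) = e \<cdot> k"
        by (simp add: p(2) ek in_homs)
      have "ev2 \<cdot> (\<iota> ?L \<boxtimes> (q \<cdot> f)) = (ev2 \<cdot> (\<iota> ?L \<boxtimes> q)) \<cdot> (\<iota> ?L \<boxtimes> f)" by simp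
      then show "q \<cdot> f \<in> homs V T E2 \<and> ev2 \<cdot> (\<iota> ?L \<boxtimes> (q \<cdot> f)) = e \<cdot> k"
        by (simp add: q(2) f(2) in_homs)
    qed simp
    \<comment> \<open>Transposition along \<open>ev1\<close> turns the universal property of
      \<open>\<kappa>\<close> into the one of \<open>\<epsilon>\<close>.\<close>
    have "(\<kappa> \<cdot> h = f) = (\<epsilon> \<cdot> (\<iota> ?L \<boxtimes> h) = k)" if h: "h \<in> homs V T P" for h
    proof -
      note [simp] = h[unfolded in_homs]
      have "\<epsilon> \<cdot> (\<iota> ?L \<boxtimes> h) = ev1 \<cdot> (\<iota> ?L \<boxtimes> (\<kappa> \<cdot> h))" by (simp add: \<epsilon>_def)
      moreover have "ev1 \<cdot> (\<iota> ?L \<boxtimes> (\<kappa> \<cdot> h)) = k \<Longrightarrow> \<kappa> \<cdot> h = f"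
        by (rule ex1_eqI[OF un1[OF T k1]]) (simp_all add: in_homs f(2))
      ultimately show ?thesis using f(2) by auto
    qed
    then have "(\<lambda>h. h \<in> homs V T P \<and> \<pi> \<cdot> h = g \<and> \<kappa> \<cdot> h = f)
        = (\<lambda>h. h \<in> homs V T P \<and> \<pi> \<cdot> h = g \<and> \<epsilon> \<cdot> (\<iota> ?L \<boxtimes> h) = k)"
      by (intro ext conj_cong refl)
    then show ?thesis using un[OF g f(1) pf df] by (rule subst[where P = Ex1])
  qed
  then show ?thesis
    unfolding is_lift_object_def using \<pi> lin e\<epsilon> by blast
qed

text \<open>There is exactly one map out of an initial module, so lifting against trivial fibrations
  starting from it amounts to this condition, in which no initial module has to be
  mentioned.\<close>

definition cofibrant_module where
  "cofibrant_module R L \<longleftrightarrow> (\<forall>Z W r l. is_left_module V R Z \<longrightarrow> is_left_module V R W \<longrightarrow>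
     r \<in> left_module_homs V R Z W \<longrightarrow> r \<in> TF \<longrightarrow> l \<in> left_module_homs V R L W \<longrightarrow>
     (\<exists>l' \<in> left_module_homs V R L Z. r \<cdot> l' = l))"

text \<open>A linear map out of a tensor product \<open>L \<otimes> V\<close> is a module map from \<open>L\<close> to a module of maps,
  and for a cofibration \<open>i\<close> the pushout-product axiom makes \<open>[B, X] \<rightarrow> [A, X] \<times>\<^bsub>[A, Y]\<^esub> [B, Y]\<close> a
  trivial fibration.\<close>

lemma linear_lift:
  assumes R: "is_monoid V R" and L: "is_left_module V R L" "cofibrant_module R L"
    and X: "is_left_module V R X" and Y: "is_left_module V R Y"
    and e: "e \<in> left_module_homs V R X Y" "e \<in> TF"
    and i: "i \<in> Cof M" "i \<in> homs V A B"
    and a: "linear R L A X a" and b: "linear R L B Y b" and eq: "e \<cdot> a = b \<cdot> (\<iota> (Car L) \<boxtimes> i)"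
  obtains k where "linear R L B X k" "k \<cdot> (\<iota> (Car L) \<boxtimes> i) = a" "e \<cdot> k = b"
proof -
  let ?R = "MCar R" and ?L = "Car L"
  have AB [simp]: "A \<in> Obj V" "B \<in> Obj V" using homs_Obj[OF i(2)] by auto
  obtain W wX wY where W: "is_left_module V R W" "linear R W A X wX" "linear R W B Y wY"
    and ew: "e \<cdot> wX = wY \<cdot> (\<iota> (Car W) \<boxtimes> i)"
    and unW: "\<And>T a b. T \<in> Obj V \<Longrightarrow> a \<in> homs V (T \<otimes> A) (Car X) \<Longrightarrow> b \<in> homs V (T \<otimes> B) (Car Y) \<Longrightarrow>
      e \<cdot> a = b \<cdot> (\<iota> T \<boxtimes> i) \<Longrightarrow>
      \<exists>!h. h \<in> homs V T (Car W) \<and> wX \<cdot> (h \<boxtimes> \<iota> A) = a \<and> wY \<cdot> (h \<boxtimes> \<iota> B) = b"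
    using ex_hom_module[OF R X Y e(1) i(2)] by blast
  \<comment> \<open>The same construction for the identity of \<open>B\<close> yields the module
    [B,X]: the second universal map \<open>z'\<close> is then determined by
    \<open>z\<close>.\<close>
  obtain Z z z' where Z: "is_left_module V R Z" "linear R Z B X z" and z': "linear R Z B Y z'"
    and ez: "e \<cdot> z = z' \<cdot> (\<iota> (Car Z) \<boxtimes> \<iota> B)"
    and unZ: "\<And>T a b. T \<in> Obj V \<Longrightarrow> a \<in> homs V (T \<otimes> B) (Car X) \<Longrightarrow> b \<in> homs V (T \<otimes> B) (Car Y) \<Longrightarrow>
      e \<cdot> a = b \<cdot> (\<iota> T \<boxtimes> \<iota> B) \<Longrightarrow>
      \<exists>!h. h \<in> homs V T (Car Z) \<and> z \<cdot> (h \<boxtimes> \<iota> B) = a \<and> z' \<cdot> (h \<boxtimes> \<iota> B) = b"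
  proof (rule ex_hom_module[OF R X Y e(1) Ident_homs[OF AB(2)]])
    fix W wX wY
    assume "is_left_module V R W" "linear R W B X wX" "linear R W B Y wY"
      "e \<cdot> wX = wY \<cdot> (\<iota> (Car W) \<boxtimes> \<iota> B)"
      "\<And>T a b. T \<in> Obj V \<Longrightarrow> a \<in> homs V (T \<otimes> B) (Car X) \<Longrightarrow> b \<in> homs V (T \<otimes> B) (Car Y) \<Longrightarrow>
        e \<cdot> a = b \<cdot> (\<iota> T \<boxtimes> \<iota> B) \<Longrightarrow>
        \<exists>!h. h \<in> homs V T (Car W) \<and> wX \<cdot> (h \<boxtimes> \<iota> B) = a \<and> wY \<cdot> (h \<boxtimes> \<iota> B) = b"
    then show thesis by (rule that)
  qed
  note [simp] = is_monoidD[OF R] is_left_moduleD[OF L(1)] is_left_moduleD[OF X] is_left_moduleD[OF Y]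
    is_left_moduleD[OF W(1)] is_left_moduleD[OF Z(1)] left_module_homsD(1-3)[OF e(1)] i(2)[unfolded in_homs]
  have hs: "wX \<in> homs V (Car W \<otimes> A) (Car X)" "wY \<in> homs V (Car W \<otimes> B) (Car Y)"
    "z \<in> homs V (Car Z \<otimes> B) (Car X)" "z' \<in> homs V (Car Z \<otimes> B) (Car Y)"
    "a \<in> homs V (?L \<otimes> A) (Car X)" "b \<in> homs V (?L \<otimes> B) (Car Y)"
    using W(2,3) Z(2) z' a b unfolding linear_def by blast+
  note [simp] = hs[unfolded in_homs]
  have z'_eq: "z' = e \<cdot> z" using ez by simp
  have linD: "f \<cdot> (Act N \<boxtimes> \<iota> T) = Act N' \<cdot> (\<iota> ?R \<boxtimes> f) \<cdot> Assoc V ?R (Car N) T" if "linear R N T N' f" for N T N' f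
    using that by (simp add: linear_def)
  have W_eqI: "h = k" if h: "h \<in> homs V T (Car W)" and k: "k \<in> homs V T (Car W)"
    and eq: "wX \<cdot> (h \<boxtimes> \<iota> A) = wX \<cdot> (k \<boxtimes> \<iota> A)" "wY \<cdot> (h \<boxtimes> \<iota> B) = wY \<cdot> (k \<boxtimes> \<iota> B)" for T h k
  proof -
    have [simp]: "T \<in> Obj V" using homs_Obj[OF h] by auto
    note [simp] = h[unfolded in_homs] k[unfolded in_homs]
    have "e \<cdot> (wX \<cdot> (k \<boxtimes> \<iota> A)) = (e \<cdot> wX) \<cdot> (k \<boxtimes> \<iota> A)" by simp
    also have "\<dots> = (wY \<cdot> (k \<boxtimes> \<iota> B)) \<cdot> (\<iota> T \<boxtimes> i)" by (simp only: ew) simp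
    finally have "\<exists>!h. h \<in> homs V T (Car W) \<and> wX \<cdot> (h \<boxtimes> \<iota> A) = wX \<cdot> (k \<boxtimes> \<iota> A) \<and> wY \<cdot> (h \<boxtimes> \<iota> B) = wY \<cdot> (k \<boxtimes> \<iota> B)"
      by (intro unW) (simp_all add: in_homs)
    then show ?thesis
      by (rule ex1_eqI) (simp_all only: h k eq simp_thms)
  qed
  have Z_un: "\<exists>!h. h \<in> homs V T (Car Z) \<and> z \<cdot> (h \<boxtimes> \<iota> B) = f" if f: "f \<in> homs V (T \<otimes> B) (Car X)" and [simp]: "T \<in> Obj V" for T f
  proof -
    note [simp] = f[unfolded in_homs]
    have "(z \<cdot> (h \<boxtimes> \<iota> B) = f \<and> z' \<cdot> (h \<boxtimes> \<iota> B) = e \<cdot> f) = (z \<cdot> (h \<boxtimes> \<iota> B) = f)" if "h \<in> homs V T (Car Z)" for h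
      using that by (auto simp: z'_eq in_homs)
    then have "(\<lambda>h. h \<in> homs V T (Car Z) \<and> z \<cdot> (h \<boxtimes> \<iota> B) = f \<and> z' \<cdot> (h \<boxtimes> \<iota> B) = e \<cdot> f)
      = (\<lambda>h. h \<in> homs V T (Car Z) \<and> z \<cdot> (h \<boxtimes> \<iota> B) = f)"
      by (intro ext conj_cong refl)
    moreover have "\<exists>!h. h \<in> homs V T (Car Z) \<and> z \<cdot> (h \<boxtimes> \<iota> B) = f \<and> z' \<cdot> (h \<boxtimes> \<iota> B) = e \<cdot> f"
      by (rule unZ) (simp_all add: in_homs)
    ultimately show ?thesis by (rule subst[where P = Ex1])
  qed
  \<comment> \<open>The comparison map out of [B,X], restricting along \<open>i\<close> in one
    component and composing with \<open>e\<close> in the other.\<close>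
  have "\<exists>!r. r \<in> homs V (Car Z) (Car W) \<and> wX \<cdot> (r \<boxtimes> \<iota> A) = z \<cdot> (\<iota> (Car Z) \<boxtimes> i) \<and> wY \<cdot> (r \<boxtimes> \<iota> B) = e \<cdot> z"
    by (rule unW) (simp_all add: in_homs)
  then obtain r where r: "r \<in> homs V (Car Z) (Car W)" "wX \<cdot> (r \<boxtimes> \<iota> A) = z \<cdot> (\<iota> (Car Z) \<boxtimes> i)"
    "wY \<cdot> (r \<boxtimes> \<iota> B) = e \<cdot> z" by blast
  note [simp] = r(1)[unfolded in_homs]
  have r_lin: "r \<in> left_module_homs V R Z W"
  proof -
    have "wX \<cdot> ((r \<cdot> Act Z) \<boxtimes> \<iota> A) = (wX \<cdot> (r \<boxtimes> \<iota> A)) \<cdot> (Act Z \<boxtimes> \<iota> A)" by simp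
    also have "\<dots> = (z \<cdot> (Act Z \<boxtimes> \<iota> B)) \<cdot> (\<iota> (?R \<otimes> Car Z) \<boxtimes> i)" by (simp only: r) simp
    also have "\<dots> = Act X \<cdot> (\<iota> ?R \<boxtimes> z) \<cdot> (Assoc V ?R (Car Z) B \<cdot> ((\<iota> ?R \<boxtimes> \<iota> (Car Z)) \<boxtimes> i))"
      by (simp add: linD[OF Z(2)])
    also have "\<dots> = Act X \<cdot> (\<iota> ?R \<boxtimes> (z \<cdot> (\<iota> (Car Z) \<boxtimes> i))) \<cdot> Assoc V ?R (Car Z) A"
      by (subst Assoc_nat') auto
    also have "\<dots> = Act X \<cdot> (\<iota> ?R \<boxtimes> wX) \<cdot> (\<iota> ?R \<boxtimes> (r \<boxtimes> \<iota> A)) \<cdot> Assoc V ?R (Car Z) A"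
      by (simp add: r(2))
    also have "\<dots> = Act X \<cdot> (\<iota> ?R \<boxtimes> wX) \<cdot> (Assoc V ?R (Car W) A \<cdot> ((\<iota> ?R \<boxtimes> r) \<boxtimes> \<iota> A))"
      by (subst Assoc_nat') auto
    also have "\<dots> = (wX \<cdot> (Act W \<boxtimes> \<iota> A)) \<cdot> ((\<iota> ?R \<boxtimes> r) \<boxtimes> \<iota> A)" by (simp add: linD[OF W(2)])
    also have "\<dots> = wX \<cdot> ((Act W \<cdot> (\<iota> ?R \<boxtimes> r)) \<boxtimes> \<iota> A)" by simp
    finally have 1: "wX \<cdot> ((r \<cdot> Act Z) \<boxtimes> \<iota> A) = wX \<cdot> ((Act W \<cdot> (\<iota> ?R \<boxtimes> r)) \<boxtimes> \<iota> A)" .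
    have "wY \<cdot> ((r \<cdot> Act Z) \<boxtimes> \<iota> B) = (wY \<cdot> (r \<boxtimes> \<iota> B)) \<cdot> (Act Z \<boxtimes> \<iota> B)" by simp
    also have "\<dots> = z' \<cdot> (Act Z \<boxtimes> \<iota> B)" by (simp only: r z'_eq)
    also have "\<dots> = Act Y \<cdot> (\<iota> ?R \<boxtimes> z') \<cdot> Assoc V ?R (Car Z) B" by (rule linD[OF z'])
    also have "\<dots> = Act Y \<cdot> (\<iota> ?R \<boxtimes> wY) \<cdot> (\<iota> ?R \<boxtimes> (r \<boxtimes> \<iota> B)) \<cdot> Assoc V ?R (Car Z) B"
      by (simp add: r(3) z'_eq)
    also have "\<dots> = Act Y \<cdot> (\<iota> ?R \<boxtimes> wY) \<cdot> (Assoc V ?R (Car W) B \<cdot> ((\<iota> ?R \<boxtimes> r) \<boxtimes> \<iota> B))"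
      by (subst Assoc_nat') auto
    also have "\<dots> = (wY \<cdot> (Act W \<boxtimes> \<iota> B)) \<cdot> ((\<iota> ?R \<boxtimes> r) \<boxtimes> \<iota> B)" by (simp add: linD[OF W(3)])
    also have "\<dots> = wY \<cdot> ((Act W \<cdot> (\<iota> ?R \<boxtimes> r)) \<boxtimes> \<iota> B)" by simp
    finally have 2: "wY \<cdot> ((r \<cdot> Act Z) \<boxtimes> \<iota> B) = wY \<cdot> ((Act W \<cdot> (\<iota> ?R \<boxtimes> r)) \<boxtimes> \<iota> B)" .
    have "r \<cdot> Act Z = Act W \<cdot> (\<iota> ?R \<boxtimes> r)"
      by (rule W_eqI[OF _ _ 1 2]) (simp_all add: in_homs)
    then show ?thesis by (simp add: left_module_homs_def in_homs)
  qed
  \<comment> \<open>A lifting problem of \<open>j\<close> against \<open>r\<close> transposes to a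
    lifting problem of the pushout-product of \<open>j\<close> and \<open>i\<close> against
    \<open>e\<close>.\<close>
  have r_TF: "r \<in> TF"
  proof (rule TFI)
    fix j assume j: "j \<in> Cof M"
    let ?C = "Dom V j" and ?D = "Cod V j"
    note [simp] = Cof_arr[OF j]
    show "lifts_against V j r"
      unfolding lifts_against_def
    proof (intro ballI impI)
      fix u v assume u: "u \<in> homs V ?C (Dom V r)" and v: "v \<in> homs V ?D (Cod V r)" and uv: "r \<cdot> u = v \<cdot> j"
      have [simp]: "u \<in> Arr V" "Dom V u = ?C" "Cod V u = Car Z" "v \<in> Arr V" "Dom V v = ?D" "Cod V v = Car W"
        using u v by (simp_all add: in_homs)
      have "(wX \<cdot> (v \<boxtimes> \<iota> A)) \<cdot> (j \<boxtimes> \<iota> A) = (wX \<cdot> (r \<boxtimes> \<iota> A)) \<cdot> (u \<boxtimes> \<iota> A)" by (simp add: uv)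
      also have "\<dots> = (z \<cdot> (u \<boxtimes> \<iota> B)) \<cdot> (\<iota> ?C \<boxtimes> i)" by (simp only: r) simp
      finally have 1: "(wX \<cdot> (v \<boxtimes> \<iota> A)) \<cdot> (j \<boxtimes> \<iota> A) = (z \<cdot> (u \<boxtimes> \<iota> B)) \<cdot> (\<iota> ?C \<boxtimes> i)" .
      have "e \<cdot> (wX \<cdot> (v \<boxtimes> \<iota> A)) = (e \<cdot> wX) \<cdot> (v \<boxtimes> \<iota> A)" by simp
      also have "\<dots> = (wY \<cdot> (v \<boxtimes> \<iota> B)) \<cdot> (\<iota> ?D \<boxtimes> i)" by (simp only: ew) simp
      finally have 2: "e \<cdot> (wX \<cdot> (v \<boxtimes> \<iota> A)) = (wY \<cdot> (v \<boxtimes> \<iota> B)) \<cdot> (\<iota> ?D \<boxtimes> i)" .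
      have "e \<cdot> (z \<cdot> (u \<boxtimes> \<iota> B)) = (e \<cdot> z) \<cdot> (u \<boxtimes> \<iota> B)" by simp
      also have "\<dots> = wY \<cdot> ((r \<cdot> u) \<boxtimes> \<iota> B)" by (simp only: r(3)[symmetric]) simp
      also have "\<dots> = (wY \<cdot> (v \<boxtimes> \<iota> B)) \<cdot> (j \<boxtimes> \<iota> B)" by (simp add: uv)
      finally have 3: "e \<cdot> (z \<cdot> (u \<boxtimes> \<iota> B)) = (wY \<cdot> (v \<boxtimes> \<iota> B)) \<cdot> (j \<boxtimes> \<iota> B)" .
      obtain k where k: "k \<in> homs V (?D \<otimes> B) (Car X)" "k \<cdot> (\<iota> ?D \<boxtimes> i) = wX \<cdot> (v \<boxtimes> \<iota> A)"
        "k \<cdot> (j \<boxtimes> \<iota> B) = z \<cdot> (u \<boxtimes> \<iota> B)" "e \<cdot> k = wY \<cdot> (v \<boxtimes> \<iota> B)"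
        by (rule pushout_product_lift[OF i j _ e(2) _ _ _ _ 1 2 3, of "Car X" "Car Y"])
          (simp_all add: in_homs)
      note [simp] = k(1)[unfolded in_homs]
      obtain h where h: "h \<in> homs V ?D (Car Z)" "z \<cdot> (h \<boxtimes> \<iota> B) = k" using Z_un[OF k(1)] by auto
      note [simp] = h(1)[unfolded in_homs]
      have "h \<cdot> j = u"
      proof (rule ex1_eqI[OF Z_un])
        have "z \<cdot> ((h \<cdot> j) \<boxtimes> \<iota> B) = (z \<cdot> (h \<boxtimes> \<iota> B)) \<cdot> (j \<boxtimes> \<iota> B)" by simp
        then show "h \<cdot> j \<in> homs V ?C (Car Z) \<and> z \<cdot> ((h \<cdot> j) \<boxtimes> \<iota> B) = z \<cdot> (u \<boxtimes> \<iota> B)"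
          by (simp add: in_homs h(2) k(3))
      qed (simp_all add: in_homs)
      moreover have "r \<cdot> h = v"
      proof (rule W_eqI)
        have "wX \<cdot> ((r \<cdot> h) \<boxtimes> \<iota> A) = (wX \<cdot> (r \<boxtimes> \<iota> A)) \<cdot> (h \<boxtimes> \<iota> A)" by simp
        also have "\<dots> = (z \<cdot> (h \<boxtimes> \<iota> B)) \<cdot> (\<iota> ?D \<boxtimes> i)" by (simp only: r) simp
        finally show "wX \<cdot> ((r \<cdot> h) \<boxtimes> \<iota> A) = wX \<cdot> (v \<boxtimes> \<iota> A)" by (simp only: h(2) k(2))
        have "wY \<cdot> ((r \<cdot> h) \<boxtimes> \<iota> B) = (wY \<cdot> (r \<boxtimes> \<iota> B)) \<cdot> (h \<boxtimes> \<iota> B)" by simp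
        also have "\<dots> = e \<cdot> (z \<cdot> (h \<boxtimes> \<iota> B))" by (simp only: r) simp
        finally show "wY \<cdot> ((r \<cdot> h) \<boxtimes> \<iota> B) = wY \<cdot> (v \<boxtimes> \<iota> B)" by (simp only: h(2) k(4))
      qed (simp_all add: in_homs)
      ultimately show "\<exists>h \<in> homs V ?D (Dom V r). h \<cdot> j = u \<and> r \<cdot> h = v"
        using h(1) by (intro bexI[of _ h]) (simp_all add: in_homs)
    qed
  qed simp
  \<comment> \<open>The pair of \<open>a\<close> and \<open>b\<close> is a module map from
    \<open>L\<close> to \<open>W\<close>. Cofibrancy of \<open>L\<close> lifts it along
    \<open>r\<close> to [B,X], and the lift transposes back to the desired linear map.\<close>
  have "\<exists>!l. l \<in> homs V ?L (Car W) \<and> wX \<cdot> (l \<boxtimes> \<iota> A) = a \<and> wY \<cdot> (l \<boxtimes> \<iota> B) = b"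
    by (rule unW) (simp_all add: in_homs eq)
  then obtain l where l: "l \<in> homs V ?L (Car W)" "wX \<cdot> (l \<boxtimes> \<iota> A) = a" "wY \<cdot> (l \<boxtimes> \<iota> B) = b" by blast
  note [simp] = l(1)[unfolded in_homs]
  have l_lin: "l \<in> left_module_homs V R L W"
  proof -
    have *: "w \<cdot> ((l \<cdot> Act L) \<boxtimes> \<iota> T) = w \<cdot> ((Act W \<cdot> (\<iota> ?R \<boxtimes> l)) \<boxtimes> \<iota> T)"
      if w: "linear R W T N w" and f: "linear R L T N f" and wl: "w \<cdot> (l \<boxtimes> \<iota> T) = f"
        and N: "is_left_module V R N" and T: "T \<in> Obj V" for w T N f
    proof -
      note [simp] = is_left_moduleD[OF N] T
      have "w \<in> homs V (Car W \<otimes> T) (Car N)" using w by (simp add: linear_def)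
      note [simp] = this[unfolded in_homs]
      have "w \<cdot> ((l \<cdot> Act L) \<boxtimes> \<iota> T) = (w \<cdot> (l \<boxtimes> \<iota> T)) \<cdot> (Act L \<boxtimes> \<iota> T)" by simp
      also have "\<dots> = Act N \<cdot> (\<iota> ?R \<boxtimes> (w \<cdot> (l \<boxtimes> \<iota> T))) \<cdot> Assoc V ?R ?L T" by (simp only: wl linD[OF f])
      also have "\<dots> = Act N \<cdot> (\<iota> ?R \<boxtimes> w) \<cdot> (Assoc V ?R (Car W) T \<cdot> ((\<iota> ?R \<boxtimes> l) \<boxtimes> \<iota> T))"
        by (subst Assoc_nat') auto
      also have "\<dots> = (w \<cdot> (Act W \<boxtimes> \<iota> T)) \<cdot> ((\<iota> ?R \<boxtimes> l) \<boxtimes> \<iota> T)" by (simp add: linD[OF w])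
      finally show ?thesis by simp
    qed
    have "l \<cdot> Act L = Act W \<cdot> (\<iota> ?R \<boxtimes> l)"
      by (rule W_eqI[OF _ _ *[OF W(2) a l(2) X] *[OF W(3) b l(3) Y]]) (simp_all add: in_homs)
    then show ?thesis by (simp add: left_module_homs_def in_homs)
  qed
  obtain l' where l': "l' \<in> left_module_homs V R L Z" "r \<cdot> l' = l"
    using L(2) Z(1) W(1) r_lin r_TF l_lin unfolding cofibrant_module_def by blast
  note [simp] = left_module_homsD(1-3)[OF l'(1)]
  define k where "k = z \<cdot> (l' \<boxtimes> \<iota> B)"
  show thesis
  proof
    have "k \<cdot> (Act L \<boxtimes> \<iota> B) = (z \<cdot> (Act Z \<boxtimes> \<iota> B)) \<cdot> ((\<iota> ?R \<boxtimes> l') \<boxtimes> \<iota> B)"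
      by (simp add: k_def left_module_homsD(4)[OF l'(1)])
    also have "\<dots> = Act X \<cdot> (\<iota> ?R \<boxtimes> z) \<cdot> (Assoc V ?R (Car Z) B \<cdot> ((\<iota> ?R \<boxtimes> l') \<boxtimes> \<iota> B))"
      by (simp add: linD[OF Z(2)])
    also have "\<dots> = Act X \<cdot> (\<iota> ?R \<boxtimes> k) \<cdot> Assoc V ?R ?L B"
      by (subst Assoc_nat') (auto simp: k_def)
    finally show "linear R L B X k" by (simp add: linear_def in_homs k_def)
    have "k \<cdot> (\<iota> ?L \<boxtimes> i) = (z \<cdot> (\<iota> (Car Z) \<boxtimes> i)) \<cdot> (l' \<boxtimes> \<iota> A)" by (simp add: k_def)
    also have "\<dots> = wX \<cdot> ((r \<cdot> l') \<boxtimes> \<iota> A)" by (simp only: r(2)[symmetric]) simp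
    finally show "k \<cdot> (\<iota> ?L \<boxtimes> i) = a" by (simp only: l' l)
    have "e \<cdot> k = (e \<cdot> z) \<cdot> (l' \<boxtimes> \<iota> B)" by (simp add: k_def)
    also have "\<dots> = wY \<cdot> ((r \<cdot> l') \<boxtimes> \<iota> B)" by (simp only: r(3)[symmetric]) simp
    finally show "e \<cdot> k = b" by (simp only: l' l)
  qed
qed

lemma linear_comp:
  assumes R: "is_monoid V R" and L: "is_left_module V R L" and N: "is_left_module V R N"
    and f: "linear R L S N f" and g: "g \<in> homs V T S"
  shows "linear R L T N (f \<cdot> (\<iota> (Car L) \<boxtimes> g))"
proof -
  let ?L = "Car L" and ?R = "MCar R"
  have [simp]: "T \<in> Obj V" "S \<in> Obj V" using homs_Obj[OF g] by auto
  have f1: "f \<in> homs V (?L \<otimes> S) (Car N)" "f \<cdot> (Act L \<boxtimes> \<iota> S) = Act N \<cdot> (\<iota> ?R \<boxtimes> f) \<cdot> Assoc V ?R ?L S"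
    using f by (simp_all add: linear_def)
  note [simp] = is_monoidD[OF R] is_left_moduleD[OF L] is_left_moduleD[OF N] g[unfolded in_homs]
    f1(1)[unfolded in_homs]
  have "(f \<cdot> (\<iota> ?L \<boxtimes> g)) \<cdot> (Act L \<boxtimes> \<iota> T) = (f \<cdot> (Act L \<boxtimes> \<iota> S)) \<cdot> (\<iota> (?R \<otimes> ?L) \<boxtimes> g)" by simp
  also have "\<dots> = Act N \<cdot> (\<iota> ?R \<boxtimes> f) \<cdot> (Assoc V ?R ?L S \<cdot> ((\<iota> ?R \<boxtimes> \<iota> ?L) \<boxtimes> g))"
    by (simp add: f1(2))
  also have "\<dots> = Act N \<cdot> (\<iota> ?R \<boxtimes> (f \<cdot> (\<iota> ?L \<boxtimes> g))) \<cdot> Assoc V ?R ?L T"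
    by (subst Assoc_nat') auto
  finally show ?thesis by (simp add: linear_def in_homs)
qed

text \<open>The projection is a pullback of the map from Hom_R(L,X) to Hom_R(L,Y), and a lift of a
  cofibration against it is a linear map out of \<open>L \<otimes> B\<close> of the kind that
  \<open>linear_lift\<close> provides.\<close>

lemma lift_object_TF:
  assumes R: "is_monoid V R" and L: "is_left_module V R L" "cofibrant_module R L"
    and X: "is_left_module V R X" and Y: "is_left_module V R Y"
    and e: "e \<in> left_module_homs V R X Y" "e \<in> TF"
    and c: "linear R L G Y c" and P: "is_lift_object R L X e G c P \<pi> \<epsilon>"
  shows "\<pi> \<in> TF"
proof (rule TFI)
  let ?L = "Car L" and ?R = "MCar R"
  have \<pi>: "\<pi> \<in> homs V P G" and \<epsilon>: "linear R L P X \<epsilon>" and e\<epsilon>: "e \<cdot> \<epsilon> = c \<cdot> (\<iota> ?L \<boxtimes> \<pi>)"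
    and un: "\<And>T g k. g \<in> homs V T G \<Longrightarrow> linear R L T X k \<Longrightarrow> e \<cdot> k = c \<cdot> (\<iota> ?L \<boxtimes> g) \<Longrightarrow>
        \<exists>!h. h \<in> homs V T P \<and> \<pi> \<cdot> h = g \<and> \<epsilon> \<cdot> (\<iota> ?L \<boxtimes> h) = k"
    using P unfolding is_lift_object_def by blast+
  note [simp] = is_monoidD[OF R] is_left_moduleD[OF X] is_left_moduleD[OF L(1)] is_left_moduleD[OF Y]
    left_module_homsD(1-3)[OF e(1)] \<pi>[unfolded in_homs]
  have [simp]: "P \<in> Obj V" "G \<in> Obj V" using homs_Obj[OF \<pi>] by auto
  have hs: "\<epsilon> \<in> homs V (?L \<otimes> P) (Car X)" "c \<in> homs V (?L \<otimes> G) (Car Y)"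
    using \<epsilon> c by (simp_all add: linear_def)
  note [simp] = hs[unfolded in_homs]
  show "\<pi> \<in> Arr V" by simp
  fix i assume i: "i \<in> Cof M"
  let ?A = "Dom V i" and ?B = "Cod V i"
  note [simp] = Cof_arr[OF i]
  show "lifts_against V i \<pi>"
    unfolding lifts_against_def
  proof (intro ballI impI)
    fix u v assume "u \<in> homs V ?A (Dom V \<pi>)" "v \<in> homs V ?B (Cod V \<pi>)" and uv: "\<pi> \<cdot> u = v \<cdot> i"
    then have u: "u \<in> homs V ?A P" and v: "v \<in> homs V ?B G" by simp_all
    note [simp] = u[unfolded in_homs, simplified] v[unfolded in_homs, simplified]
    have "e \<cdot> (\<epsilon> \<cdot> (\<iota> ?L \<boxtimes> u)) = (e \<cdot> \<epsilon>) \<cdot> (\<iota> ?L \<boxtimes> u)" by simp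
    also have "\<dots> = (c \<cdot> (\<iota> ?L \<boxtimes> v)) \<cdot> (\<iota> ?L \<boxtimes> i)" by (simp only: e\<epsilon>) (simp add: uv)
    finally have eq: "e \<cdot> (\<epsilon> \<cdot> (\<iota> ?L \<boxtimes> u)) = (c \<cdot> (\<iota> ?L \<boxtimes> v)) \<cdot> (\<iota> ?L \<boxtimes> i)" .
    have "i \<in> homs V ?A ?B" by (simp add: in_homs)
    then obtain k where k: "linear R L ?B X k" "k \<cdot> (\<iota> ?L \<boxtimes> i) = \<epsilon> \<cdot> (\<iota> ?L \<boxtimes> u)" "e \<cdot> k = c \<cdot> (\<iota> ?L \<boxtimes> v)"
      by (rule linear_lift[OF R L X Y e i _ linear_comp[OF R L(1) X \<epsilon> u] linear_comp[OF R L(1) Y c v] eq])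
    obtain h where h: "h \<in> homs V ?B P" "\<pi> \<cdot> h = v" "\<epsilon> \<cdot> (\<iota> ?L \<boxtimes> h) = k"
      using un[OF v k(1,3)] by blast
    note [simp] = h(1)[unfolded in_homs, simplified]
    \<comment> \<open>Both sides have the same components under \<open>\<pi>\<close> and
      \<open>\<epsilon>\<close>, so the uniqueness in the universal property applies.\<close>
    have "h \<cdot> i = u"
    proof (rule ex1_eqI[OF un])
      have "\<epsilon> \<cdot> (\<iota> ?L \<boxtimes> (h \<cdot> i)) = (\<epsilon> \<cdot> (\<iota> ?L \<boxtimes> h)) \<cdot> (\<iota> ?L \<boxtimes> i)" by simp
      moreover have "\<pi> \<cdot> h \<cdot> i = (\<pi> \<cdot> h) \<cdot> i" by simp
      ultimately show "h \<cdot> i \<in> homs V ?A P \<and> \<pi> \<cdot> h \<cdot> i = v \<cdot> i \<and> \<epsilon> \<cdot> (\<iota> ?L \<boxtimes> (h \<cdot> i)) = \<epsilon> \<cdot> (\<iota> ?L \<boxtimes> u)"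
        by (simp only: h k) (simp add: in_homs)
      show "u \<in> homs V ?A P \<and> \<pi> \<cdot> u = v \<cdot> i \<and> \<epsilon> \<cdot> (\<iota> ?L \<boxtimes> u) = \<epsilon> \<cdot> (\<iota> ?L \<boxtimes> u)"
        using uv by (simp add: in_homs)
    qed (use linear_comp[OF R L(1) X \<epsilon> u] eq in \<open>simp_all add: in_homs\<close>)
    then show "\<exists>h \<in> homs V ?B (Dom V \<pi>). h \<cdot> i = u \<and> \<pi> \<cdot> h = v"
      using h by (intro bexI[of _ h]) (simp_all add: in_homs)
  qed
qed

end

section \<open>Families of modules\<close>

definition regular :: "('o, 'm) mon \<Rightarrow> ('o, 'm) module" where
  "regular R = \<lparr>Car = MCar R, Act = MMul R\<rparr>"

text \<open>The part of an enriched category that consists of the hom-objects into \<open>b\<close>.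
  Requiring the module at \<open>b\<close> to be \<open>R\<close> makes the monoid one of the
  components, so that families are indexed by objects, like the colours of the operad introduced
  below.\<close>

definition is_family :: "('o, 'm) smcat \<Rightarrow> 's \<Rightarrow> ('o, 'm) mon \<Rightarrow> ('s \<Rightarrow> ('o, 'm) module) \<Rightarrow> bool" where
  "is_family V b R N \<longleftrightarrow> is_monoid V R \<and> (\<forall>x. is_left_module V R (N x)) \<and> N b = regular R"

text \<open>For families, the action equation at \<open>x = b\<close> says that \<open>f b\<close>
  is multiplicative. Thus \<open>f b\<close> is a map of monoids and each \<open>f x\<close> is
  linear over it.\<close>

definition family_homs ::
  "('o, 'm) smcat \<Rightarrow> 's \<Rightarrow> ('o, 'm) mon \<Rightarrow> ('s \<Rightarrow> ('o, 'm) module) \<Rightarrow> ('o, 'm) mon \<Rightarrow>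
   ('s \<Rightarrow> ('o, 'm) module) \<Rightarrow> ('s \<Rightarrow> 'm) set" where
  "family_homs V b R N R' N' =
     {f. (\<forall>x. f x \<in> homs V (Car (N x)) (Car (N' x)) \<and>
              f x \<cdot>\<^bsub>V\<^esub> Act (N x) = Act (N' x) \<cdot>\<^bsub>V\<^esub> (f b \<boxtimes>\<^bsub>V\<^esub> f x)) \<and>
         f b \<cdot>\<^bsub>V\<^esub> MOne R = MOne R'}"

context closed_symmetric_monoidal_category
begin

lemma is_vcatD:
  assumes "is_vcat V H"
  shows "Hom H x y \<in> Obj V"
    "VComp H x y z \<in> Arr V" "Dom V (VComp H x y z) = Hom H y z \<otimes> Hom H x y" "Cod V (VComp H x y z) = Hom H x z"
    "VUnit H x \<in> Arr V" "Dom V (VUnit H x) = Unit V" "Cod V (VUnit H x) = Hom H x x"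
  using assms by (simp_all add: is_vcat_def in_homs)

lemma vcat_assoc:
  "is_vcat V H \<Longrightarrow> VComp H w x z \<cdot> (VComp H x y z \<boxtimes> \<iota> (Hom H w x))
     = VComp H w y z \<cdot> (\<iota> (Hom H y z) \<boxtimes> VComp H w x y) \<cdot> Assoc V (Hom H y z) (Hom H x y) (Hom H w x)"
  by (simp add: is_vcat_def)

lemma vcat_unit:
  "is_vcat V H \<Longrightarrow> VComp H x y y \<cdot> (VUnit H y \<boxtimes> \<iota> (Hom H x y)) = LUnit V (Hom H x y)"
  "is_vcat V H \<Longrightarrow> VComp H x x y \<cdot> (\<iota> (Hom H x y) \<boxtimes> VUnit H x) = RUnit V (Hom H x y)"
  by (simp_all add: is_vcat_def)

lemma vfunctorsD:
  assumes "F \<in> vfunctors V H K"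
  shows "F x y \<in> Arr V" "Dom V (F x y) = Hom H x y" "Cod V (F x y) = Hom K x y"
    "F x z \<cdot> VComp H x y z = VComp K x y z \<cdot> (F y z \<boxtimes> F x y)" "F x x \<cdot> VUnit H x = VUnit K x"
  using assms by (simp_all add: vfunctors_def in_homs)

lemma family_homsD:
  assumes "f \<in> family_homs V b R N R' N'"
  shows "f x \<in> Arr V" "Dom V (f x) = Car (N x)" "Cod V (f x) = Car (N' x)"
    "f x \<cdot> Act (N x) = Act (N' x) \<cdot> (f b \<boxtimes> f x)" "f b \<cdot> MOne R = MOne R'"
  using assms by (simp_all add: family_homs_def in_homs)

lemma hom_family:
  assumes H: "is_vcat V H"
  shows "is_family V b (endo_monoid H b) (\<lambda>x. hom_left_module H x b)"
  using is_vcatD[OF H] vcat_assoc[OF H] vcat_unit[OF H]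
  by (simp add: is_family_def is_monoid_def is_left_module_def endo_monoid_def hom_left_module_def
      regular_def in_homs)

lemma restrict_left_module:
  assumes R: "is_monoid V R" and R': "is_monoid V R'" and N: "is_left_module V R' N"
    and f: "f \<in> homs V (MCar R) (MCar R')" "f \<cdot> MMul R = MMul R' \<cdot> (f \<boxtimes> f)" "f \<cdot> MOne R = MOne R'"
  shows "is_left_module V R \<lparr>Car = Car N, Act = Act N \<cdot> (f \<boxtimes> \<iota> (Car N))\<rparr>"
proof -
  let ?N = "Car N" and ?R = "MCar R" and ?S = "MCar R'"
  note [simp] = is_monoidD[OF R] is_monoidD[OF R'] is_left_moduleD[OF N] f(1)[unfolded in_homs]
  have "(Act N \<cdot> (f \<boxtimes> \<iota> ?N)) \<cdot> (MMul R \<boxtimes> \<iota> ?N) = (Act N \<cdot> (MMul R' \<boxtimes> \<iota> ?N)) \<cdot> ((f \<boxtimes> f) \<boxtimes> \<iota> ?N)"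
    by (simp add: f(2))
  also have "\<dots> = Act N \<cdot> (\<iota> ?S \<boxtimes> Act N) \<cdot> (Assoc V ?S ?S ?N \<cdot> ((f \<boxtimes> f) \<boxtimes> \<iota> ?N))"
    by (simp add: left_module_assoc[OF N])
  also have "\<dots> = Act N \<cdot> (f \<boxtimes> (Act N \<cdot> (f \<boxtimes> \<iota> ?N))) \<cdot> Assoc V ?R ?R ?N"
    by (subst Assoc_nat') auto
  finally have "(Act N \<cdot> (f \<boxtimes> \<iota> ?N)) \<cdot> (MMul R \<boxtimes> \<iota> ?N) = Act N \<cdot> (f \<boxtimes> (Act N \<cdot> (f \<boxtimes> \<iota> ?N))) \<cdot> Assoc V ?R ?R ?N" .
  moreover have "(Act N \<cdot> (f \<boxtimes> \<iota> ?N)) \<cdot> (MOne R \<boxtimes> \<iota> ?N) = LUnit V ?N"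
    using left_module_unit[OF N] by (simp add: f(3))
  ultimately show ?thesis
    by (simp add: is_left_module_def in_homs)
qed

end

section \<open>The enriched category of linear maps over a given one\<close>

text \<open>\<open>P x y\<close> is \<open>Hom\<^sub>R(L y, L x) \<times> H(x, y)\<close>, the product being taken over \<open>Hom\<^sub>R(L y, H(x, b))\<close>.\<close>

locale module_cover = monoidal_model V U M
  for V :: "('o, 'm) smcat" (structure) and U :: "'u itself" and M :: "'m model_str" +
  fixes H :: "('s, 'o, 'm) vcat" and b :: 's and R :: "('o, 'm) mon" and L :: "'s \<Rightarrow> ('o, 'm) module"
    and e :: "'s \<Rightarrow> 'm" and P :: "'s \<Rightarrow> 's \<Rightarrow> 'o" and \<pi> \<epsilon> :: "'s \<Rightarrow> 's \<Rightarrow> 'm"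
  assumes H: "is_vcat V H" and L: "is_family V b R L" and L_cof: "\<And>x. cofibrant_module R (L x)"
    and e: "e \<in> family_homs V b R L (endo_monoid H b) (\<lambda>x. hom_left_module H x b)"
    and e_TF: "\<And>x. e x \<in> TF"
    and P: "\<And>x y. is_lift_object R (L y) (L x) (e x) (Hom H x y)
      (VComp H x y b \<cdot> (e y \<boxtimes> \<iota> (Hom H x y))) (P x y) (\<pi> x y) (\<epsilon> x y)"
begin

lemma R: "is_monoid V R" and Lx: "is_left_module V R (L x)" and Lb: "L b = regular R"
  using L by (simp_all add: is_family_def)

lemma e_simps [simp]: "e x \<in> Arr V" "Dom V (e x) = Car (L x)" "Cod V (e x) = Hom H x b"
  using family_homsD[OF e] by (simp_all add: hom_left_module_def)

lemma e_act: "e x \<cdot> Act (L x) = VComp H x b b \<cdot> (e b \<boxtimes> e x)" and e_one: "e b \<cdot> MOne R = VUnit H b"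
  using family_homsD[OF e] by (simp_all add: hom_left_module_def endo_monoid_def)

lemmas [simp] = is_monoidD[OF R] is_left_moduleD[OF Lx] is_vcatD[OF H]

lemma Lb_simps [simp]: "Car (L b) = MCar R" "Act (L b) = MMul R"
  by (simp_all add: Lb regular_def)

text \<open>Restriction of scalars along \<open>e b\<close> puts \<open>H(x,b)\<close> over the
  monoid of \<open>L\<close>, so that \<open>e x\<close> becomes a map of modules over one
  monoid.\<close>

definition Y where "Y x = \<lparr>Car = Hom H x b, Act = VComp H x b b \<cdot> (e b \<boxtimes> \<iota> (Hom H x b))\<rparr>"

lemma Y: "is_left_module V R (Y x)"
proof -
  have "is_monoid V (endo_monoid H b)" "is_left_module V (endo_monoid H b) (hom_left_module H x b)"
    using hom_family[OF H, of b] by (simp_all add: is_family_def)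
  from restrict_left_module[OF R this, of "e b"] show ?thesis
    using e_act[of b] e_one by (simp add: Y_def in_homs endo_monoid_def hom_left_module_def)
qed

lemma e_lin: "e x \<in> left_module_homs V R (L x) (Y x)"
  using e_act by (simp add: left_module_homs_def Y_def in_homs)

text \<open>The transpose of the map from \<open>H(x,y)\<close> to Hom_R(L(y), H(x,b)) over which
  \<open>P x y\<close> is formed: an element of \<open>L(y)\<close> is sent to \<open>H(y,b)\<close>
  and then precomposed with \<open>H(x,y)\<close>.\<close>

abbreviation c where "c x y \<equiv> VComp H x y b \<cdot> (e y \<boxtimes> \<iota> (Hom H x y))"

lemma c_lin: "linear R (L y) (Hom H x y) (Y x) (c x y)"
proof -
  let ?L = "Car (L y)" and ?H = "Hom H x y" and ?R = "MCar R"
  have "c x y \<cdot> (Act (L y) \<boxtimes> \<iota> ?H) = (VComp H x y b \<cdot> (VComp H y b b \<boxtimes> \<iota> ?H)) \<cdot> ((e b \<boxtimes> e y) \<boxtimes> \<iota> ?H)"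
    by (simp add: e_act)
  also have "\<dots> = VComp H x b b \<cdot> (\<iota> (Hom H b b) \<boxtimes> VComp H x y b) \<cdot>
      (Assoc V (Hom H b b) (Hom H y b) ?H \<cdot> ((e b \<boxtimes> e y) \<boxtimes> \<iota> ?H))"
    by (simp add: vcat_assoc[OF H])
  also have "\<dots> = VComp H x b b \<cdot> (e b \<boxtimes> c x y) \<cdot> Assoc V ?R ?L ?H"
    by (subst Assoc_nat') auto
  finally show ?thesis by (simp add: linear_def in_homs Y_def)
qed

lemma \<pi>_homs: "\<pi> x y \<in> homs V (P x y) (Hom H x y)"
  and \<epsilon>_lin: "linear R (L y) (P x y) (L x) (\<epsilon> x y)"
  and e_\<epsilon>: "e x \<cdot> \<epsilon> x y = c x y \<cdot> (\<iota> (Car (L y)) \<boxtimes> \<pi> x y)"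
  using P[of y x] unfolding is_lift_object_def by blast+

lemma P_univ:
  "g \<in> homs V T (Hom H x y) \<Longrightarrow> linear R (L y) T (L x) k \<Longrightarrow> e x \<cdot> k = c x y \<cdot> (\<iota> (Car (L y)) \<boxtimes> g) \<Longrightarrow>
    \<exists>!h. h \<in> homs V T (P x y) \<and> \<pi> x y \<cdot> h = g \<and> \<epsilon> x y \<cdot> (\<iota> (Car (L y)) \<boxtimes> h) = k"
  using P[of y x] unfolding is_lift_object_def by blast

lemma P_simps [simp]: "P x y \<in> Obj V" "\<pi> x y \<in> Arr V" "Dom V (\<pi> x y) = P x y" "Cod V (\<pi> x y) = Hom H x y"
    "\<epsilon> x y \<in> Arr V" "Dom V (\<epsilon> x y) = Car (L y) \<otimes> P x y" "Cod V (\<epsilon> x y) = Car (L x)"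
  using homs_Obj[OF \<pi>_homs[of x y]] \<pi>_homs[of x y] \<epsilon>_lin[of y x] by (simp_all add: linear_def in_homs)

lemma \<epsilon>_act: "\<epsilon> x y \<cdot> (Act (L y) \<boxtimes> \<iota> (P x y))
    = Act (L x) \<cdot> (\<iota> (MCar R) \<boxtimes> \<epsilon> x y) \<cdot> Assoc V (MCar R) (Car (L y)) (P x y)"
  using \<epsilon>_lin[of y x] by (simp add: linear_def)

lemma \<pi>_TF: "\<pi> x y \<in> TF"
  by (rule lift_object_TF[OF R Lx L_cof Lx Y e_lin e_TF c_lin P])

text \<open>The axioms of \<open>K\<close> are verified on two components: under
  \<open>\<pi>\<close> they are the axioms of \<open>H\<close>, and under \<open>\<epsilon>\<close>
  they say that successive actions on \<open>L\<close> agree up to coherence.\<close>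

lemma P_eqI:
  assumes h: "h \<in> homs V T (P x y)" and k: "k \<in> homs V T (P x y)"
    and eq: "\<pi> x y \<cdot> h = \<pi> x y \<cdot> k" "\<epsilon> x y \<cdot> (\<iota> (Car (L y)) \<boxtimes> h) = \<epsilon> x y \<cdot> (\<iota> (Car (L y)) \<boxtimes> k)"
  shows "h = k"
proof -
  let ?L = "Car (L y)"
  have [simp]: "T \<in> Obj V" using homs_Obj[OF h] by simp
  note [simp] = h[unfolded in_homs] k[unfolded in_homs]
  have lin: "linear R (L y) T (L x) (\<epsilon> x y \<cdot> (\<iota> ?L \<boxtimes> k))"
    by (rule linear_comp[OF R Lx Lx \<epsilon>_lin k])
  have "e x \<cdot> (\<epsilon> x y \<cdot> (\<iota> ?L \<boxtimes> k)) = (e x \<cdot> \<epsilon> x y) \<cdot> (\<iota> ?L \<boxtimes> k)" by simp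
  also have "\<dots> = c x y \<cdot> (\<iota> ?L \<boxtimes> (\<pi> x y \<cdot> k))" by (simp only: e_\<epsilon>) simp
  finally have "\<exists>!h. h \<in> homs V T (P x y) \<and> \<pi> x y \<cdot> h = \<pi> x y \<cdot> k \<and>
      \<epsilon> x y \<cdot> (\<iota> ?L \<boxtimes> h) = \<epsilon> x y \<cdot> (\<iota> ?L \<boxtimes> k)"
    by (intro P_univ lin) (simp_all add: in_homs)
  then show ?thesis by (rule ex1_eqI) (simp_all only: h k eq simp_thms)
qed

text \<open>Composition is forced by its components: over \<open>H\<close> it is the composition of
  \<open>H\<close>, and on \<open>L\<close> a composite acts by \<open>\<epsilon> y z\<close>
  followed by \<open>\<epsilon> x y\<close>. The inverse associator puts the factor that acts first
  next to \<open>L(z)\<close>.\<close>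

definition \<kappa> where
  "\<kappa> x y z = (THE h. h \<in> homs V (P y z \<otimes> P x y) (P x z) \<and>
     \<pi> x z \<cdot> h = VComp H x y z \<cdot> (\<pi> y z \<boxtimes> \<pi> x y) \<and>
     \<epsilon> x z \<cdot> (\<iota> (Car (L z)) \<boxtimes> h)
       = \<epsilon> x y \<cdot> (\<epsilon> y z \<boxtimes> \<iota> (P x y)) \<cdot> inverse_arr (Assoc V (Car (L z)) (P y z) (P x y)))"

text \<open>The universal property applies after two checks: the composite action is
  \<open>R\<close>-linear, by the pentagon, and it lies over the action on the hom-objects into
  \<open>b\<close>, by the associativity of \<open>H\<close>.\<close>

lemma \<kappa>:
  shows \<kappa>_homs: "\<kappa> x y z \<in> homs V (P y z \<otimes> P x y) (P x z)"
    and \<pi>_\<kappa>: "\<pi> x z \<cdot> \<kappa> x y z = VComp H x y z \<cdot> (\<pi> y z \<boxtimes> \<pi> x y)"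
    and \<epsilon>_\<kappa>: "\<epsilon> x z \<cdot> (\<iota> (Car (L z)) \<boxtimes> \<kappa> x y z) \<cdot> Assoc V (Car (L z)) (P y z) (P x y)
       = \<epsilon> x y \<cdot> (\<epsilon> y z \<boxtimes> \<iota> (P x y))"
proof -
  let ?L = "Car (L z)" and ?K = "P y z" and ?K' = "P x y" and ?R = "MCar R"
  let ?i = "inverse_arr (Assoc V ?L ?K ?K')"
  define k where "k = \<epsilon> x y \<cdot> (\<epsilon> y z \<boxtimes> \<iota> ?K') \<cdot> ?i"
  have [simp]: "k \<in> Arr V" "Dom V k = ?L \<otimes> (?K \<otimes> ?K')" "Cod V k = Car (L x)" by (simp_all add: k_def)
  have kA: "k \<cdot> Assoc V ?L ?K ?K' = \<epsilon> x y \<cdot> (\<epsilon> y z \<boxtimes> \<iota> ?K')" by (simp add: k_def)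
  have "k \<cdot> (Act (L z) \<boxtimes> \<iota> (?K \<otimes> ?K')) = Act (L x) \<cdot> (\<iota> ?R \<boxtimes> k) \<cdot> Assoc V ?R ?L (?K \<otimes> ?K')"
  proof (rule iso_epi)
    have "(k \<cdot> (Act (L z) \<boxtimes> \<iota> (?K \<otimes> ?K'))) \<cdot> Assoc V (?R \<otimes> ?L) ?K ?K'
        = k \<cdot> ((Act (L z) \<boxtimes> (\<iota> ?K \<boxtimes> \<iota> ?K')) \<cdot> Assoc V (?R \<otimes> ?L) ?K ?K')" by simp
    also have "\<dots> = k \<cdot> (Assoc V ?L ?K ?K' \<cdot> ((Act (L z) \<boxtimes> \<iota> ?K) \<boxtimes> \<iota> ?K'))"
      by (subst Assoc_nat') auto
    also have "\<dots> = (k \<cdot> Assoc V ?L ?K ?K') \<cdot> ((Act (L z) \<boxtimes> \<iota> ?K) \<boxtimes> \<iota> ?K')" by simp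
    also have "\<dots> = \<epsilon> x y \<cdot> ((\<epsilon> y z \<cdot> (Act (L z) \<boxtimes> \<iota> ?K)) \<boxtimes> \<iota> ?K')" by (simp only: kA) simp
    also have "\<dots> = (\<epsilon> x y \<cdot> (Act (L y) \<boxtimes> \<iota> ?K')) \<cdot> ((\<iota> ?R \<boxtimes> \<epsilon> y z) \<boxtimes> \<iota> ?K') \<cdot> (Assoc V ?R ?L ?K \<boxtimes> \<iota> ?K')"
      by (simp only: \<epsilon>_act[of y z]) simp
    also have "\<dots> = Act (L x) \<cdot> (\<iota> ?R \<boxtimes> \<epsilon> x y) \<cdot> (Assoc V ?R (Car (L y)) ?K' \<cdot> ((\<iota> ?R \<boxtimes> \<epsilon> y z) \<boxtimes> \<iota> ?K')) \<cdot>
        (Assoc V ?R ?L ?K \<boxtimes> \<iota> ?K')"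
      by (simp only: \<epsilon>_act) simp
    also have "\<dots> = Act (L x) \<cdot> (\<iota> ?R \<boxtimes> (\<epsilon> x y \<cdot> (\<epsilon> y z \<boxtimes> \<iota> ?K'))) \<cdot> Assoc V ?R (?L \<otimes> ?K) ?K' \<cdot>
        (Assoc V ?R ?L ?K \<boxtimes> \<iota> ?K')"
      by (subst Assoc_nat') auto
    also have "\<dots> = Act (L x) \<cdot> (\<iota> ?R \<boxtimes> k) \<cdot> ((\<iota> ?R \<boxtimes> Assoc V ?L ?K ?K') \<cdot> Assoc V ?R (?L \<otimes> ?K) ?K' \<cdot>
        (Assoc V ?R ?L ?K \<boxtimes> \<iota> ?K'))"
      by (simp only: kA[symmetric]) simp
    also have "\<dots> = Act (L x) \<cdot> (\<iota> ?R \<boxtimes> k) \<cdot> (Assoc V ?R ?L (?K \<otimes> ?K') \<cdot> Assoc V (?R \<otimes> ?L) ?K ?K')"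
      by (subst pentagon) auto
    finally show "(k \<cdot> (Act (L z) \<boxtimes> \<iota> (?K \<otimes> ?K'))) \<cdot> Assoc V (?R \<otimes> ?L) ?K ?K'
        = (Act (L x) \<cdot> (\<iota> ?R \<boxtimes> k) \<cdot> Assoc V ?R ?L (?K \<otimes> ?K')) \<cdot> Assoc V (?R \<otimes> ?L) ?K ?K'" by simp
  qed simp_all
  then have lin: "linear R (L z) (?K \<otimes> ?K') (L x) k" by (simp add: linear_def in_homs)
  have "e x \<cdot> k = c x z \<cdot> (\<iota> ?L \<boxtimes> (VComp H x y z \<cdot> (\<pi> y z \<boxtimes> \<pi> x y)))"
  proof (rule iso_epi)
    have "(e x \<cdot> k) \<cdot> Assoc V ?L ?K ?K' = e x \<cdot> (k \<cdot> Assoc V ?L ?K ?K')" by simp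
    also have "\<dots> = (e x \<cdot> \<epsilon> x y) \<cdot> (\<epsilon> y z \<boxtimes> \<iota> ?K')" by (simp only: kA) simp
    also have "\<dots> = VComp H x y b \<cdot> ((e y \<cdot> \<epsilon> y z) \<boxtimes> \<pi> x y)" by (simp only: e_\<epsilon>[of x y]) simp
    also have "\<dots> = (VComp H x y b \<cdot> (VComp H y z b \<boxtimes> \<iota> (Hom H x y))) \<cdot> ((e z \<boxtimes> \<pi> y z) \<boxtimes> \<pi> x y)"
      by (simp only: e_\<epsilon>) simp
    also have "\<dots> = VComp H x z b \<cdot> (\<iota> (Hom H z b) \<boxtimes> VComp H x y z) \<cdot>
        (Assoc V (Hom H z b) (Hom H y z) (Hom H x y) \<cdot> ((e z \<boxtimes> \<pi> y z) \<boxtimes> \<pi> x y))"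
      by (simp only: vcat_assoc[OF H]) simp
    also have "\<dots> = VComp H x z b \<cdot> (e z \<boxtimes> (VComp H x y z \<cdot> (\<pi> y z \<boxtimes> \<pi> x y))) \<cdot> Assoc V ?L ?K ?K'"
      by (subst Assoc_nat') auto
    finally show "(e x \<cdot> k) \<cdot> Assoc V ?L ?K ?K'
        = (c x z \<cdot> (\<iota> ?L \<boxtimes> (VComp H x y z \<cdot> (\<pi> y z \<boxtimes> \<pi> x y)))) \<cdot> Assoc V ?L ?K ?K'" by simp
  qed simp_all
  then have "\<exists>!h. h \<in> homs V (?K \<otimes> ?K') (P x z) \<and> \<pi> x z \<cdot> h = VComp H x y z \<cdot> (\<pi> y z \<boxtimes> \<pi> x y) \<and>
     \<epsilon> x z \<cdot> (\<iota> ?L \<boxtimes> h) = k"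
    by (intro P_univ lin) (simp_all add: in_homs)
  from theI'[OF this] have *: "\<kappa> x y z \<in> homs V (?K \<otimes> ?K') (P x z)"
      "\<pi> x z \<cdot> \<kappa> x y z = VComp H x y z \<cdot> (\<pi> y z \<boxtimes> \<pi> x y)"
      "\<epsilon> x z \<cdot> (\<iota> ?L \<boxtimes> \<kappa> x y z) = k"
    unfolding \<kappa>_def k_def by blast+
  show "\<kappa> x y z \<in> homs V (?K \<otimes> ?K') (P x z)" "\<pi> x z \<cdot> \<kappa> x y z = VComp H x y z \<cdot> (\<pi> y z \<boxtimes> \<pi> x y)"
    by (rule *)+
  have "\<epsilon> x z \<cdot> (\<iota> ?L \<boxtimes> \<kappa> x y z) \<cdot> Assoc V ?L ?K ?K' = (\<epsilon> x z \<cdot> (\<iota> ?L \<boxtimes> \<kappa> x y z)) \<cdot> Assoc V ?L ?K ?K'"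
    using *(1) by (simp add: in_homs)
  then show "\<epsilon> x z \<cdot> (\<iota> ?L \<boxtimes> \<kappa> x y z) \<cdot> Assoc V ?L ?K ?K' = \<epsilon> x y \<cdot> (\<epsilon> y z \<boxtimes> \<iota> ?K')"
    by (simp only: *(3) kA)
qed

lemmas [simp] = \<kappa>_homs[unfolded in_homs, THEN conjunct1] \<kappa>_homs[unfolded in_homs, THEN conjunct2, THEN conjunct1]
  \<kappa>_homs[unfolded in_homs, THEN conjunct2, THEN conjunct2]

definition \<eta> where
  "\<eta> x = (THE h. h \<in> homs V (Unit V) (P x x) \<and> \<pi> x x \<cdot> h = VUnit H x \<and>
     \<epsilon> x x \<cdot> (\<iota> (Car (L x)) \<boxtimes> h) = RUnit V (Car (L x)))"

text \<open>The right unit isomorphism is linear by \<open>RUnit_Tens\<close>, and it lies over the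
  unit of \<open>H\<close> by the right unit law of \<open>H\<close>.\<close>

lemma \<eta>:
  shows \<eta>_homs: "\<eta> x \<in> homs V (Unit V) (P x x)" and \<pi>_\<eta>: "\<pi> x x \<cdot> \<eta> x = VUnit H x"
    and \<epsilon>_\<eta>: "\<epsilon> x x \<cdot> (\<iota> (Car (L x)) \<boxtimes> \<eta> x) = RUnit V (Car (L x))"
proof -
  let ?L = "Car (L x)" and ?R = "MCar R"
  have "RUnit V ?L \<cdot> (Act (L x) \<boxtimes> \<iota> (Unit V)) = Act (L x) \<cdot> RUnit V (?R \<otimes> ?L)"
    by (simp add: RUnit_nat')
  then have lin: "linear R (L x) (Unit V) (L x) (RUnit V ?L)"
    by (simp add: linear_def in_homs RUnit_Tens)
  have "c x x \<cdot> (\<iota> ?L \<boxtimes> VUnit H x) = (VComp H x x b \<cdot> (\<iota> (Hom H x b) \<boxtimes> VUnit H x)) \<cdot> (e x \<boxtimes> \<iota> (Unit V))"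
    by simp
  also have "\<dots> = e x \<cdot> RUnit V ?L" by (simp only: vcat_unit[OF H]) (simp add: RUnit_nat')
  finally have "\<exists>!h. h \<in> homs V (Unit V) (P x x) \<and> \<pi> x x \<cdot> h = VUnit H x \<and> \<epsilon> x x \<cdot> (\<iota> ?L \<boxtimes> h) = RUnit V ?L"
    by (intro P_univ lin) (simp_all add: in_homs)
  from theI'[OF this] show "\<eta> x \<in> homs V (Unit V) (P x x)" "\<pi> x x \<cdot> \<eta> x = VUnit H x"
    "\<epsilon> x x \<cdot> (\<iota> ?L \<boxtimes> \<eta> x) = RUnit V ?L"
    unfolding \<eta>_def by blast+
qed

lemmas [simp] = \<eta>_homs[unfolded in_homs, THEN conjunct1] \<eta>_homs[unfolded in_homs, THEN conjunct2, THEN conjunct1]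
  \<eta>_homs[unfolded in_homs, THEN conjunct2, THEN conjunct2]

text \<open>The action law \<open>\<epsilon>_\<kappa>\<close> at generalised elements of the
  hom-objects, ready for substituting composites and units.\<close>

lemma \<epsilon>_\<kappa>':
  assumes f: "f \<in> homs V S (P y z)" and g: "g \<in> homs V T (P x y)"
  shows "\<epsilon> x z \<cdot> (\<iota> (Car (L z)) \<boxtimes> (\<kappa> x y z \<cdot> (f \<boxtimes> g))) \<cdot> Assoc V (Car (L z)) S T
       = \<epsilon> x y \<cdot> ((\<epsilon> y z \<cdot> (\<iota> (Car (L z)) \<boxtimes> f)) \<boxtimes> g)"
proof -
  let ?L = "Car (L z)"
  have [simp]: "S \<in> Obj V" "T \<in> Obj V" using homs_Obj[OF f] homs_Obj[OF g] by auto
  note [simp] = f[unfolded in_homs] g[unfolded in_homs]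
  have "\<epsilon> x z \<cdot> (\<iota> ?L \<boxtimes> (\<kappa> x y z \<cdot> (f \<boxtimes> g))) \<cdot> Assoc V ?L S T
      = \<epsilon> x z \<cdot> (\<iota> ?L \<boxtimes> \<kappa> x y z) \<cdot> ((\<iota> ?L \<boxtimes> (f \<boxtimes> g)) \<cdot> Assoc V ?L S T)" by simp
  also have "\<dots> = (\<epsilon> x z \<cdot> (\<iota> ?L \<boxtimes> \<kappa> x y z) \<cdot> Assoc V ?L (P y z) (P x y)) \<cdot> ((\<iota> ?L \<boxtimes> f) \<boxtimes> g)"
    by (subst Assoc_nat'[symmetric, of "\<iota> ?L" f g ?L "P y z" "P x y", simplified]) simp
  also have "\<dots> = \<epsilon> x y \<cdot> ((\<epsilon> y z \<cdot> (\<iota> ?L \<boxtimes> f)) \<boxtimes> g)" by (simp only: \<epsilon>_\<kappa>) simp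
  finally show ?thesis .
qed

definition K where "K = \<lparr>Hom = P, VComp = \<kappa>, VUnit = \<eta>\<rparr>"

lemma \<kappa>_assoc: "\<kappa> w x z \<cdot> (\<kappa> x y z \<boxtimes> \<iota> (P w x)) = \<kappa> w y z \<cdot> (\<iota> (P y z) \<boxtimes> \<kappa> w x y) \<cdot> Assoc V (P y z) (P x y) (P w x)"
proof (rule P_eqI)
  let ?L = "Car (L z)" and ?X = "P y z" and ?Y = "P x y" and ?Z = "P w x"
  have "\<pi> w z \<cdot> (\<kappa> w x z \<cdot> (\<kappa> x y z \<boxtimes> \<iota> ?Z)) = (\<pi> w z \<cdot> \<kappa> w x z) \<cdot> (\<kappa> x y z \<boxtimes> \<iota> ?Z)" by simp
  also have "\<dots> = VComp H w x z \<cdot> ((\<pi> x z \<cdot> \<kappa> x y z) \<boxtimes> \<pi> w x)" by (simp only: \<pi>_\<kappa>[where x = w and y = x]) simp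
  also have "\<dots> = (VComp H w x z \<cdot> (VComp H x y z \<boxtimes> \<iota> (Hom H w x))) \<cdot> ((\<pi> y z \<boxtimes> \<pi> x y) \<boxtimes> \<pi> w x)"
    by (simp only: \<pi>_\<kappa>) simp
  also have "\<dots> = VComp H w y z \<cdot> (\<iota> (Hom H y z) \<boxtimes> VComp H w x y) \<cdot>
     (Assoc V (Hom H y z) (Hom H x y) (Hom H w x) \<cdot> ((\<pi> y z \<boxtimes> \<pi> x y) \<boxtimes> \<pi> w x))"
    by (simp only: vcat_assoc[OF H]) simp
  also have "\<dots> = VComp H w y z \<cdot> (\<pi> y z \<boxtimes> (VComp H w x y \<cdot> (\<pi> x y \<boxtimes> \<pi> w x))) \<cdot> Assoc V ?X ?Y ?Z"
    by (subst Assoc_nat') auto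
  also have "\<dots> = (VComp H w y z \<cdot> (\<pi> y z \<boxtimes> \<pi> w y)) \<cdot> (\<iota> ?X \<boxtimes> \<kappa> w x y) \<cdot> Assoc V ?X ?Y ?Z"
    by (simp only: \<pi>_\<kappa>[symmetric, where x = w and y = x and z = y]) simp
  also have "\<dots> = \<pi> w z \<cdot> (\<kappa> w y z \<cdot> (\<iota> ?X \<boxtimes> \<kappa> w x y) \<cdot> Assoc V ?X ?Y ?Z)"
    by (simp only: \<pi>_\<kappa>[symmetric]) simp
  finally show "\<pi> w z \<cdot> (\<kappa> w x z \<cdot> (\<kappa> x y z \<boxtimes> \<iota> ?Z)) = \<dots>" .
  show "\<epsilon> w z \<cdot> (\<iota> ?L \<boxtimes> (\<kappa> w x z \<cdot> (\<kappa> x y z \<boxtimes> \<iota> ?Z)))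
     = \<epsilon> w z \<cdot> (\<iota> ?L \<boxtimes> (\<kappa> w y z \<cdot> (\<iota> ?X \<boxtimes> \<kappa> w x y) \<cdot> Assoc V ?X ?Y ?Z))" (is "?lhs = ?rhs")
  \<comment> \<open>Two associators reach the bracketing ((L \<otimes> X) \<otimes> Y) \<otimes> Z,
    in which both sides act three times in succession.\<close>
  proof (rule iso_epi, rule iso_epi)
    have "(?lhs \<cdot> Assoc V ?L (?X \<otimes> ?Y) ?Z) \<cdot> (Assoc V ?L ?X ?Y \<boxtimes> \<iota> ?Z)
        = (\<epsilon> w z \<cdot> (\<iota> ?L \<boxtimes> (\<kappa> w x z \<cdot> (\<kappa> x y z \<boxtimes> \<iota> ?Z))) \<cdot> Assoc V ?L (?X \<otimes> ?Y) ?Z) \<cdot> (Assoc V ?L ?X ?Y \<boxtimes> \<iota> ?Z)"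
      by simp
    also have "\<dots> = (\<epsilon> w x \<cdot> ((\<epsilon> x z \<cdot> (\<iota> ?L \<boxtimes> \<kappa> x y z)) \<boxtimes> \<iota> ?Z)) \<cdot> (Assoc V ?L ?X ?Y \<boxtimes> \<iota> ?Z)"
      by (subst \<epsilon>_\<kappa>') (simp_all add: in_homs)
    also have "\<dots> = \<epsilon> w x \<cdot> ((\<epsilon> x z \<cdot> (\<iota> ?L \<boxtimes> \<kappa> x y z) \<cdot> Assoc V ?L ?X ?Y) \<boxtimes> \<iota> ?Z)" by simp
    also have "\<dots> = (\<epsilon> w x \<cdot> (\<epsilon> x y \<boxtimes> \<iota> ?Z)) \<cdot> ((\<epsilon> y z \<boxtimes> \<iota> ?Y) \<boxtimes> \<iota> ?Z)" by (simp only: \<epsilon>_\<kappa>) simp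
    also have "\<dots> = \<epsilon> w y \<cdot> (\<iota> (Car (L y)) \<boxtimes> \<kappa> w x y) \<cdot> (Assoc V (Car (L y)) ?Y ?Z \<cdot> ((\<epsilon> y z \<boxtimes> \<iota> ?Y) \<boxtimes> \<iota> ?Z))"
      by (simp only: \<epsilon>_\<kappa>[symmetric]) simp
    also have "\<dots> = \<epsilon> w y \<cdot> (\<epsilon> y z \<boxtimes> \<kappa> w x y) \<cdot> Assoc V (?L \<otimes> ?X) ?Y ?Z"
      by (subst Assoc_nat') auto
    also have "\<dots> = (\<epsilon> w y \<cdot> ((\<epsilon> y z \<cdot> (\<iota> ?L \<boxtimes> \<iota> ?X)) \<boxtimes> \<kappa> w x y)) \<cdot> Assoc V (?L \<otimes> ?X) ?Y ?Z" by simp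
    also have "\<dots> = (\<epsilon> w z \<cdot> (\<iota> ?L \<boxtimes> (\<kappa> w y z \<cdot> (\<iota> ?X \<boxtimes> \<kappa> w x y))) \<cdot> Assoc V ?L ?X (?Y \<otimes> ?Z)) \<cdot> Assoc V (?L \<otimes> ?X) ?Y ?Z"
      by (subst \<epsilon>_\<kappa>') (simp_all add: in_homs)
    also have "\<dots> = \<epsilon> w z \<cdot> (\<iota> ?L \<boxtimes> (\<kappa> w y z \<cdot> (\<iota> ?X \<boxtimes> \<kappa> w x y))) \<cdot> (Assoc V ?L ?X (?Y \<otimes> ?Z) \<cdot> Assoc V (?L \<otimes> ?X) ?Y ?Z)" by simp
    also have "\<dots> = \<epsilon> w z \<cdot> (\<iota> ?L \<boxtimes> (\<kappa> w y z \<cdot> (\<iota> ?X \<boxtimes> \<kappa> w x y))) \<cdot>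
        ((\<iota> ?L \<boxtimes> Assoc V ?X ?Y ?Z) \<cdot> Assoc V ?L (?X \<otimes> ?Y) ?Z \<cdot> (Assoc V ?L ?X ?Y \<boxtimes> \<iota> ?Z))"
      by (subst pentagon) auto
    also have "\<dots> = (?rhs \<cdot> Assoc V ?L (?X \<otimes> ?Y) ?Z) \<cdot> (Assoc V ?L ?X ?Y \<boxtimes> \<iota> ?Z)" by simp
    finally show "(?lhs \<cdot> Assoc V ?L (?X \<otimes> ?Y) ?Z) \<cdot> (Assoc V ?L ?X ?Y \<boxtimes> \<iota> ?Z) = \<dots>" .
  qed simp_all
qed (simp_all add: in_homs)

lemma \<kappa>_left_unit: "\<kappa> x y y \<cdot> (\<eta> y \<boxtimes> \<iota> (P x y)) = LUnit V (P x y)"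
proof (rule P_eqI)
  let ?L = "Car (L y)" and ?Z = "P x y"
  have "\<pi> x y \<cdot> (\<kappa> x y y \<cdot> (\<eta> y \<boxtimes> \<iota> ?Z)) = (\<pi> x y \<cdot> \<kappa> x y y) \<cdot> (\<eta> y \<boxtimes> \<iota> ?Z)" by simp
  also have "\<dots> = (VComp H x y y \<cdot> (VUnit H y \<boxtimes> \<iota> (Hom H x y))) \<cdot> (\<iota> (Unit V) \<boxtimes> \<pi> x y)"
    by (simp only: \<pi>_\<kappa>) (simp add: \<pi>_\<eta>)
  also have "\<dots> = \<pi> x y \<cdot> LUnit V ?Z" by (simp only: vcat_unit[OF H]) (simp add: LUnit_nat')
  finally show "\<pi> x y \<cdot> (\<kappa> x y y \<cdot> (\<eta> y \<boxtimes> \<iota> ?Z)) = \<pi> x y \<cdot> LUnit V ?Z" .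
  show "\<epsilon> x y \<cdot> (\<iota> ?L \<boxtimes> (\<kappa> x y y \<cdot> (\<eta> y \<boxtimes> \<iota> ?Z))) = \<epsilon> x y \<cdot> (\<iota> ?L \<boxtimes> LUnit V ?Z)" (is "?lhs = ?rhs")
  proof (rule iso_epi)
    have "?lhs \<cdot> Assoc V ?L (Unit V) ?Z = \<epsilon> x y \<cdot> (\<iota> ?L \<boxtimes> (\<kappa> x y y \<cdot> (\<eta> y \<boxtimes> \<iota> ?Z))) \<cdot> Assoc V ?L (Unit V) ?Z"
      by simp
    also have "\<dots> = \<epsilon> x y \<cdot> (RUnit V ?L \<boxtimes> \<iota> ?Z)"
      by (subst \<epsilon>_\<kappa>') (simp_all add: in_homs \<epsilon>_\<eta>)
    also have "\<dots> = ?rhs \<cdot> Assoc V ?L (Unit V) ?Z" by (simp add: triangle)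
    finally show "?lhs \<cdot> Assoc V ?L (Unit V) ?Z = ?rhs \<cdot> Assoc V ?L (Unit V) ?Z" .
  qed simp_all
qed (simp_all add: in_homs)

lemma \<kappa>_right_unit: "\<kappa> x x y \<cdot> (\<iota> (P x y) \<boxtimes> \<eta> x) = RUnit V (P x y)"
proof (rule P_eqI)
  let ?L = "Car (L y)" and ?Z = "P x y" and ?I = "Unit V"
  have "\<pi> x y \<cdot> (\<kappa> x x y \<cdot> (\<iota> ?Z \<boxtimes> \<eta> x)) = (\<pi> x y \<cdot> \<kappa> x x y) \<cdot> (\<iota> ?Z \<boxtimes> \<eta> x)" by simp
  also have "\<dots> = (VComp H x x y \<cdot> (\<iota> (Hom H x y) \<boxtimes> VUnit H x)) \<cdot> (\<pi> x y \<boxtimes> \<iota> ?I)"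
    by (simp only: \<pi>_\<kappa>) (simp add: \<pi>_\<eta>)
  also have "\<dots> = \<pi> x y \<cdot> RUnit V ?Z" by (simp only: vcat_unit[OF H]) (simp add: RUnit_nat')
  finally show "\<pi> x y \<cdot> (\<kappa> x x y \<cdot> (\<iota> ?Z \<boxtimes> \<eta> x)) = \<pi> x y \<cdot> RUnit V ?Z" .
  show "\<epsilon> x y \<cdot> (\<iota> ?L \<boxtimes> (\<kappa> x x y \<cdot> (\<iota> ?Z \<boxtimes> \<eta> x))) = \<epsilon> x y \<cdot> (\<iota> ?L \<boxtimes> RUnit V ?Z)" (is "?lhs = ?rhs")
  proof (rule iso_epi)
    have "?lhs \<cdot> Assoc V ?L ?Z ?I = \<epsilon> x y \<cdot> (\<iota> ?L \<boxtimes> (\<kappa> x x y \<cdot> (\<iota> ?Z \<boxtimes> \<eta> x))) \<cdot> Assoc V ?L ?Z ?I"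
      by simp
    also have "\<dots> = (\<epsilon> x x \<cdot> (\<iota> (Car (L x)) \<boxtimes> \<eta> x)) \<cdot> (\<epsilon> x y \<boxtimes> \<iota> ?I)"
      by (subst \<epsilon>_\<kappa>') (simp_all add: in_homs)
    also have "\<dots> = \<epsilon> x y \<cdot> RUnit V (?L \<otimes> ?Z)" by (simp only: \<epsilon>_\<eta>) (simp add: RUnit_nat')
    also have "\<dots> = ?rhs \<cdot> Assoc V ?L ?Z ?I" by (simp add: RUnit_Tens)
    finally show "?lhs \<cdot> Assoc V ?L ?Z ?I = ?rhs \<cdot> Assoc V ?L ?Z ?I" .
  qed simp_all
qed (simp_all add: in_homs)

lemma K_vcat: "is_vcat V K"
  using \<kappa>_assoc \<kappa>_left_unit \<kappa>_right_unit by (simp add: is_vcat_def K_def in_homs)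

lemma \<pi>_vfunctor: "\<pi> \<in> vfunctors V K H"
  using \<pi>_\<kappa> \<pi>_\<eta> by (simp add: vfunctors_def K_def in_homs)

definition \<theta> where "\<theta> x = \<epsilon> x b \<cdot> (MOne R \<boxtimes> \<iota> (P x b)) \<cdot> inverse_arr (LUnit V (P x b))"

lemma \<theta>_simps [simp]: "\<theta> x \<in> Arr V" "Dom V (\<theta> x) = P x b" "Cod V (\<theta> x) = Car (L x)"
  by (simp_all add: \<theta>_def)

lemma \<theta>_LUnit: "\<theta> x \<cdot> LUnit V (P x b) = \<epsilon> x b \<cdot> (MOne R \<boxtimes> \<iota> (P x b))"
  by (simp add: \<theta>_def)

text \<open>\<open>e b\<close> preserves units, so after \<open>e\<close> the evaluation at the unit
  becomes composition with the identity of \<open>b\<close>.\<close>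

lemma e_\<theta>: "e x \<cdot> \<theta> x = \<pi> x b"
proof (rule iso_epi)
  have "(e x \<cdot> \<theta> x) \<cdot> LUnit V (P x b) = e x \<cdot> (\<theta> x \<cdot> LUnit V (P x b))" by simp
  also have "\<dots> = (e x \<cdot> \<epsilon> x b) \<cdot> (MOne R \<boxtimes> \<iota> (P x b))" by (simp only: \<theta>_LUnit) simp
  also have "\<dots> = (VComp H x b b \<cdot> (VUnit H b \<boxtimes> \<iota> (Hom H x b))) \<cdot> (\<iota> (Unit V) \<boxtimes> \<pi> x b)"
    by (simp only: e_\<epsilon>) (simp add: e_one)
  also have "\<dots> = \<pi> x b \<cdot> LUnit V (P x b)" by (simp only: vcat_unit[OF H]) (simp add: LUnit_nat')
  finally show "(e x \<cdot> \<theta> x) \<cdot> LUnit V (P x b) = \<pi> x b \<cdot> LUnit V (P x b)" .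
qed simp_all

text \<open>A linear map out of the regular module is determined by its value at the unit: the
  Yoneda lemma for \<open>R\<close>.\<close>

lemma \<epsilon>_eq: "\<epsilon> x b = Act (L x) \<cdot> (\<iota> (MCar R) \<boxtimes> \<theta> x)"
proof -
  let ?R = "MCar R" and ?P = "P x b" and ?I = "Unit V"
  have RU: "MMul R \<cdot> (\<iota> ?R \<boxtimes> MOne R) = RUnit V ?R" using R by (simp add: is_monoid_def)
  have "\<epsilon> x b \<cdot> (\<iota> ?R \<boxtimes> LUnit V ?P) = Act (L x) \<cdot> (\<iota> ?R \<boxtimes> (\<epsilon> x b \<cdot> (MOne R \<boxtimes> \<iota> ?P)))"
  proof (rule iso_epi)
    have "(\<epsilon> x b \<cdot> (\<iota> ?R \<boxtimes> LUnit V ?P)) \<cdot> Assoc V ?R ?I ?P = \<epsilon> x b \<cdot> (RUnit V ?R \<boxtimes> \<iota> ?P)"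
      by (simp add: triangle)
    also have "\<dots> = (\<epsilon> x b \<cdot> (Act (L b) \<boxtimes> \<iota> ?P)) \<cdot> ((\<iota> ?R \<boxtimes> MOne R) \<boxtimes> \<iota> ?P)"
      by (simp add: RU)
    also have "\<dots> = Act (L x) \<cdot> (\<iota> ?R \<boxtimes> \<epsilon> x b) \<cdot> (Assoc V ?R ?R ?P \<cdot> ((\<iota> ?R \<boxtimes> MOne R) \<boxtimes> \<iota> ?P))"
      by (simp only: \<epsilon>_act) simp
    also have "\<dots> = (Act (L x) \<cdot> (\<iota> ?R \<boxtimes> (\<epsilon> x b \<cdot> (MOne R \<boxtimes> \<iota> ?P)))) \<cdot> Assoc V ?R ?I ?P"
      by (subst Assoc_nat') auto
    finally show "(\<epsilon> x b \<cdot> (\<iota> ?R \<boxtimes> LUnit V ?P)) \<cdot> Assoc V ?R ?I ?P = \<dots>" .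
  qed simp_all
  then have "\<epsilon> x b \<cdot> (\<iota> ?R \<boxtimes> LUnit V ?P) = (Act (L x) \<cdot> (\<iota> ?R \<boxtimes> \<theta> x)) \<cdot> (\<iota> ?R \<boxtimes> LUnit V ?P)"
    by (simp only: \<theta>_LUnit[symmetric]) simp
  then show ?thesis by (rule iso_epi) simp_all
qed

text \<open>A composite acts on the unit in two steps: first the element of \<open>P b b\<close>
  acts, giving its value under \<open>\<theta> b\<close>, and then the element of
  \<open>P x b\<close> acts on this value, which by \<open>\<epsilon>_eq\<close> is multiplication
  with its own value under \<open>\<theta> x\<close>.\<close>

lemma \<theta>_\<kappa>: "\<theta> x \<cdot> \<kappa> x b b = Act (L x) \<cdot> (\<theta> b \<boxtimes> \<theta> x)"
proof -
  let ?R = "MCar R" and ?P = "P x b" and ?Q = "P b b" and ?I = "Unit V"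
  have "\<theta> x \<cdot> \<kappa> x b b = \<epsilon> x b \<cdot> (\<theta> b \<boxtimes> \<iota> ?P)"
  proof (rule iso_epi, rule iso_epi)
    have "((\<theta> x \<cdot> \<kappa> x b b) \<cdot> LUnit V (?Q \<otimes> ?P)) \<cdot> Assoc V ?I ?Q ?P
        = (\<theta> x \<cdot> LUnit V ?P) \<cdot> (\<iota> ?I \<boxtimes> \<kappa> x b b) \<cdot> Assoc V ?I ?Q ?P"
      by (simp add: Comp_cong_left[OF LUnit_nat'])
    also have "\<dots> = \<epsilon> x b \<cdot> (\<iota> ?R \<boxtimes> \<kappa> x b b) \<cdot> ((MOne R \<boxtimes> (\<iota> ?Q \<boxtimes> \<iota> ?P)) \<cdot> Assoc V ?I ?Q ?P)"
      by (simp only: \<theta>_LUnit) simp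
    also have "\<dots> = \<epsilon> x b \<cdot> (\<iota> ?R \<boxtimes> \<kappa> x b b) \<cdot> (Assoc V ?R ?Q ?P \<cdot> ((MOne R \<boxtimes> \<iota> ?Q) \<boxtimes> \<iota> ?P))"
      by (subst Assoc_nat') auto
    also have "\<dots> = (\<epsilon> x b \<cdot> (\<iota> (Car (L b)) \<boxtimes> \<kappa> x b b) \<cdot> Assoc V (Car (L b)) ?Q ?P) \<cdot> ((MOne R \<boxtimes> \<iota> ?Q) \<boxtimes> \<iota> ?P)"
      by simp
    also have "\<dots> = \<epsilon> x b \<cdot> ((\<epsilon> b b \<cdot> (MOne R \<boxtimes> \<iota> ?Q)) \<boxtimes> \<iota> ?P)" by (simp only: \<epsilon>_\<kappa>) simp
    also have "\<dots> = \<epsilon> x b \<cdot> (\<theta> b \<boxtimes> \<iota> ?P) \<cdot> (LUnit V ?Q \<boxtimes> \<iota> ?P)"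
      by (simp only: \<theta>_LUnit[symmetric]) simp
    also have "\<dots> = ((\<epsilon> x b \<cdot> (\<theta> b \<boxtimes> \<iota> ?P)) \<cdot> LUnit V (?Q \<otimes> ?P)) \<cdot> Assoc V ?I ?Q ?P"
      by (simp add: LUnit_Tens[symmetric])
    finally show "((\<theta> x \<cdot> \<kappa> x b b) \<cdot> LUnit V (?Q \<otimes> ?P)) \<cdot> Assoc V ?I ?Q ?P = \<dots>" .
  qed simp_all
  also have "\<dots> = Act (L x) \<cdot> (\<theta> b \<boxtimes> \<theta> x)" by (simp add: \<epsilon>_eq)
  finally show ?thesis .
qed

lemma \<theta>_\<eta>: "\<theta> b \<cdot> \<eta> b = MOne R"
proof (rule iso_epi)
  let ?I = "Unit V"
  have "(\<theta> b \<cdot> \<eta> b) \<cdot> LUnit V ?I = (\<theta> b \<cdot> LUnit V (P b b)) \<cdot> (\<iota> ?I \<boxtimes> \<eta> b)"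
    by (simp add: LUnit_nat')
  also have "\<dots> = (\<epsilon> b b \<cdot> (\<iota> (Car (L b)) \<boxtimes> \<eta> b)) \<cdot> (MOne R \<boxtimes> \<iota> ?I)"
    by (simp only: \<theta>_LUnit) simp
  also have "\<dots> = MOne R \<cdot> LUnit V ?I" by (simp only: \<epsilon>_\<eta>) (simp add: RUnit_nat' LUnit_Unit)
  finally show "(\<theta> b \<cdot> \<eta> b) \<cdot> LUnit V ?I = MOne R \<cdot> LUnit V ?I" .
qed simp_all

end

section \<open>Splitting a replacement of the family of hom-objects\<close>

context monoidal_model
begin

text \<open>The form in which the cofibrancy of \<open>H\<close> enters. It is self-dual, and so
  passes to the opposite enriched category.\<close>

definition has_sections :: "('s, 'o, 'm) vcat \<Rightarrow> bool" where
  "has_sections H \<longleftrightarrow> (\<forall>K F. is_vcat V K \<longrightarrow> F \<in> vfunctors V K H \<longrightarrow> (\<forall>x y. F x y \<in> TF) \<longrightarrow>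
     (\<exists>S \<in> vfunctors V H K. \<forall>x y. F x y \<cdot> S x y = \<iota> (Hom H x y)))"

lemma family_section:
  assumes vH: "is_vcat V H" "has_sections H" and fL: "is_family V b R L" "\<And>x. cofibrant_module R (L x)"
    and fe: "e \<in> family_homs V b R L (endo_monoid H b) (\<lambda>x. hom_left_module H x b)" "\<And>x. e x \<in> TF"
  obtains t where "t \<in> family_homs V b (endo_monoid H b) (\<lambda>x. hom_left_module H x b) R L"
    "\<And>x. e x \<cdot> t x = \<iota> (Hom H x b)"
proof -
  have R: "is_monoid V R" and Lx: "\<And>x. is_left_module V R (L x)"
    using fL(1) by (simp_all add: is_family_def)
  note [simp] = is_vcatD[OF vH(1)] family_homsD(1,2)[OF fe(1)] is_left_moduleD[OF Lx] is_monoidD[OF R]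
  have e_Cod [simp]: "Cod V (e x) = Hom H x b" for x
    using family_homsD(3)[OF fe(1)] by (simp add: hom_left_module_def)
  let ?Q = "\<lambda>x y P \<pi> \<epsilon>. is_lift_object R (L y) (L x) (e x) (Hom H x y)
      (VComp H x y b \<cdot> (e y \<boxtimes> \<iota> (Hom H x y))) P \<pi> \<epsilon>"
  define p where "p x y = (SOME p. ?Q x y (fst p) (fst (snd p)) (snd (snd p)))" for x y
  have "\<exists>P \<pi> \<epsilon>. ?Q x y P \<pi> \<epsilon>" for x y
    by (rule ex_lift_object[where Y = "hom_left_module H x b"])
      (simp_all add: R Lx in_homs hom_left_module_def)
  then have "\<exists>p. ?Q x y (fst p) (fst (snd p)) (snd (snd p))" for x y by auto
  then have P: "?Q x y (fst (p x y)) (fst (snd (p x y))) (snd (snd (p x y)))" for x y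
    unfolding p_def by (rule someI_ex)
  define P where "P x y = fst (p x y)" for x y
  define \<pi> where "\<pi> x y = fst (snd (p x y))" for x y
  define \<epsilon> where "\<epsilon> x y = snd (snd (p x y))" for x y
  interpret module_cover V U M H b R L e P \<pi> \<epsilon>
    by unfold_locales (fact vH fL fe P[folded P_def \<pi>_def \<epsilon>_def])+
  obtain S where S: "S \<in> vfunctors V H K" "\<And>x y. \<pi> x y \<cdot> S x y = \<iota> (Hom H x y)"
    using vH(2) K_vcat \<pi>_vfunctor \<pi>_TF unfolding has_sections_def by blast
  have [simp]: "S x y \<in> Arr V" "Dom V (S x y) = Hom H x y" "Cod V (S x y) = P x y" for x y
    using vfunctorsD[OF S(1)] by (simp_all add: K_def)
  have S_comp: "S x z \<cdot> VComp H x y z = \<kappa> x y z \<cdot> (S y z \<boxtimes> S x y)" and S_unit: "S x x \<cdot> VUnit H x = \<eta> x" for x y z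
    using vfunctorsD[OF S(1)] by (simp_all add: K_def)
  \<comment> \<open>By \<open>e_\<theta>\<close> the section \<open>S\<close> of
    \<open>\<pi>\<close> turns into a section of \<open>e\<close>, and by
    \<open>\<theta>_\<kappa>\<close> and \<open>\<theta>_\<eta>\<close> it is a map of
    families.\<close>
  define t where "t x = \<theta> x \<cdot> S x b" for x
  have [simp]: "t x \<in> Arr V" "Dom V (t x) = Hom H x b" "Cod V (t x) = Car (L x)" for x by (simp_all add: t_def)
  have "t x \<cdot> VComp H x b b = Act (L x) \<cdot> (t b \<boxtimes> t x)" for x
  proof -
    have "t x \<cdot> VComp H x b b = \<theta> x \<cdot> (S x b \<cdot> VComp H x b b)" by (simp add: t_def)
    also have "\<dots> = (\<theta> x \<cdot> \<kappa> x b b) \<cdot> (S b b \<boxtimes> S x b)" by (simp only: S_comp) simp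
    also have "\<dots> = Act (L x) \<cdot> (t b \<boxtimes> t x)" by (simp only: \<theta>_\<kappa>) (simp add: t_def)
    finally show ?thesis .
  qed
  moreover have "t b \<cdot> VUnit H b = MOne R"
    by (simp add: t_def S_unit \<theta>_\<eta>)
  moreover have "e x \<cdot> t x = \<iota> (Hom H x b)" for x
  proof -
    have "e x \<cdot> t x = (e x \<cdot> \<theta> x) \<cdot> S x b" by (simp add: t_def)
    then show ?thesis by (simp only: e_\<theta> S(2))
  qed
  ultimately show thesis
    by (intro that[of t]) (simp_all add: family_homs_def in_homs hom_left_module_def endo_monoid_def)
qed

end

section \<open>The operad of monoids with families of modules\<close>

text \<open>A colour list is the input of at most one operation with a given target: \<open>b\<^sup>n\<close> with target \<open>b\<close>
  (a product), and \<open>b\<^sup>n t\<close> with target \<open>t\<close> (an iterated action).\<close>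

inductive module_path :: "'s \<Rightarrow> 's list \<Rightarrow> 's \<Rightarrow> bool" for b where
  Nil: "module_path b [] b"
| Single: "module_path b [t] t"
| Cons: "module_path b cs t \<Longrightarrow> module_path b (b # cs) t"

lemma module_path_base: "module_path b cs b \<longleftrightarrow> set cs \<subseteq> {b}"
proof
  have "module_path b cs t \<Longrightarrow> t = b \<Longrightarrow> set cs \<subseteq> {b}" for t
    by (induction rule: module_path.induct) auto
  then show "module_path b cs b \<Longrightarrow> set cs \<subseteq> {b}" by simp
  show "set cs \<subseteq> {b} \<Longrightarrow> module_path b cs b"
    by (induction cs) (auto intro: module_path.intros)
qed

lemma module_path_append:
  "set cs \<subseteq> {b} \<Longrightarrow> module_path b ds t \<Longrightarrow> module_path b (cs @ ds) t"
  by (induction cs) (auto intro: module_path.intros)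

text \<open>Closure under operadic composition: an input \<open>b\<close> can only be replaced by a
  power of \<open>b\<close>, so the shape of the list is preserved.\<close>

lemma module_path_concat:
  "module_path b ds t \<Longrightarrow> map snd qs = ds \<Longrightarrow> (\<And>cs s. (cs, s) \<in> set qs \<Longrightarrow> module_path b cs s) \<Longrightarrow>
    module_path b (concat (map fst qs)) t"
proof (induction arbitrary: qs rule: module_path.induct)
  case Nil
  then show ?case by (auto intro: module_path.intros)
next
  case (Single t)
  then show ?case by (auto simp: map_eq_Cons_conv)
next
  case (Cons ds t)
  then obtain cs qs' where qs: "qs = (cs, b) # qs'" "map snd qs' = ds"
    by (auto simp: map_eq_Cons_conv)
  have "module_path b (concat (map fst qs')) t" using Cons.IH[of qs'] Cons.prems(2) qs by auto
  moreover have "set cs \<subseteq> {b}" using Cons.prems(2) qs module_path_base by fastforce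
  ultimately show ?case using qs by (simp add: module_path_append)
qed

text \<open>An operation is coded by its inputs and its target. As these determine it, composition
  is concatenation of the inputs; \<open>col\<close> and \<open>opn\<close> place colours and
  operations in the universe type.\<close>

definition path_operad :: "('s \<Rightarrow> 'u) \<Rightarrow> ('s list \<times> 's \<Rightarrow> 'u) \<Rightarrow> 's \<Rightarrow> 'u operad" where
  "path_operad col opn b =
     \<lparr>Colours = range col,
      Opns = opn ` {(cs, t). module_path b cs t},
      Src = (\<lambda>p. map col (fst (inv opn p))),
      Tgt = (\<lambda>p. col (snd (inv opn p))),
      OpId = (\<lambda>c. opn ([inv col c], inv col c)),
      Plug = (\<lambda>p qs. opn (concat (map (\<lambda>q. fst (inv opn q)) qs), snd (inv opn p)))\<rparr>"

locale path_operad_coding =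
  fixes col :: "'s \<Rightarrow> 'u" and opn :: "'s list \<times> 's \<Rightarrow> 'u" and b :: 's
  assumes col: "inj col" and opn: "inj opn"
begin

abbreviation P where "P \<equiv> path_operad col opn b"

lemma P_simps [simp]:
  "Colours P = range col"
  "opn (cs, t) \<in> Opns P \<longleftrightarrow> module_path b cs t"
  "Src P (opn (cs, t)) = map col cs"
  "Tgt P (opn (cs, t)) = col t"
  "OpId P (col t) = opn ([t], t)"
  using inj_eq[OF opn] by (auto simp: path_operad_def inv_f_f[OF col] inv_f_f[OF opn])

lemma Opns_cases: "p \<in> Opns P \<Longrightarrow> (\<And>cs t. p = opn (cs, t) \<Longrightarrow> module_path b cs t \<Longrightarrow> thesis) \<Longrightarrow> thesis"
  by (auto simp: path_operad_def)

lemma Plug_opn [simp]: "Plug P (opn (ds, t)) (map opn qs) = opn (concat (map fst qs), t)"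
  by (simp add: path_operad_def inv_f_f[OF opn] comp_def)

lemma pluggable_opn [simp]:
  "pluggable P (opn (ds, t)) (map opn qs) \<longleftrightarrow>
     module_path b ds t \<and> (\<forall>(cs, s) \<in> set qs. module_path b cs s) \<and> map snd qs = ds"
proof -
  have *: "map (Tgt P \<circ> opn) qs = map col (map snd qs)" by auto
  have "map (Tgt P \<circ> opn) qs = map col ds \<longleftrightarrow> map snd qs = ds"
    unfolding * using inj_map_eq_map[OF col] by blast
  moreover have "opn ` set qs \<subseteq> Opns P \<longleftrightarrow> (\<forall>(cs, s) \<in> set qs. module_path b cs s)" by auto
  ultimately show ?thesis by (simp add: pluggable_def)
qed

lemma Opns_list: "set qs \<subseteq> Opns P \<Longrightarrow> \<exists>qs'. qs = map opn qs'"
proof (induction qs)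
  case (Cons q qs)
  then obtain qs' cs t where "qs = map opn qs'" "q = opn (cs, t)" by (auto elim: Opns_cases)
  then have "q # qs = map opn ((cs, t) # qs')" by simp
  then show ?case by (rule exI)
qed simp

lemma pluggable_cases:
  assumes "pluggable P p qs"
  obtains ds t qs' where "p = opn (ds, t)" "qs = map opn qs'" "module_path b ds t"
    "\<forall>(cs, s) \<in> set qs'. module_path b cs s" "map snd qs' = ds"
proof -
  obtain ds t where p: "p = opn (ds, t)"
    using assms by (auto simp: pluggable_def elim: Opns_cases)
  obtain qs' where qs: "qs = map opn qs'"
    using assms Opns_list by (auto simp: pluggable_def)
  show thesis
    using assms by (intro that[OF p qs]) (auto simp: p qs)
qed

text \<open>Operations with the same inputs and the same target coincide, so the operad laws reduce
  to associativity and unit laws for the concatenation of lists. Smallness holds because there are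
  countably many lists over a countable type.\<close>

lemma small_path_operad:
  assumes univ: "universe TYPE('u)" and ct: "\<exists>g :: 's \<Rightarrow> nat. inj g"
  shows "small_operad P"
proof
  obtain g :: "'s \<Rightarrow> nat" where g: "inj g" using ct by blast
  have "inj (\<lambda>(cs, t). (map g cs, g t))"
    using g by (auto simp: inj_def inj_map_eq_map)
  then have "inj (to_nat \<circ> (\<lambda>(cs, t). (map g cs, g t)))" by (rule inj_compose[OF inj_to_nat])
  then obtain g' :: "'s list \<times> 's \<Rightarrow> nat" where g': "inj g'" by blast
  have "range col \<subseteq> range (\<lambda>n. col (inv g n))" using inv_f_f[OF g] by (metis image_subset_iff rangeI)
  then show "small TYPE('u) (Colours P)" using univ by (simp add: small_range)
  have "Opns P \<subseteq> range (\<lambda>n. opn (inv g' n))"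
  proof
    fix p assume "p \<in> Opns P"
    then obtain cs t where "p = opn (cs, t)" by (rule Opns_cases)
    then show "p \<in> range (\<lambda>n. opn (inv g' n))"
      by (intro range_eqI[of _ _ "g' (cs, t)"]) (simp add: inv_f_f[OF g'])
  qed
  then show "small TYPE('u) (Opns P)" using univ by (rule small_range[rotated])
next
  fix p qs assume "pluggable P p qs"
  then obtain ds t qs' where *: "p = opn (ds, t)" "qs = map opn qs'" "module_path b ds t"
    "\<forall>(cs, s) \<in> set qs'. module_path b cs s" "map snd qs' = ds"
    by (rule pluggable_cases)
  have "concat (map (Src P) (map opn qs')) = map col (concat (map fst qs'))"
    by (induction qs') (auto simp: P_simps(3)[of "fst q" "snd q" for q, simplified])
  then show "Plug P p qs \<in> Opns P \<and> Src P (Plug P p qs) = concat (map (Src P) qs) \<and>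
      Tgt P (Plug P p qs) = Tgt P p"
    using module_path_concat[OF *(3,5)] *(4) by (auto simp: *(1,2))
next
  fix p qs rss assume pl: "pluggable P p qs" and rss: "list_all2 (pluggable P) qs rss"
  obtain ds t qs' where *: "p = opn (ds, t)" "qs = map opn qs'"
    by (rule pluggable_cases[OF pl])
  \<comment> \<open>The nested list is decoded position by position: an inner composite is coded by
    its concatenated inputs and the unchanged target.\<close>
  have "\<exists>rss'. rss = map (map opn) rss' \<and> map2 (Plug P) qs rss = map2 (\<lambda>q rs. opn (concat (map fst rs), snd q)) qs' rss' \<and> length rss' = length qs'"
    using rss unfolding *
  proof (induction qs' arbitrary: rss)
    case (Cons q qs')
    then obtain rs rss1 where r: "rss = rs # rss1" "pluggable P (opn q) rs" "list_all2 (pluggable P) (map opn qs') rss1"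
      by (auto simp: list_all2_Cons1)
    obtain rss' where rss': "rss1 = map (map opn) rss'"
      "map2 (Plug P) (map opn qs') rss1 = map2 (\<lambda>q rs. opn (concat (map fst rs), snd q)) qs' rss'" "length rss' = length qs'"
      using Cons.IH[OF r(3)] by blast
    obtain rs' where rs': "rs = map opn rs'" using r(2) Opns_list by (auto simp: pluggable_def)
    have "Plug P (opn q) rs = opn (concat (map fst rs'), snd q)"
      using Plug_opn[of "fst q" "snd q" rs'] by (simp add: rs')
    then show ?case
      using rss' by (intro exI[of _ "rs' # rss'"]) (simp add: r(1) rs')
  qed simp
  then obtain rss' where r: "rss = map (map opn) rss'"
    "map2 (Plug P) qs rss = map2 (\<lambda>q rs. opn (concat (map fst rs), snd q)) qs' rss'" "length rss' = length qs'"
    by blast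
  have m: "map2 (Plug P) qs rss = map opn (map2 (\<lambda>q rs. (concat (map fst rs), snd q)) qs' rss')"
    using r(2) by auto
  have "map fst (map2 (\<lambda>q rs. (concat (map fst rs), snd q)) qs' rss') = map (\<lambda>rs. concat (map fst rs)) rss'"
    using r(3) by (induction qs' rss' rule: list_induct2') auto
  moreover have "concat (map (\<lambda>rs. concat (map fst rs)) rss') = concat (map fst (concat rss'))"
    by (induction rss') auto
  ultimately have "Plug P p (map2 (Plug P) qs rss) = opn (concat (map fst (concat rss')), t)"
    by (simp only: m *(1) Plug_opn)
  moreover have "concat rss = map opn (concat rss')" by (simp add: r(1) map_concat)
  ultimately show "Plug P (Plug P p qs) (concat rss) = Plug P p (map2 (Plug P) qs rss)"
    by (simp only: * Plug_opn)
next
  fix p assume "p \<in> Opns P"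
  then obtain cs t where p: "p = opn (cs, t)" and cs: "module_path b cs t" by (rule Opns_cases)
  show "set (Src P p) \<subseteq> Colours P" "Tgt P p \<in> Colours P" by (auto simp: p)
  show "Plug P (OpId P (Tgt P p)) [p] = p"
    using Plug_opn[of "[t]" t "[(cs, t)]"] by (simp add: p)
  have "map (OpId P) (Src P p) = map opn (map (\<lambda>c. ([c], c)) cs)" by (simp add: p)
  moreover have "concat (map fst (map (\<lambda>c. ([c], c)) cs)) = cs" by (induction cs) auto
  ultimately show "Plug P p (map (OpId P) (Src P p)) = p"
    unfolding p by (simp only: Plug_opn)
next
  fix c assume "c \<in> Colours P"
  then show "OpId P c \<in> Opns P \<and> Src P (OpId P c) = [c] \<and> Tgt P (OpId P c) = c"
    by (auto intro: module_path.intros)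
qed

end

section \<open>Iterated tensor products and iterated actions\<close>

context closed_symmetric_monoidal_category
begin

lemma tens_list_simps [simp]: "tens_list V [] = Unit V" "tens_list V (X # Xs) = X \<otimes> tens_list V Xs"
  by (simp_all add: tens_list_def)

lemma tens_list_Obj [simp]: "set Xs \<subseteq> Obj V \<Longrightarrow> tens_list V Xs \<in> Obj V"
  by (induction Xs) auto

lemma tensA_list_simps [simp]: "tensA_list V [] = \<iota> (Unit V)" "tensA_list V (f # fs) = f \<boxtimes> tensA_list V fs"
  by (simp_all add: tensA_list_def)

lemma tens_append_arr [simp]:
  assumes "set Xs \<subseteq> Obj V" "set Ys \<subseteq> Obj V"
  shows "tens_append V Xs Ys \<in> Arr V" "Dom V (tens_append V Xs Ys) = tens_list V Xs \<otimes> tens_list V Ys"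
    "Cod V (tens_append V Xs Ys) = tens_list V (Xs @ Ys)"
proof -
  have "tens_append V Xs Ys \<in> homs V (tens_list V Xs \<otimes> tens_list V Ys) (tens_list V (Xs @ Ys))"
    using assms by (induction Xs) (auto simp: in_homs)
  then show "tens_append V Xs Ys \<in> Arr V" "Dom V (tens_append V Xs Ys) = tens_list V Xs \<otimes> tens_list V Ys"
    "Cod V (tens_append V Xs Ys) = tens_list V (Xs @ Ys)" by (simp_all add: in_homs)
qed

text \<open>\<open>LUnit_Unit\<close> starts the induction and \<open>RUnit_Tens\<close> is its
  step.\<close>

lemma tens_append_Nil: "set Xs \<subseteq> Obj V \<Longrightarrow> tens_append V Xs [] = RUnit V (tens_list V Xs)"
  by (induction Xs) (simp_all add: LUnit_Unit RUnit_Tens)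

lemma tens_concat_arr [simp]:
  assumes "\<forall>Xs \<in> set Xss. set Xs \<subseteq> Obj V"
  shows "tens_concat V Xss \<in> Arr V" "Dom V (tens_concat V Xss) = tens_list V (map (tens_list V) Xss)"
    "Cod V (tens_concat V Xss) = tens_list V (concat Xss)"
proof -
  have "tens_concat V Xss \<in> homs V (tens_list V (map (tens_list V) Xss)) (tens_list V (concat Xss))"
    using assms
  proof (induction Xss)
    case (Cons Xs Xss)
    then have "set (concat Xss) \<subseteq> Obj V" "set Xs \<subseteq> Obj V" by auto
    then show ?case using Cons by (simp add: in_homs)
  qed (simp add: in_homs)
  then show "tens_concat V Xss \<in> Arr V" "Dom V (tens_concat V Xss) = tens_list V (map (tens_list V) Xss)"
    "Cod V (tens_concat V Xss) = tens_list V (concat Xss)" by (simp_all add: in_homs)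
qed

text \<open>The structure maps of the algebra of a family. The last letter of a path may belong to a
  module without unit, so a single letter is not multiplied with \<open>MOne R\<close>;
  \<open>RUnit\<close> removes the unit object with which \<open>tens_list\<close> ends.\<close>

primrec iterated_act :: "('o, 'm) mon \<Rightarrow> ('s \<Rightarrow> ('o, 'm) module) \<Rightarrow> 's \<Rightarrow> 's list \<Rightarrow> 'm" where
  "iterated_act R N t [] = MOne R"
| "iterated_act R N t (c # cs) =
     (if cs = [] then RUnit V (Car (N c)) else Act (N t) \<cdot> (\<iota> (MCar R) \<boxtimes> iterated_act R N t cs))"

end

locale module_family = closed_symmetric_monoidal_category V
  for V :: "('o, 'm) smcat" (structure) +
  fixes b :: 's and R :: "('o, 'm) mon" and N :: "'s \<Rightarrow> ('o, 'm) module"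
  assumes family: "is_family V b R N"
begin

abbreviation obs where "obs cs \<equiv> map (\<lambda>s. Car (N s)) cs"
abbreviation ev where "ev t cs \<equiv> iterated_act R N t cs"

lemma family_R: "is_monoid V R" and family_N: "is_left_module V R (N x)" and family_b: "N b = regular R"
  using family by (simp_all add: is_family_def)

lemma family_simps [simp]:
  "Car (N b) = MCar R" "Act (N b) = MMul R"
  "MCar R \<in> Obj V" "MMul R \<in> Arr V" "Dom V (MMul R) = MCar R \<otimes> MCar R" "Cod V (MMul R) = MCar R"
  "MOne R \<in> Arr V" "Dom V (MOne R) = Unit V" "Cod V (MOne R) = MCar R"
  "Car (N x) \<in> Obj V" "Act (N x) \<in> Arr V" "Dom V (Act (N x)) = MCar R \<otimes> Car (N x)" "Cod V (Act (N x)) = Car (N x)"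
  using is_monoidD[OF family_R] is_left_moduleD[OF family_N] by (simp_all add: family_b regular_def)

lemma obs_Obj [simp]: "set (obs cs) \<subseteq> Obj V" "(\<lambda>s. Car (N s)) ` X \<subseteq> Obj V"
  by auto

text \<open>The two clauses for a nonempty list agree where they meet: for \<open>cs = []\<close>
  the path forces \<open>t = b\<close>, and the equation is the right unit law of
  \<open>R\<close>.\<close>

lemma ev_Cons:
  assumes "module_path b cs t"
  shows "ev t (b # cs) = Act (N t) \<cdot> (\<iota> (MCar R) \<boxtimes> ev t cs)"
  using assms by cases (use family_R in \<open>simp_all add: is_monoid_def\<close>)

lemma ev_homs: "module_path b cs t \<Longrightarrow> ev t cs \<in> homs V (tens_list V (obs cs)) (Car (N t))"
proof (induction rule: module_path.induct)
  case (Cons cs t)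
  then show ?case by (simp add: ev_Cons in_homs del: iterated_act.simps)
qed (simp_all add: in_homs)

lemma ev_arr [simp]:
  assumes "module_path b cs t"
  shows "ev t cs \<in> Arr V" "Dom V (ev t cs) = tens_list V (obs cs)" "Cod V (ev t cs) = Car (N t)"
  using ev_homs[OF assms] by (simp_all add: in_homs)

text \<open>The prefix has only letters \<open>b\<close>, so it evaluates to an element of the
  monoid, and this element acts on the value of the suffix: the module axioms, iterated over the
  prefix.\<close>

lemma ev_append:
  assumes ds: "module_path b ds t"
  shows "set cs \<subseteq> {b} \<Longrightarrow> ev t (cs @ ds) \<cdot> tens_append V (obs cs) (obs ds) = Act (N t) \<cdot> (ev b cs \<boxtimes> ev t ds)"
proof (induction cs)
  case Nil
  have "ev t ds \<cdot> LUnit V (tens_list V (obs ds)) = LUnit V (Car (N t)) \<cdot> (\<iota> (Unit V) \<boxtimes> ev t ds)"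
    by (simp add: LUnit_nat' ds)
  also have "\<dots> = (Act (N t) \<cdot> (MOne R \<boxtimes> \<iota> (Car (N t)))) \<cdot> (\<iota> (Unit V) \<boxtimes> ev t ds)"
    by (simp only: left_module_unit[OF family_N])
  finally show ?case by (simp add: ds)
next
  case (Cons c cs)
  then have c: "c = b" and cs: "set cs \<subseteq> {b}" by auto
  have p: "module_path b (cs @ ds) t" "module_path b cs b"
    using module_path_append[OF cs ds] module_path_base[of b cs] cs by auto
  let ?A = "MCar R"
  define T D where "T = tens_list V (obs cs)" and "D = tens_list V (obs ds)"
  have [simp]: "T \<in> Obj V" "D \<in> Obj V" by (simp_all add: T_def D_def)
  define f where "f = ev t (cs @ ds)"
  define g where "g = ev b cs"
  define h where "h = ev t ds"
  define k where "k = tens_append V (obs cs) (obs ds)"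
  have [simp]: "f \<in> Arr V" "Dom V f = tens_list V (obs (cs @ ds))" "Cod V f = Car (N t)"
    using ev_arr[OF p(1)] by (simp_all add: f_def)
  have [simp]: "g \<in> Arr V" "Dom V g = T" "Cod V g = ?A" "h \<in> Arr V" "Dom V h = D" "Cod V h = Car (N t)"
    using ev_arr[OF p(2)] ev_arr[OF ds] by (simp_all add: g_def h_def T_def D_def)
  have [simp]: "k \<in> Arr V" "Dom V k = T \<otimes> D" "Cod V k = tens_list V (obs (cs @ ds))"
    by (simp_all add: k_def T_def D_def)
  have IH: "f \<cdot> k = Act (N t) \<cdot> (g \<boxtimes> h)" using Cons.IH[OF cs] by (simp only: f_def g_def h_def k_def)
  have "ev t ((c # cs) @ ds) \<cdot> tens_append V (obs (c # cs)) (obs ds)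
      = (Act (N t) \<cdot> (\<iota> ?A \<boxtimes> f)) \<cdot> ((\<iota> ?A \<boxtimes> k) \<cdot> Assoc V ?A T D)"
    using ev_Cons[OF p(1)] by (simp only: f_def k_def T_def D_def c append.simps list.map
        tens_append.simps family_simps(1))
  also have "\<dots> = Act (N t) \<cdot> (\<iota> ?A \<boxtimes> (f \<cdot> k)) \<cdot> Assoc V ?A T D" by simp
  also have "\<dots> = Act (N t) \<cdot> (\<iota> ?A \<boxtimes> Act (N t)) \<cdot> ((\<iota> ?A \<boxtimes> (g \<boxtimes> h)) \<cdot> Assoc V ?A T D)"
    by (simp only: IH) simp
  also have "\<dots> = Act (N t) \<cdot> (\<iota> ?A \<boxtimes> Act (N t)) \<cdot> (Assoc V ?A ?A (Car (N t)) \<cdot> ((\<iota> ?A \<boxtimes> g) \<boxtimes> h))"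
    by (subst Assoc_nat') auto
  also have "\<dots> = (Act (N t) \<cdot> (MMul R \<boxtimes> \<iota> (Car (N t)))) \<cdot> ((\<iota> ?A \<boxtimes> g) \<boxtimes> h)"
    by (simp only: left_module_assoc[OF family_N]) simp
  also have "\<dots> = Act (N t) \<cdot> ((MMul R \<cdot> (\<iota> ?A \<boxtimes> g)) \<boxtimes> h)" by simp
  also have "\<dots> = Act (N t) \<cdot> (ev b (c # cs) \<boxtimes> h)"
    using ev_Cons[OF p(2)] by (simp only: g_def c family_simps(2))
  finally show ?case by (simp only: h_def)
qed

text \<open>The composition axiom of algebras for iterated actions. A block plugged into an input
  \<open>b\<close> evaluates in the monoid, and \<open>ev_append\<close> splits it off from the
  remaining blocks.\<close>

lemma ev_concat:
  assumes "module_path b ds t" "map snd qs = ds" "\<And>cs s. (cs, s) \<in> set qs \<Longrightarrow> module_path b cs s"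
  shows "ev t (concat (map fst qs)) \<cdot> tens_concat V (map (\<lambda>q. obs (fst q)) qs)
      = ev t ds \<cdot> tensA_list V (map (\<lambda>q. ev (snd q) (fst q)) qs)"
  using assms
proof (induction arbitrary: qs rule: module_path.induct)
  case Nil
  then show ?case by simp
next
  case (Single t)
  then obtain cs where qs: "qs = [(cs, t)]" by (auto simp: map_eq_Cons_conv)
  have [simp]: "module_path b cs t" using Single qs by simp
  show ?case by (simp add: qs tens_append_Nil RUnit_nat')
next
  case (Cons ds t)
  then obtain cs qs' where qs: "qs = (cs, b) # qs'" "map snd qs' = ds"
    by (auto simp: map_eq_Cons_conv)
  have q': "\<And>cs s. (cs, s) \<in> set qs' \<Longrightarrow> module_path b cs s" using Cons.prems(2) qs(1) by simp
  have IH: "ev t (concat (map fst qs')) \<cdot> tens_concat V (map (\<lambda>q. obs (fst q)) qs')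
      = ev t ds \<cdot> tensA_list V (map (\<lambda>q. ev (snd q) (fst q)) qs')"
    by (rule Cons.IH[OF qs(2) q'])
  have cs: "set cs \<subseteq> {b}" using Cons.prems(2) qs module_path_base by fastforce
  have pc: "module_path b (concat (map fst qs')) t" by (rule module_path_concat[OF Cons.hyps qs(2) q'])
  define rest where "rest = concat (map fst qs')"
  have rest: "concat (map (\<lambda>q. obs (fst q)) qs') = obs rest" by (simp add: rest_def map_concat comp_def)
  have p: "module_path b rest t" "module_path b cs b" "module_path b (cs @ rest) t"
    using pc module_path_base[of b cs] cs module_path_append[OF cs pc] by (auto simp: rest_def)
  define tc where "tc = tens_concat V (map (\<lambda>q. obs (fst q)) qs')"
  have pr: "\<forall>Xs \<in> set (map (\<lambda>q. obs (fst q)) qs'). set Xs \<subseteq> Obj V"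
    by auto
  have tc: "tc \<in> Arr V" "Cod V tc = tens_list V (obs rest)"
    "Dom V tc = tens_list V (map (\<lambda>q. tens_list V (obs (fst q))) qs')"
    using tens_concat_arr[OF pr] rest by (simp_all add: tc_def comp_def)
  define ta where "ta = tensA_list V (map (\<lambda>q. ev (snd q) (fst q)) qs')"
  have "tensA_list V (map (\<lambda>q. ev (snd q) (fst q)) qs') \<in>
      homs V (tens_list V (map (\<lambda>q. tens_list V (obs (fst q))) qs')) (tens_list V (obs (map snd qs')))"
    using q' by (induction qs') (auto simp: in_homs)
  then have ta: "ta \<in> Arr V" "Dom V ta = Dom V tc" "Cod V ta = tens_list V (obs ds)"
    by (simp_all add: in_homs ta_def qs(2) tc)
  define f where "f = ev b cs"
  define g where "g = ev t rest"
  define T where "T = tens_list V (obs cs)"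
  have [simp]: "f \<in> Arr V" "Dom V f = T" "Cod V f = MCar R" "T \<in> Obj V"
    "g \<in> Arr V" "Dom V g = tens_list V (obs rest)" "Cod V g = Car (N t)"
    using p by (simp_all add: f_def g_def T_def)
  have "ev t (concat (map fst qs)) \<cdot> tens_concat V (map (\<lambda>q. obs (fst q)) qs)
     = ev t (cs @ rest) \<cdot> (tens_append V (obs cs) (obs rest) \<cdot> (\<iota> T \<boxtimes> tc))"
    using rest by (simp add: qs(1) rest_def[symmetric] tc_def T_def)
  also have "\<dots> = (ev t (cs @ rest) \<cdot> tens_append V (obs cs) (obs rest)) \<cdot> (\<iota> T \<boxtimes> tc)"
    by (rule Comp_assoc'[symmetric]) (simp_all add: p tc T_def)
  also have "\<dots> = (Act (N t) \<cdot> (f \<boxtimes> g)) \<cdot> (\<iota> T \<boxtimes> tc)"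
    by (simp only: ev_append[OF p(1) cs] f_def g_def)
  also have "\<dots> = Act (N t) \<cdot> (f \<boxtimes> (g \<cdot> tc))" by (simp add: tc)
  also have "\<dots> = Act (N t) \<cdot> (f \<boxtimes> (ev t ds \<cdot> ta))"
    using IH by (simp only: g_def tc_def ta_def rest_def)
  also have "\<dots> = (Act (N t) \<cdot> (\<iota> (MCar R) \<boxtimes> ev t ds)) \<cdot> (f \<boxtimes> ta)" by (simp add: ta Cons.hyps)
  also have "\<dots> = ev t (b # ds) \<cdot> tensA_list V (map (\<lambda>q. ev (snd q) (fst q)) qs)"
    by (simp add: ev_Cons[symmetric] qs(1) ta_def f_def Cons.hyps del: iterated_act.simps)
  finally show ?case .
qed

end

section \<open>Algebras of the path operad as families of modules\<close>

locale path_algebras = closed_symmetric_monoidal_category V + path_operad_coding col opn b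
  for V :: "('o, 'm) smcat" (structure) and col :: "'s \<Rightarrow> 'u" and opn b
begin

lemma is_algebraD:
  assumes Z: "is_algebra V P Z"
  shows "fst Z (col s) \<in> Obj V"
    and "module_path b cs t \<Longrightarrow>
      snd Z (opn (cs, t)) \<in> homs V (tens_list V (map (\<lambda>s. fst Z (col s)) cs)) (fst Z (col t))"
    and "snd Z (opn ([t], t)) = RUnit V (fst Z (col t))"
proof -
  obtain A a where [simp]: "Z = (A, a)" by fastforce
  have "A \<in> range col \<rightarrow>\<^sub>E Obj V"
    and a: "\<forall>p \<in> Opns P. a p \<in> homs V (tens_list V (map A (Src P p))) (A (Tgt P p))"
    and i: "\<forall>c \<in> range col. a (OpId P c) = RUnit V (A c)"
    using Z by (simp_all add: is_algebra_def)
  then show "fst Z (col s) \<in> Obj V" by auto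
  show "module_path b cs t \<Longrightarrow>
      snd Z (opn (cs, t)) \<in> homs V (tens_list V (map (\<lambda>s. fst Z (col s)) cs)) (fst Z (col t))"
    using a[rule_format, of "opn (cs, t)"] by (simp add: comp_def)
  show "snd Z (opn ([t], t)) = RUnit V (fst Z (col t))"
    using i[rule_format, of "col t"] by simp
qed

lemma algebra_plug:
  assumes Z: "is_algebra V P Z" and "module_path b ds t" "map snd qs = ds" "\<forall>(cs, s) \<in> set qs. module_path b cs s"
  shows "snd Z (opn (concat (map fst qs), t)) \<cdot> tens_concat V (map (\<lambda>q. map (\<lambda>s. fst Z (col s)) (fst q)) qs)
    = snd Z (opn (ds, t)) \<cdot> tensA_list V (map (\<lambda>q. snd Z (opn q)) qs)"
proof -
  obtain A a where [simp]: "Z = (A, a)" by fastforce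
  have "\<forall>p qs. pluggable P p qs \<longrightarrow> a (Plug P p qs) \<cdot> tens_concat V (map (\<lambda>q. map A (Src P q)) qs)
        = a p \<cdot> tensA_list V (map a qs)"
    using Z by (simp add: is_algebra_def)
  moreover have "pluggable P (opn (ds, t)) (map opn qs)" using assms(2-4) by simp
  ultimately have eq: "a (Plug P (opn (ds, t)) (map opn qs)) \<cdot> tens_concat V (map (\<lambda>q. map A (Src P q)) (map opn qs))
        = a (opn (ds, t)) \<cdot> tensA_list V (map a (map opn qs))"
    by blast
  have "map (\<lambda>q. map A (Src P q)) (map opn qs) = map (\<lambda>q. map (\<lambda>s. A (col s)) (fst q)) qs"
    by auto
  from eq[unfolded this] show ?thesis by (simp add: comp_def)
qed

text \<open>\<open>tens_list\<close> ends with the unit object, so the binary operation has source X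
  b \<otimes> (X t \<otimes> I); the inverse of \<open>RUnit\<close> introduces the last
  factor.\<close>

definition algebra_act where
  "algebra_act Z t = snd Z (opn ([b, t], t)) \<cdot>
     (\<iota> (fst Z (col b)) \<boxtimes> inverse_arr (RUnit V (fst Z (col t))))"

definition algebra_monoid where
  "algebra_monoid Z = \<lparr>MCar = fst Z (col b), MMul = algebra_act Z b, MOne = snd Z (opn ([], b))\<rparr>"

definition algebra_module where
  "algebra_module Z t = \<lparr>Car = fst Z (col t), Act = algebra_act Z t\<rparr>"

context
  fixes Z assumes Z: "is_algebra V P Z"
begin

abbreviation X where "X s \<equiv> fst Z (col s)"
abbreviation \<alpha> where "\<alpha> cs t \<equiv> snd Z (opn (cs, t))"

lemma X_Obj [simp]: "X s \<in> Obj V" "set (map (\<lambda>s. X s) cs) \<subseteq> Obj V" "(\<lambda>s. X s) ` S \<subseteq> Obj V"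
  using is_algebraD(1)[OF Z] by auto

lemma \<alpha>_arr:
  assumes "module_path b cs t"
  shows "\<alpha> cs t \<in> Arr V" "Dom V (\<alpha> cs t) = tens_list V (map (\<lambda>s. X s) cs)" "Cod V (\<alpha> cs t) = X t"
  using is_algebraD(2)[OF Z assms] by (simp_all add: in_homs)

lemma path_simps [simp]: "module_path b [] b" "module_path b [t] t" "module_path b [b, t] t"
    "module_path b [b, b, t] t"
  by (auto intro: module_path.intros)

lemma act_arr [simp]: "algebra_act Z t \<in> Arr V" "Dom V (algebra_act Z t) = X b \<otimes> X t" "Cod V (algebra_act Z t) = X t"
  by (simp_all add: algebra_act_def \<alpha>_arr)

lemma \<alpha>_act: "\<alpha> [b, t] t = algebra_act Z t \<cdot> (\<iota> (X b) \<boxtimes> RUnit V (X t))"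
  by (simp add: algebra_act_def \<alpha>_arr)

text \<open>The operation on \<open>b # cs\<close> arises from the binary one by plugging the
  operation on \<open>cs\<close> into the second input. Hence nullary and binary operations
  determine all others. The isomorphism cancelled is \<open>tens_concat\<close> for the two
  blocks.\<close>

lemma \<alpha>_Cons:
  assumes cs: "module_path b cs t"
  shows "\<alpha> (b # cs) t = algebra_act Z t \<cdot> (\<iota> (X b) \<boxtimes> \<alpha> cs t)"
proof (rule iso_epi[where f = "RUnit V (X b) \<boxtimes> RUnit V (tens_list V (map (\<lambda>s. X s) cs))"])
  let ?T = "tens_list V (map (\<lambda>s. X s) cs)" and ?I = "Unit V"
  note [simp] = \<alpha>_arr[OF cs] \<alpha>_arr[OF module_path.Cons[OF cs]]
  have tc: "tens_concat V (map (\<lambda>q. map (\<lambda>s. X s) (fst q)) [([b], b), (cs, t)]) = RUnit V (X b) \<boxtimes> RUnit V ?T"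
  proof -
    have "tens_concat V (map (\<lambda>q. map (\<lambda>s. X s) (fst q)) [([b], b), (cs, t)])
      = ((\<iota> (X b) \<boxtimes> LUnit V ?T) \<cdot> Assoc V (X b) ?I ?T) \<cdot> (\<iota> (X b \<otimes> ?I) \<boxtimes> RUnit V ?T)"
      by (simp add: tens_append_Nil)
    then show ?thesis by (simp only: triangle X_Obj tens_list_Obj) simp
  qed
  have "\<alpha> (b # cs) t \<cdot> (RUnit V (X b) \<boxtimes> RUnit V ?T) = \<alpha> [b, t] t \<cdot> (RUnit V (X b) \<boxtimes> (\<alpha> cs t \<boxtimes> \<iota> ?I))"
    using algebra_plug[OF Z, of "[b, t]" t "[([b], b), (cs, t)]"] cs
    by (simp only: tc) (simp add: is_algebraD(3)[OF Z])
  also have "\<dots> = algebra_act Z t \<cdot> (RUnit V (X b) \<boxtimes> (RUnit V (X t) \<cdot> (\<alpha> cs t \<boxtimes> \<iota> ?I)))"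
    by (simp add: \<alpha>_act)
  also have "\<dots> = (algebra_act Z t \<cdot> (\<iota> (X b) \<boxtimes> \<alpha> cs t)) \<cdot> (RUnit V (X b) \<boxtimes> RUnit V ?T)"
    by (simp add: RUnit_nat')
  finally show "\<alpha> (b # cs) t \<cdot> (RUnit V (X b) \<boxtimes> RUnit V ?T)
    = (algebra_act Z t \<cdot> (\<iota> (X b) \<boxtimes> \<alpha> cs t)) \<cdot> (RUnit V (X b) \<boxtimes> RUnit V ?T)" .
qed (simp_all add: \<alpha>_arr[OF cs] \<alpha>_arr[OF module_path.Cons[OF cs]])

text \<open>Plugging the nullary operation into the first input of the binary one gives the identity
  operation of \<open>t\<close>.\<close>

lemma act_unit: "algebra_act Z t \<cdot> (\<alpha> [] b \<boxtimes> \<iota> (X t)) = LUnit V (X t)"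
\<comment> \<open>The source of \<open>tens_concat\<close> for the blocks \<open>[]\<close> and
  \<open>[t]\<close> has two trailing units, one from the block and one from the list of blocks;
  each needs a right unit isomorphism.\<close>
proof (rule iso_epi[where f = "\<iota> (Unit V) \<boxtimes> (RUnit V (X t) \<cdot> RUnit V (X t \<otimes> Unit V))"])
  let ?I = "Unit V" and ?X = "X t"
  note [simp] = \<alpha>_arr[OF path_simps(1)]
  have ta: "tens_append V [?X] [] = RUnit V (?X \<otimes> ?I)" by (subst tens_append_Nil) simp_all
  have "(algebra_act Z t \<cdot> (\<alpha> [] b \<boxtimes> \<iota> ?X)) \<cdot> (\<iota> ?I \<boxtimes> (RUnit V ?X \<cdot> RUnit V (?X \<otimes> ?I)))
      = algebra_act Z t \<cdot> (\<alpha> [] b \<boxtimes> (RUnit V ?X \<cdot> (RUnit V ?X \<boxtimes> \<iota> ?I)))" by (simp add: RUnit_nat')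
  also have "\<dots> = \<alpha> [b, t] t \<cdot> (\<alpha> [] b \<boxtimes> (RUnit V ?X \<boxtimes> \<iota> ?I))" by (simp add: \<alpha>_act)
  also have "\<dots> = RUnit V ?X \<cdot> LUnit V (?X \<otimes> ?I) \<cdot> (\<iota> ?I \<boxtimes> RUnit V (?X \<otimes> ?I))"
    using algebra_plug[OF Z, of "[b, t]" t "[([], b), ([t], t)]"]
    by (simp add: is_algebraD(3)[OF Z] ta del: tens_append.simps(2))
  also have "\<dots> = (RUnit V ?X \<cdot> LUnit V (?X \<otimes> ?I)) \<cdot> (\<iota> ?I \<boxtimes> RUnit V (?X \<otimes> ?I))" by simp
  also have "\<dots> = (LUnit V ?X \<cdot> (\<iota> ?I \<boxtimes> RUnit V ?X)) \<cdot> (\<iota> ?I \<boxtimes> RUnit V (?X \<otimes> ?I))"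
    by (simp only: LUnit_nat'[of "RUnit V ?X" ?X] RUnit_arr X_Obj)
  also have "\<dots> = LUnit V ?X \<cdot> (\<iota> ?I \<boxtimes> (RUnit V ?X \<cdot> RUnit V (?X \<otimes> ?I)))" by simp
  finally show "(algebra_act Z t \<cdot> (\<alpha> [] b \<boxtimes> \<iota> ?X)) \<cdot> (\<iota> ?I \<boxtimes> (RUnit V ?X \<cdot> RUnit V (?X \<otimes> ?I))) = \<dots>" .
  show "is_iso V (\<iota> ?I \<boxtimes> (RUnit V ?X \<cdot> RUnit V (?X \<otimes> ?I)))" by (simp add: iso_Comp)
qed (simp_all add: \<alpha>_arr)

text \<open>Two computations of the operation on \<open>[b, b, t]\<close>: plugging the product into
  the first input of the binary operation, and \<open>\<alpha>_Cons\<close>.\<close>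

lemma act_assoc: "algebra_act Z t \<cdot> (algebra_act Z b \<boxtimes> \<iota> (X t))
    = algebra_act Z t \<cdot> (\<iota> (X b) \<boxtimes> algebra_act Z t) \<cdot> Assoc V (X b) (X b) (X t)"
proof (rule iso_epi[where f = "(\<iota> (X b) \<boxtimes> RUnit V (X b)) \<boxtimes> (RUnit V (X t) \<cdot> RUnit V (X t \<otimes> Unit V))"])
  let ?I = "Unit V" and ?X = "X t" and ?R = "X b" and ?m = "algebra_act Z t"
  let ?XI = "?X \<otimes> ?I"
  let ?g = "RUnit V ?X \<cdot> RUnit V ?XI"
  have tc: "tens_concat V (map (\<lambda>q. map (\<lambda>s. X s) (fst q)) [([b, b], b), ([t], t)])
      = Assoc V ?R ?R ?XI \<cdot> ((\<iota> ?R \<boxtimes> RUnit V ?R) \<boxtimes> RUnit V ?XI)"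
  proof -
    have "tens_concat V (map (\<lambda>q. map (\<lambda>s. X s) (fst q)) [([b, b], b), ([t], t)])
      = (\<iota> ?R \<boxtimes> ((\<iota> ?R \<boxtimes> LUnit V ?XI) \<cdot> Assoc V ?R ?I ?XI)) \<cdot> (Assoc V ?R (?R \<otimes> ?I) ?XI \<cdot> ((\<iota> ?R \<boxtimes> \<iota> (?R \<otimes> ?I)) \<boxtimes> RUnit V ?XI))"
      using tens_append_Nil[of "[X t]"] by (simp del: tens_append.simps(2)) (simp add: tens_append.simps(2))
    also have "\<dots> = (\<iota> ?R \<boxtimes> (RUnit V ?R \<boxtimes> \<iota> ?XI)) \<cdot> (Assoc V ?R (?R \<otimes> ?I) ?XI \<cdot> ((\<iota> ?R \<boxtimes> \<iota> (?R \<otimes> ?I)) \<boxtimes> RUnit V ?XI))"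
      by (simp only: triangle X_Obj Tens_in Unit_in)
    also have "\<dots> = (\<iota> ?R \<boxtimes> (RUnit V ?R \<boxtimes> RUnit V ?XI)) \<cdot> Assoc V ?R (?R \<otimes> ?I) (?XI \<otimes> ?I)"
      by (subst Assoc_nat') auto
    also have "\<dots> = Assoc V ?R ?R ?XI \<cdot> ((\<iota> ?R \<boxtimes> RUnit V ?R) \<boxtimes> RUnit V ?XI)"
      by (subst Assoc_nat') auto
    finally show ?thesis .
  qed
  have bbt: "\<alpha> [b, b, t] t = ?m \<cdot> (\<iota> ?R \<boxtimes> (?m \<cdot> (\<iota> ?R \<boxtimes> RUnit V ?X)))"
    using \<alpha>_Cons[of "[b, t]" t] by (simp add: \<alpha>_act)
  have "(?m \<cdot> (algebra_act Z b \<boxtimes> \<iota> ?X)) \<cdot> ((\<iota> ?R \<boxtimes> RUnit V ?R) \<boxtimes> ?g)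
      = ?m \<cdot> ((algebra_act Z b \<cdot> (\<iota> ?R \<boxtimes> RUnit V ?R)) \<boxtimes> (RUnit V ?X \<cdot> (RUnit V ?X \<boxtimes> \<iota> ?I)))"
    by (simp add: RUnit_nat')
  also have "\<dots> = \<alpha> [b, t] t \<cdot> (\<alpha> [b, b] b \<boxtimes> (RUnit V ?X \<boxtimes> \<iota> ?I))"
    by (simp add: \<alpha>_act)
  also have "\<dots> = \<alpha> [b, b, t] t \<cdot> Assoc V ?R ?R ?XI \<cdot> ((\<iota> ?R \<boxtimes> RUnit V ?R) \<boxtimes> RUnit V ?XI)"
    using algebra_plug[OF Z, of "[b, t]" t "[([b, b], b), ([t], t)]"]
    by (simp only: tc) (simp add: is_algebraD(3)[OF Z])
  also have "\<dots> = ?m \<cdot> (\<iota> ?R \<boxtimes> ?m) \<cdot> ((\<iota> ?R \<boxtimes> (\<iota> ?R \<boxtimes> RUnit V ?X)) \<cdot> Assoc V ?R ?R ?XI) \<cdot> ((\<iota> ?R \<boxtimes> RUnit V ?R) \<boxtimes> RUnit V ?XI)"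
    by (simp add: bbt)
  also have "\<dots> = ?m \<cdot> (\<iota> ?R \<boxtimes> ?m) \<cdot> (Assoc V ?R ?R ?X \<cdot> ((\<iota> ?R \<boxtimes> \<iota> ?R) \<boxtimes> RUnit V ?X)) \<cdot> ((\<iota> ?R \<boxtimes> RUnit V ?R) \<boxtimes> RUnit V ?XI)"
    by (subst Assoc_nat') auto
  also have "\<dots> = (?m \<cdot> (\<iota> ?R \<boxtimes> ?m) \<cdot> Assoc V ?R ?R ?X) \<cdot> ((\<iota> ?R \<boxtimes> RUnit V ?R) \<boxtimes> ?g)"
    by simp
  finally show "(?m \<cdot> (algebra_act Z b \<boxtimes> \<iota> ?X)) \<cdot> ((\<iota> ?R \<boxtimes> RUnit V ?R) \<boxtimes> ?g) = \<dots>" .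
  show "is_iso V ((\<iota> ?R \<boxtimes> RUnit V ?R) \<boxtimes> ?g)" by (simp add: iso_Comp)
qed (simp_all add: \<alpha>_arr)

lemma algebra_family: "is_family V b (algebra_monoid Z) (algebra_module Z)"
proof -
  have "algebra_act Z b \<cdot> (\<iota> (X b) \<boxtimes> \<alpha> [] b) = RUnit V (X b)"
    using \<alpha>_Cons[OF path_simps(1)] by (simp add: is_algebraD(3)[OF Z])
  then show ?thesis
    using act_assoc act_unit
    by (simp add: is_family_def is_monoid_def is_left_module_def algebra_monoid_def algebra_module_def
        regular_def in_homs \<alpha>_arr)
qed

end

definition family_algebra where
  "family_algebra R N =
     ((\<lambda>c \<in> range col. Car (N (inv col c))),
      (\<lambda>p \<in> Opns P. iterated_act R N (snd (inv opn p)) (fst (inv opn p))))"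

context
  fixes R N assumes fam: "is_family V b R N"
begin

interpretation module_family V b R N
  using fam by unfold_locales

lemma fst_family_algebra [simp]: "fst (family_algebra R N) (col s) = Car (N s)"
  by (simp add: family_algebra_def inv_f_f[OF col])

lemma snd_family_algebra [simp]:
  "module_path b cs t \<Longrightarrow> snd (family_algebra R N) (opn (cs, t)) = iterated_act R N t cs"
  by (simp add: family_algebra_def inv_f_f[OF opn])

lemma is_algebra_family_algebra: "is_algebra V P (family_algebra R N)"
proof -
  let ?A = "fst (family_algebra R N)" and ?a = "snd (family_algebra R N)"
  have "?A \<in> Colours P \<rightarrow>\<^sub>E Obj V" "?a \<in> extensional (Opns P)"
    by (auto simp: family_algebra_def)
  moreover have "?a p \<in> homs V (tens_list V (map ?A (Src P p))) (?A (Tgt P p))" if "p \<in> Opns P" for p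
    using that by (rule Opns_cases) (simp add: ev_homs comp_def)
  moreover have "?a (OpId P c) = RUnit V (?A c)" if "c \<in> Colours P" for c
    using that by (auto simp: module_path.Single)
  moreover have "?a (Plug P p qs) \<cdot> tens_concat V (map (\<lambda>q. map ?A (Src P q)) qs) = ?a p \<cdot> tensA_list V (map ?a qs)"
    if pl: "pluggable P p qs" for p qs
  proof -
    obtain ds t qs' where *: "p = opn (ds, t)" "qs = map opn qs'" "module_path b ds t"
      "\<forall>(cs, s) \<in> set qs'. module_path b cs s" "map snd qs' = ds"
      by (rule pluggable_cases[OF pl])
    have q: "\<And>cs s. (cs, s) \<in> set qs' \<Longrightarrow> module_path b cs s" using *(4) by auto
    have "map (\<lambda>q. map ?A (Src P q)) qs = map (\<lambda>q. obs (fst q)) qs'" by (auto simp: *(2))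
    moreover have "map ?a qs = map (\<lambda>q. ev (snd q) (fst q)) qs'" using q by (auto simp: *(2))
    moreover have "?a (Plug P p qs) = ev t (concat (map fst qs'))"
      using module_path_concat[OF *(3,5) q] by (simp add: *(1,2))
    ultimately show ?thesis
      using ev_concat[OF *(3,5) q] by (simp only: *(1) snd_family_algebra[OF *(3)])
  qed
  ultimately show ?thesis by (simp add: is_algebra_def case_prod_beta module_path.Single)
qed

text \<open>The passage from families to algebras and back is the identity on the nose, so maps
  between algebras of families translate to maps of the given families.\<close>

lemma algebra_module_family_algebra: "algebra_module (family_algebra R N) = N"
proof
  fix t
  have "algebra_act (family_algebra R N) t = Act (N t)"
    by (simp add: algebra_act_def module_path.intros)
  then show "algebra_module (family_algebra R N) t = N t" by (simp add: algebra_module_def)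
qed

lemma algebra_monoid_family_algebra: "algebra_monoid (family_algebra R N) = R"
proof -
  have "algebra_act (family_algebra R N) b = MMul R"
    by (simp add: algebra_act_def module_path.intros)
  then show ?thesis by (simp add: algebra_monoid_def module_path.intros)
qed

end

text \<open>Compatibility with the nullary and the binary operations is compatibility with unit and
  actions, up to the right unit isomorphism in the source of the binary ones.\<close>

lemma family_hom_of_algebra_hom:
  assumes Z: "is_algebra V P Z" and Z': "is_algebra V P Z'" and f: "f \<in> algebra_homs V P Z Z'"
  shows "(\<lambda>s. f (col s)) \<in> family_homs V b (algebra_monoid Z) (algebra_module Z) (algebra_monoid Z') (algebra_module Z')"
proof -
  let ?X = "\<lambda>s. fst Z (col s)" and ?X' = "\<lambda>s. fst Z' (col s)" and ?f = "\<lambda>s. f (col s)"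
  note [simp] = X_Obj(1)[OF Z] X_Obj(1)[OF Z'] act_arr[OF Z] act_arr[OF Z'] \<alpha>_arr[OF Z path_simps(1)[OF Z]]
    \<alpha>_arr[OF Z' path_simps(1)[OF Z]]
  have f1: "?f s \<in> homs V (?X s) (?X' s)" for s using f by (auto simp: algebra_homs_def case_prod_beta)
  note [simp] = f1[unfolded in_homs, THEN conjunct1] f1[unfolded in_homs, THEN conjunct2, THEN conjunct1]
    f1[unfolded in_homs, THEN conjunct2, THEN conjunct2]
  have f2: "f (Tgt P p) \<cdot> snd Z p = snd Z' p \<cdot> tensA_list V (map f (Src P p))" if "p \<in> Opns P" for p
    using f that by (auto simp: algebra_homs_def case_prod_beta)
  have "?f b \<cdot> snd Z (opn ([], b)) = snd Z' (opn ([], b))"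
    using f2[of "opn ([], b)"] by (simp add: module_path.intros)
  moreover have "?f t \<cdot> algebra_act Z t = algebra_act Z' t \<cdot> (?f b \<boxtimes> ?f t)" for t
  proof (rule iso_epi[where f = "\<iota> (?X b) \<boxtimes> RUnit V (?X t)"])
    have "(?f t \<cdot> algebra_act Z t) \<cdot> (\<iota> (?X b) \<boxtimes> RUnit V (?X t)) = ?f t \<cdot> snd Z (opn ([b, t], t))"
      by (simp add: \<alpha>_act[OF Z])
    also have "\<dots> = snd Z' (opn ([b, t], t)) \<cdot> (?f b \<boxtimes> (?f t \<boxtimes> \<iota> (Unit V)))"
      using f2[of "opn ([b, t], t)"] by (simp add: module_path.intros)
    also have "\<dots> = algebra_act Z' t \<cdot> (?f b \<boxtimes> (RUnit V (?X' t) \<cdot> (?f t \<boxtimes> \<iota> (Unit V))))"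
      by (simp add: \<alpha>_act[OF Z'])
    also have "\<dots> = (algebra_act Z' t \<cdot> (?f b \<boxtimes> ?f t)) \<cdot> (\<iota> (?X b) \<boxtimes> RUnit V (?X t))"
      by (simp add: RUnit_nat')
    finally show "(?f t \<cdot> algebra_act Z t) \<cdot> (\<iota> (?X b) \<boxtimes> RUnit V (?X t)) = \<dots>" .
  qed simp_all
  ultimately show ?thesis
    using f1 by (simp add: family_homs_def algebra_monoid_def algebra_module_def)
qed

text \<open>Compatibility with every operation follows by induction along
  \<open>module_path\<close>, with \<open>\<alpha>_Cons\<close> reducing each longer operation to an
  action.\<close>

lemma algebra_hom_of_family_hom:
  assumes Z: "is_algebra V P Z" and Z': "is_algebra V P Z'"
    and f: "f \<in> family_homs V b (algebra_monoid Z) (algebra_module Z) (algebra_monoid Z') (algebra_module Z')"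
  shows "(\<lambda>c \<in> range col. f (inv col c)) \<in> algebra_homs V P Z Z'"
proof -
  let ?X = "\<lambda>s. fst Z (col s)" and ?X' = "\<lambda>s. fst Z' (col s)"
  let ?g = "\<lambda>c \<in> range col. f (inv col c)"
  note [simp] = X_Obj(1)[OF Z] X_Obj(1)[OF Z'] act_arr[OF Z] act_arr[OF Z']
  have f1: "f s \<in> homs V (?X s) (?X' s)" and f2: "f s \<cdot> algebra_act Z s = algebra_act Z' s \<cdot> (f b \<boxtimes> f s)" for s
    using f by (simp_all add: family_homs_def algebra_module_def)
  have f3: "f b \<cdot> snd Z (opn ([], b)) = snd Z' (opn ([], b))"
    using f by (simp add: family_homs_def algebra_monoid_def)
  note [simp] = f1[unfolded in_homs, THEN conjunct1] f1[unfolded in_homs, THEN conjunct2, THEN conjunct1]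
    f1[unfolded in_homs, THEN conjunct2, THEN conjunct2]
  have gc [simp]: "?g (col s) = f s" for s by (simp add: inv_f_f[OF col])
  have ta: "tensA_list V (map f cs) \<in> homs V (tens_list V (map ?X cs)) (tens_list V (map ?X' cs))" for cs
    by (induction cs) (auto simp: in_homs)
  note [simp] = ta[unfolded in_homs, THEN conjunct1] ta[unfolded in_homs, THEN conjunct2, THEN conjunct1]
    ta[unfolded in_homs, THEN conjunct2, THEN conjunct2]
  have "f t \<cdot> snd Z (opn (cs, t)) = snd Z' (opn (cs, t)) \<cdot> tensA_list V (map f cs)" if "module_path b cs t" for cs t
    using that
  proof (induction rule: module_path.induct)
    case Nil
    show ?case using \<alpha>_arr[OF Z' path_simps(1)[OF Z]] by (simp add: f3)
  next
    case (Single t)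
    show ?case by (simp add: is_algebraD(3)[OF Z] is_algebraD(3)[OF Z'] RUnit_nat')
  next
    case (Cons cs t)
    note [simp] = \<alpha>_arr[OF Z Cons.hyps] \<alpha>_arr[OF Z' Cons.hyps]
    have "f t \<cdot> snd Z (opn (b # cs, t)) = (f t \<cdot> algebra_act Z t) \<cdot> (\<iota> (?X b) \<boxtimes> snd Z (opn (cs, t)))"
      by (simp add: \<alpha>_Cons[OF Z Cons.hyps])
    also have "\<dots> = algebra_act Z' t \<cdot> (f b \<boxtimes> (f t \<cdot> snd Z (opn (cs, t))))" by (simp only: f2) simp
    also have "\<dots> = (algebra_act Z' t \<cdot> (\<iota> (?X' b) \<boxtimes> snd Z' (opn (cs, t)))) \<cdot> (f b \<boxtimes> tensA_list V (map f cs))"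
      by (simp only: Cons.IH) simp
    also have "\<dots> = snd Z' (opn (b # cs, t)) \<cdot> tensA_list V (map f (b # cs))"
      by (simp add: \<alpha>_Cons[OF Z' Cons.hyps])
    finally show ?case .
  qed
  moreover have "map ?g (map col cs) = map f cs" for cs by (auto simp: inv_f_f[OF col])
  ultimately have "?g (Tgt P p) \<cdot> snd Z p = snd Z' p \<cdot> tensA_list V (map ?g (Src P p))" if "p \<in> Opns P" for p
    using that by (auto elim!: Opns_cases simp del: map_map restrict_apply)
  moreover have "?g c \<in> homs V (fst Z c) (fst Z' c)" if "c \<in> Colours P" for c
    using that f1 by (auto simp: inv_f_f[OF col])
  ultimately show ?thesis by (simp add: algebra_homs_def case_prod_beta)
qed

end

section \<open>Cofibrant objects of categories of structures\<close>

lemma homs_struct_cat: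
  "F \<in> homs (struct_cat S h e c) A B \<longleftrightarrow> A \<in> S \<and> B \<in> S \<and> (\<exists>f \<in> h A B. F = (A, B, f))"
  by (auto simp: homs_def struct_cat_def)

lemma struct_cat_simps [simp]:
  "Obj (struct_cat S h e c) = S"
  "(A, B, f) \<in> Arr (struct_cat S h e c) \<longleftrightarrow> A \<in> S \<and> B \<in> S \<and> f \<in> h A B"
  "Dom (struct_cat S h e c) (A, B, f) = A"
  "Cod (struct_cat S h e c) (A, B, f) = B"
  "Ident (struct_cat S h e c) A = (A, A, e A)"
  "(B', D, g) \<cdot>\<^bsub>struct_cat S h e c\<^esub> (A, B, f) = (A, D, c g f)"
  by (simp_all add: struct_cat_def)

lemma initial_struct_cat:
  assumes A: "A \<in> S" and ex: "\<And>B. B \<in> S \<Longrightarrow> \<exists>!f. f \<in> h A B"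
  shows "initial (struct_cat S h e c) A"
proof -
  have "\<exists>!F. F \<in> homs (struct_cat S h e c) A B" if B: "B \<in> S" for B
  proof -
    obtain f where f: "f \<in> h A B" and un: "\<And>g. g \<in> h A B \<Longrightarrow> g = f" using ex[OF B] by blast
    show ?thesis
      using f A B by (intro ex1I[of _ "(A, B, f)"]) (auto simp: homs_struct_cat dest: un)
  qed
  then show ?thesis using A by (simp add: initial_def)
qed

lemma category_struct_cat:
  assumes "\<And>A. A \<in> S \<Longrightarrow> e A \<in> h A A"
    and "\<And>A B D f g. A \<in> S \<Longrightarrow> B \<in> S \<Longrightarrow> D \<in> S \<Longrightarrow> f \<in> h A B \<Longrightarrow> g \<in> h B D \<Longrightarrow> c g f \<in> h A D"
    and "\<And>A B f. A \<in> S \<Longrightarrow> B \<in> S \<Longrightarrow> f \<in> h A B \<Longrightarrow> c f (e A) = f"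
    and "\<And>A B f. A \<in> S \<Longrightarrow> B \<in> S \<Longrightarrow> f \<in> h A B \<Longrightarrow> c (e B) f = f"
    and "\<And>A B D E f g k. A \<in> S \<Longrightarrow> B \<in> S \<Longrightarrow> D \<in> S \<Longrightarrow> E \<in> S \<Longrightarrow> f \<in> h A B \<Longrightarrow> g \<in> h B D \<Longrightarrow> k \<in> h D E \<Longrightarrow>
      c (c k g) f = c k (c g f)"
  shows "category (struct_cat S h e c)"
proof
  fix f assume "f \<in> Arr (struct_cat S h e c)"
  then show "Dom (struct_cat S h e c) f \<in> Obj (struct_cat S h e c)" "Cod (struct_cat S h e c) f \<in> Obj (struct_cat S h e c)"
    by (cases f; simp)+
qed (use assms in \<open>auto simp: homs_struct_cat\<close>)

context category
begin

text \<open>Out of an initial object there is just one map to \<open>B\<close>, so the lifting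
  square commutes automatically and its lift is a lift of \<open>g\<close> along
  \<open>p\<close>.\<close>

lemma cofibrant_lift:
  assumes X: "cofibrant C N X" and N: "Cof N = llp C T"
    and p: "p \<in> T" "p \<in> homs C A B" and g: "g \<in> homs C X B"
  obtains k where "k \<in> homs C X A" "p \<cdot> k = g"
proof -
  obtain X0 f where init: "initial C X0" and f: "f \<in> homs C X0 X" and lift: "lifts_against C f p"
    using X p N by (auto simp: cofibrant_def llp_def)
  have hs: "A \<in> Obj C" "B \<in> Obj C" using homs_Obj[OF p(2)] by auto
  obtain u where u: "u \<in> homs C X0 A" using init hs by (auto simp: initial_def)
  have "p \<cdot> u \<in> homs C X0 B" "g \<cdot> f \<in> homs C X0 B" using u f p g Comp_homs by blast+
  then have "p \<cdot> u = g \<cdot> f" using init hs unfolding initial_def by blast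
  moreover have "u \<in> homs C (Dom C f) (Dom C p)" "g \<in> homs C (Cod C f) (Cod C p)"
    using u g f p(2) by (simp_all add: in_homs)
  ultimately obtain k where "k \<in> homs C (Cod C f) (Dom C p)" "p \<cdot> k = g"
    using lift unfolding lifts_against_def by blast
  then show thesis
    using f p(2) by (intro that) (simp_all add: in_homs)
qed

text \<open>Given an initial object, cofibrancy is projectivity with respect to \<open>T\<close>:
  the upper triangle of a lifting square commutes by initiality.\<close>

lemma cofibrantI:
  assumes init: "initial C X0" and X: "X \<in> Obj C" and N: "Cof N = llp C T" and T: "T \<subseteq> Arr C"
    and lift: "\<And>p g. p \<in> T \<Longrightarrow> g \<in> homs C X (Cod C p) \<Longrightarrow> \<exists>k \<in> homs C X (Dom C p). p \<cdot> k = g"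
  shows "cofibrant C N X"
proof -
  obtain f where f: "f \<in> homs C X0 X" using init X by (auto simp: initial_def)
  have "lifts_against C f p" if p: "p \<in> T" for p
    unfolding lifts_against_def
  proof (intro ballI impI)
    fix u g assume u: "u \<in> homs C (Dom C f) (Dom C p)" and g: "g \<in> homs C (Cod C f) (Cod C p)"
    have g': "g \<in> homs C X (Cod C p)" using g f by (simp add: in_homs)
    obtain k where k: "k \<in> homs C X (Dom C p)" "p \<cdot> k = g" using lift[OF p g'] by blast
    have "k \<cdot> f \<in> homs C X0 (Dom C p)" "u \<in> homs C X0 (Dom C p)"
      using f k(1) u Comp_homs by (auto simp: in_homs)
    then have "k \<cdot> f = u" using init homs_Obj[OF k(1)] unfolding initial_def by blast
    then show "\<exists>h \<in> homs C (Cod C f) (Dom C p). h \<cdot> f = u \<and> p \<cdot> h = g"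
      using k f by (auto simp: in_homs)
  qed
  then have "f \<in> Cof N" using f by (simp add: N llp_def in_homs)
  then show ?thesis using init f by (auto simp: cofibrant_def)
qed

end

lemma Cof_transferred:
  "Cof (transferred C u M) = llp C ({f \<in> Arr C. u f \<subseteq> Weq M} \<inter> {f \<in> Arr C. u f \<subseteq> Fib M})"
  by (simp add: transferred_def Let_def)

lemma TF_transferred:
  "Weq (transferred C u M) \<inter> Fib (transferred C u M) = {f \<in> Arr C. u f \<subseteq> Weq M} \<inter> {f \<in> Arr C. u f \<subseteq> Fib M}"
  by (simp add: transferred_def Let_def)

section \<open>Categories of enriched categories, monoids and modules, and their initial
  objects\<close>

context closed_symmetric_monoidal_category
begin

lemma category_VCat: "category (VCat V :: (('s, 'o, 'm) vcat, _) cat)"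
  unfolding VCat_def
proof (rule category_struct_cat, goal_cases)
  case (1 A)
  then have A: "is_vcat V A" by simp
  note [simp] = is_vcatD[OF A]
  show ?case by (simp add: vfunctors_def in_homs)
next
  case (2 A B D f g)
  then have A: "is_vcat V A" and B: "is_vcat V B" and D: "is_vcat V D" by simp_all
  note [simp] = is_vcatD[OF A] is_vcatD[OF B] is_vcatD[OF D] vfunctorsD(1-3)[OF 2(4)] vfunctorsD(1-3)[OF 2(5)]
  have "(g x z \<cdot> f x z) \<cdot> VComp A x y z = VComp D x y z \<cdot> ((g y z \<cdot> f y z) \<boxtimes> (g x y \<cdot> f x y))" for x y z
  proof -
    have "(g x z \<cdot> f x z) \<cdot> VComp A x y z = g x z \<cdot> (f x z \<cdot> VComp A x y z)" by simp
    also have "\<dots> = (g x z \<cdot> VComp B x y z) \<cdot> (f y z \<boxtimes> f x y)" by (simp add: vfunctorsD(4)[OF 2(4)])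
    also have "\<dots> = VComp D x y z \<cdot> ((g y z \<cdot> f y z) \<boxtimes> (g x y \<cdot> f x y))" by (simp add: vfunctorsD(4)[OF 2(5)])
    finally show ?thesis .
  qed
  moreover have "(g x x \<cdot> f x x) \<cdot> VUnit A x = VUnit D x" for x
    by (simp add: vfunctorsD(5)[OF 2(4)] vfunctorsD(5)[OF 2(5)])
  ultimately show ?case by (simp add: vfunctors_def in_homs)
next
  case (3 A B f)
  note [simp] = vfunctorsD(1-3)[OF 3(3)]
  show ?case by (intro ext) simp
next
  case (4 A B f)
  note [simp] = vfunctorsD(1-3)[OF 4(3)]
  show ?case by (intro ext) simp
next
  case (5 A B D E f g k)
  note [simp] = vfunctorsD(1-3)[OF 5(5)] vfunctorsD(1-3)[OF 5(6)] vfunctorsD(1-3)[OF 5(7)]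
  show ?case by (intro ext) simp
qed

lemma monoid_homsD:
  assumes "f \<in> monoid_homs V R S"
  shows "f \<in> Arr V" "Dom V f = MCar R" "Cod V f = MCar S"
    "f \<cdot> MMul R = MMul S \<cdot> (f \<boxtimes> f)" "f \<cdot> MOne R = MOne S"
  using assms by (simp_all add: monoid_homs_def in_homs)

lemma category_Mon: "category (Mon V)"
  unfolding Mon_def
proof (rule category_struct_cat, goal_cases)
  case (1 A)
  then have A: "is_monoid V A" by simp
  note [simp] = is_monoidD[OF A]
  show ?case by (simp add: monoid_homs_def in_homs)
next
  case (2 A B D f g)
  then have A: "is_monoid V A" and B: "is_monoid V B" and D: "is_monoid V D" by simp_all
  note [simp] = is_monoidD[OF A] is_monoidD[OF B] is_monoidD[OF D] monoid_homsD(1-3)[OF 2(4)] monoid_homsD(1-3)[OF 2(5)]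
  have "(g \<cdot> f) \<cdot> MMul A = (g \<cdot> MMul B) \<cdot> (f \<boxtimes> f)" by (simp add: monoid_homsD(4)[OF 2(4)])
  also have "\<dots> = MMul D \<cdot> ((g \<cdot> f) \<boxtimes> (g \<cdot> f))" by (simp add: monoid_homsD(4)[OF 2(5)])
  finally have "(g \<cdot> f) \<cdot> MMul A = MMul D \<cdot> ((g \<cdot> f) \<boxtimes> (g \<cdot> f))" .
  moreover have "(g \<cdot> f) \<cdot> MOne A = MOne D"
    by (simp add: monoid_homsD(5)[OF 2(4)] monoid_homsD(5)[OF 2(5)])
  ultimately show ?case by (simp add: monoid_homs_def in_homs)
next
  case (3 A B f)
  then show ?case using monoid_homsD(1-3)[OF 3(3)] by simp
next
  case (4 A B f)
  then show ?case using monoid_homsD(1-3)[OF 4(3)] by simp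
next
  case (5 A B D E f g k)
  then show ?case using monoid_homsD(1-3)[OF 5(5)] monoid_homsD(1-3)[OF 5(6)] monoid_homsD(1-3)[OF 5(7)] by simp
qed

lemma left_module_homs_Ident:
  "is_left_module V R X \<Longrightarrow> is_monoid V R \<Longrightarrow> \<iota> (Car X) \<in> left_module_homs V R X X"
  by (simp add: left_module_homs_def in_homs is_left_moduleD is_monoidD)

lemma category_LMod:
  assumes R: "is_monoid V R"
  shows "category (LMod V R)"
  unfolding LMod_def
proof (rule category_struct_cat, goal_cases)
  case (1 A)
  then show ?case using R by (auto intro: left_module_homs_Ident)
next
  case (2 A B D f g)
  then have A: "is_left_module V R A" and B: "is_left_module V R B" and D: "is_left_module V R D" by simp_all
  note [simp] = is_monoidD[OF R] is_left_moduleD[OF A] is_left_moduleD[OF B] is_left_moduleD[OF D]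
    left_module_homsD(1-3)[OF 2(4)] left_module_homsD(1-3)[OF 2(5)]
  have "(g \<cdot> f) \<cdot> Act A = (g \<cdot> Act B) \<cdot> (\<iota> (MCar R) \<boxtimes> f)" by (simp add: left_module_homsD(4)[OF 2(4)])
  also have "\<dots> = Act D \<cdot> (\<iota> (MCar R) \<boxtimes> (g \<cdot> f))" by (simp add: left_module_homsD(4)[OF 2(5)])
  finally show ?case by (simp add: left_module_homs_def in_homs)
next
  case (3 A B f)
  then show ?case using left_module_homsD(1-3)[OF 3(3)] by simp
next
  case (4 A B f)
  then show ?case using left_module_homsD(1-3)[OF 4(3)] by simp
next
  case (5 A B D E f g k)
  then show ?case using left_module_homsD(1-3)[OF 5(5)] left_module_homsD(1-3)[OF 5(6)] left_module_homsD(1-3)[OF 5(7)] by simp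
qed

lemma is_right_moduleD:
  assumes "is_right_module V R N"
  shows "Car N \<in> Obj V" "Act N \<in> Arr V" "Dom V (Act N) = Car N \<otimes> MCar R" "Cod V (Act N) = Car N"
    "Act N \<cdot> (Act N \<boxtimes> \<iota> (MCar R)) = Act N \<cdot> (\<iota> (Car N) \<boxtimes> MMul R) \<cdot> Assoc V (Car N) (MCar R) (MCar R)"
    "Act N \<cdot> (\<iota> (Car N) \<boxtimes> MOne R) = RUnit V (Car N)"
  using assms by (simp_all add: is_right_module_def in_homs)

lemma right_module_homsD:
  assumes "f \<in> right_module_homs V R N N'"
  shows "f \<in> Arr V" "Dom V f = Car N" "Cod V f = Car N'"
    "f \<cdot> Act N = Act N' \<cdot> (f \<boxtimes> \<iota> (MCar R))"
  using assms by (simp_all add: right_module_homs_def in_homs)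

lemma category_RMod:
  assumes R: "is_monoid V R"
  shows "category (RMod V R)"
  unfolding RMod_def
proof (rule category_struct_cat, goal_cases)
  case (1 A)
  then have A: "is_right_module V R A" by simp
  then show ?case using is_right_moduleD[OF A] is_monoidD[OF R] by (simp add: right_module_homs_def in_homs)
next
  case (2 A B D f g)
  then have A: "is_right_module V R A" and B: "is_right_module V R B" and D: "is_right_module V R D" by simp_all
  note [simp] = is_monoidD[OF R] is_right_moduleD(1-4)[OF A] is_right_moduleD(1-4)[OF B] is_right_moduleD(1-4)[OF D]
    right_module_homsD(1-3)[OF 2(4)] right_module_homsD(1-3)[OF 2(5)]
  have "(g \<cdot> f) \<cdot> Act A = (g \<cdot> Act B) \<cdot> (f \<boxtimes> \<iota> (MCar R))" by (simp add: right_module_homsD(4)[OF 2(4)])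
  also have "\<dots> = Act D \<cdot> ((g \<cdot> f) \<boxtimes> \<iota> (MCar R))" by (simp add: right_module_homsD(4)[OF 2(5)])
  finally show ?case by (simp add: right_module_homs_def in_homs)
next
  case (3 A B f)
  then show ?case using right_module_homsD(1-3)[OF 3(3)] by simp
next
  case (4 A B f)
  then show ?case using right_module_homsD(1-3)[OF 4(3)] by simp
next
  case (5 A B D E f g k)
  then show ?case using right_module_homsD(1-3)[OF 5(5)] right_module_homsD(1-3)[OF 5(6)] right_module_homsD(1-3)[OF 5(7)] by simp
qed

text \<open>The unit map of a monoid is a monoid map out of the unit object, and it is the only one
  because monoid maps preserve units.\<close>

lemma initial_Mon: "initial (Mon V) \<lparr>MCar = Unit V, MMul = LUnit V (Unit V), MOne = \<iota> (Unit V)\<rparr>"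
proof -
  let ?I = "Unit V" and ?U = "\<lparr>MCar = Unit V, MMul = LUnit V (Unit V), MOne = \<iota> (Unit V)\<rparr>"
  have "(\<iota> ?I \<boxtimes> RUnit V ?I) \<cdot> Assoc V ?I ?I ?I = RUnit V ?I \<boxtimes> \<iota> ?I"
    using triangle[of ?I ?I] by (simp add: LUnit_Unit)
  then have U: "is_monoid V ?U"
    by (simp add: is_monoid_def in_homs LUnit_Unit)
  have "\<exists>!f. f \<in> monoid_homs V ?U R" if R: "is_monoid V R" for R
  proof (rule ex1I[of _ "MOne R"])
    note [simp] = is_monoidD[OF R]
    have "MMul R \<cdot> (MOne R \<boxtimes> MOne R) = (MMul R \<cdot> (MOne R \<boxtimes> \<iota> (MCar R))) \<cdot> (\<iota> ?I \<boxtimes> MOne R)" by simp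
    also have "\<dots> = LUnit V (MCar R) \<cdot> (\<iota> ?I \<boxtimes> MOne R)" using R by (simp add: is_monoid_def)
    also have "\<dots> = MOne R \<cdot> LUnit V ?I" by (simp add: LUnit_nat')
    finally show "MOne R \<in> monoid_homs V ?U R" by (simp add: monoid_homs_def in_homs)
    show "f = MOne R" if "f \<in> monoid_homs V ?U R" for f
      using monoid_homsD[OF that] by simp
  qed
  then show ?thesis
    using U unfolding Mon_def by (intro initial_struct_cat) blast+
qed

lemma initial_eqI: "initial V X \<Longrightarrow> f \<in> homs V X Y \<Longrightarrow> g \<in> homs V X Y \<Longrightarrow> f = g"
  using homs_Obj unfolding initial_def by blast

text \<open>Tensoring with \<open>A\<close> on either side is a left adjoint and therefore preserves
  initial objects.\<close>

lemma initial_Tens: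
  assumes X: "initial V X" and A [simp]: "A \<in> Obj V"
  shows "initial V (A \<otimes> X)" "initial V (X \<otimes> A)"
proof -
  have Xo [simp]: "X \<in> Obj V" using X by (simp add: initial_def)
  have "\<exists>!f. f \<in> homs V (A \<otimes> X) Y" if Y: "Y \<in> Obj V" for Y
  proof -
    obtain E ev where E: "E \<in> Obj V" "ev \<in> homs V (A \<otimes> E) Y"
      and un: "\<And>Z f. Z \<in> Obj V \<Longrightarrow> f \<in> homs V (A \<otimes> Z) Y \<Longrightarrow> \<exists>!g. g \<in> homs V Z E \<and> ev \<cdot> (\<iota> A \<boxtimes> g) = f"
      using closed_left[OF A Y] by blast
    obtain x where x: "x \<in> homs V X E" using X E by (auto simp: initial_def)
    have "f = ev \<cdot> (\<iota> A \<boxtimes> x)" if f: "f \<in> homs V (A \<otimes> X) Y" for f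
    proof -
      obtain g where "g \<in> homs V X E" "ev \<cdot> (\<iota> A \<boxtimes> g) = f" using un[OF Xo f] by blast
      then show ?thesis using initial_eqI[OF X x] by blast
    qed
    moreover have "ev \<cdot> (\<iota> A \<boxtimes> x) \<in> homs V (A \<otimes> X) Y"
      using E x by (simp add: in_homs)
    ultimately show ?thesis by blast
  qed
  then show "initial V (A \<otimes> X)" by (simp add: initial_def)
  have "\<exists>!f. f \<in> homs V (X \<otimes> A) Y" if Y: "Y \<in> Obj V" for Y
  proof -
    obtain E ev where E: "E \<in> Obj V" "ev \<in> homs V (E \<otimes> A) Y"
      and un: "\<And>Z f. Z \<in> Obj V \<Longrightarrow> f \<in> homs V (Z \<otimes> A) Y \<Longrightarrow> \<exists>!g. g \<in> homs V Z E \<and> ev \<cdot> (g \<boxtimes> \<iota> A) = f"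
      using closed_right[OF A Y] by blast
    obtain x where x: "x \<in> homs V X E" using X E by (auto simp: initial_def)
    have "f = ev \<cdot> (x \<boxtimes> \<iota> A)" if f: "f \<in> homs V (X \<otimes> A) Y" for f
    proof -
      obtain g where "g \<in> homs V X E" "ev \<cdot> (g \<boxtimes> \<iota> A) = f" using un[OF Xo f] by blast
      then show ?thesis using initial_eqI[OF X x] by blast
    qed
    moreover have "ev \<cdot> (x \<boxtimes> \<iota> A) \<in> homs V (X \<otimes> A) Y"
      using E x by (simp add: in_homs)
    ultimately show ?thesis by blast
  qed
  then show "initial V (X \<otimes> A)" by (simp add: initial_def)
qed

text \<open>\<open>R \<otimes> X\<close> is again initial, so \<open>X\<close> carries one action;
  the module axioms and the linearity of maps out of \<open>X\<close> are equations between maps out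
  of initial objects.\<close>

lemma initial_LMod:
  assumes R: "is_monoid V R" and X: "initial V X"
  obtains N where "initial (LMod V R) N"
proof -
  note [simp] = is_monoidD[OF R]
  have Xo [simp]: "X \<in> Obj V" using X by (simp add: initial_def)
  note RX = initial_Tens(1)[OF X is_monoidD(1)[OF R]]
  obtain a where a: "a \<in> homs V (MCar R \<otimes> X) X" using RX Xo unfolding initial_def by blast
  note [simp] = a[unfolded in_homs]
  let ?N = "\<lparr>Car = X, Act = a\<rparr>"
  have "is_left_module V R ?N"
    unfolding is_left_module_def
  proof (intro conjI)
    show "Act ?N \<cdot> (MMul R \<boxtimes> \<iota> (Car ?N))
       = Act ?N \<cdot> (\<iota> (MCar R) \<boxtimes> Act ?N) \<cdot> Assoc V (MCar R) (MCar R) (Car ?N)"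
      by (rule initial_eqI[OF initial_Tens(1)[OF X, of "MCar R \<otimes> MCar R"], of _ X]) (simp_all add: in_homs)
    show "Act ?N \<cdot> (MOne R \<boxtimes> \<iota> (Car ?N)) = LUnit V (Car ?N)"
      by (rule initial_eqI[OF initial_Tens(1)[OF X, of "Unit V"], of _ X]) (simp_all add: in_homs)
  qed (simp_all add: in_homs)
  moreover have "\<exists>!f. f \<in> left_module_homs V R ?N Y" if Y: "is_left_module V R Y" for Y
  proof -
    note [simp] = is_left_moduleD[OF Y]
    obtain f where f: "f \<in> homs V X (Car Y)"
      using X is_left_moduleD(1)[OF Y] unfolding initial_def by blast
    note [simp] = f[unfolded in_homs]
    have "f \<cdot> a = Act Y \<cdot> (\<iota> (MCar R) \<boxtimes> f)"
      by (rule initial_eqI[OF RX, of _ "Car Y"]) (simp_all add: in_homs)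
    then have "f \<in> left_module_homs V R ?N Y" using f by (simp add: left_module_homs_def)
    moreover have "g = f" if "g \<in> left_module_homs V R ?N Y" for g
      using that initial_eqI[OF X _ f] by (simp add: left_module_homs_def)
    ultimately show ?thesis by blast
  qed
  ultimately have "initial (LMod V R) ?N"
    unfolding LMod_def by (intro initial_struct_cat) blast+
  then show thesis by (rule that)
qed

lemma initial_RMod:
  assumes R: "is_monoid V R" and X: "initial V X"
  obtains N where "initial (RMod V R) N"
proof -
  note [simp] = is_monoidD[OF R]
  have Xo [simp]: "X \<in> Obj V" using X by (simp add: initial_def)
  note XR = initial_Tens(2)[OF X is_monoidD(1)[OF R]]
  obtain a where a: "a \<in> homs V (X \<otimes> MCar R) X" using XR Xo unfolding initial_def by blast
  note [simp] = a[unfolded in_homs]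
  let ?N = "\<lparr>Car = X, Act = a\<rparr>"
  have "is_right_module V R ?N"
    unfolding is_right_module_def
  proof (intro conjI)
    show "Act ?N \<cdot> (Act ?N \<boxtimes> \<iota> (MCar R))
       = Act ?N \<cdot> (\<iota> (Car ?N) \<boxtimes> MMul R) \<cdot> Assoc V (Car ?N) (MCar R) (MCar R)"
      by (rule initial_eqI[OF initial_Tens(2)[OF XR is_monoidD(1)[OF R]], of _ X]) (simp_all add: in_homs)
    show "Act ?N \<cdot> (\<iota> (Car ?N) \<boxtimes> MOne R) = RUnit V (Car ?N)"
      by (rule initial_eqI[OF initial_Tens(2)[OF X, of "Unit V"], of _ X]) (simp_all add: in_homs)
  qed (simp_all add: in_homs)
  moreover have "\<exists>!f. f \<in> right_module_homs V R ?N Y" if Y: "is_right_module V R Y" for Y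
  proof -
    note [simp] = is_right_moduleD(1-4)[OF Y]
    obtain f where f: "f \<in> homs V X (Car Y)"
      using X is_right_moduleD(1)[OF Y] unfolding initial_def by blast
    note [simp] = f[unfolded in_homs]
    have "f \<cdot> a = Act Y \<cdot> (f \<boxtimes> \<iota> (MCar R))"
      by (rule initial_eqI[OF XR, of _ "Car Y"]) (simp_all add: in_homs)
    then have "f \<in> right_module_homs V R ?N Y" using f by (simp add: right_module_homs_def)
    moreover have "g = f" if "g \<in> right_module_homs V R ?N Y" for g
      using that initial_eqI[OF X _ f] by (simp add: right_module_homs_def)
    ultimately show ?thesis by blast
  qed
  ultimately have "initial (RMod V R) ?N"
    unfolding RMod_def by (intro initial_struct_cat) blast+
  then show thesis by (rule that)
qed

lemma family_homs_Comp:
  assumes N: "is_family V b R N" and N': "is_family V b R' N'" and N'': "is_family V b R'' N''"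
    and f: "f \<in> family_homs V b R N R' N'" and g: "g \<in> family_homs V b R' N' R'' N''"
  shows "(\<lambda>x. g x \<cdot> f x) \<in> family_homs V b R N R'' N''"
proof -
  have R: "is_monoid V R" "is_monoid V R'" "is_monoid V R''"
    and L: "is_left_module V R (N x)" "is_left_module V R' (N' x)" "is_left_module V R'' (N'' x)"
    and reg: "N b = regular R" "N' b = regular R'" "N'' b = regular R''" for x
    using N N' N'' by (simp_all add: is_family_def)
  have b [simp]: "Car (N b) = MCar R" "Car (N' b) = MCar R'" "Car (N'' b) = MCar R''"
    by (simp_all add: reg regular_def)
  note [simp] = is_monoidD[OF R(1)] is_monoidD[OF R(2)] is_monoidD[OF R(3)]
    is_left_moduleD[OF L(1)] is_left_moduleD[OF L(2)] is_left_moduleD[OF L(3)]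
    family_homsD(1-3)[OF f] family_homsD(1-3)[OF g]
  have "(g x \<cdot> f x) \<cdot> Act (N x) = Act (N'' x) \<cdot> ((g b \<cdot> f b) \<boxtimes> (g x \<cdot> f x))" for x
  proof -
    have "(g x \<cdot> f x) \<cdot> Act (N x) = (g x \<cdot> Act (N' x)) \<cdot> (f b \<boxtimes> f x)"
      by (simp add: family_homsD(4)[OF f])
    also have "\<dots> = Act (N'' x) \<cdot> ((g b \<cdot> f b) \<boxtimes> (g x \<cdot> f x))"
      by (simp add: family_homsD(4)[OF g])
    finally show ?thesis .
  qed
  moreover have "(g b \<cdot> f b) \<cdot> MOne R = MOne R''"
    by (simp add: family_homsD(5)[OF f] family_homsD(5)[OF g])
  ultimately show ?thesis by (simp add: family_homs_def in_homs)
qed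

end

section \<open>Cofibrant replacement of families of modules\<close>

context monoidal_model
begin

text \<open>Cofibrancy as a lifting property, with monoid and modules lifted together:
  \<open>p\<close> may change the monoid. Stated without algebras, it is evidently inherited by
  retracts.\<close>

definition cofibrant_family :: "'s \<Rightarrow> ('o, 'm) mon \<Rightarrow> ('s \<Rightarrow> ('o, 'm) module) \<Rightarrow> bool" where
  "cofibrant_family b A L \<longleftrightarrow> is_family V b A L \<and>
     (\<forall>C X B Y p g. is_family V b C X \<longrightarrow> is_family V b B Y \<longrightarrow> p \<in> family_homs V b C X B Y \<longrightarrow> (\<forall>x. p x \<in> TF) \<longrightarrow>
        g \<in> family_homs V b A L B Y \<longrightarrow> (\<exists>h \<in> family_homs V b A L C X. \<forall>x. p x \<cdot> h x = g x))"

text \<open>The replacement is made among algebras, and its lifting property is tested on algebras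
  of families, where maps of algebras and maps of families correspond.\<close>

lemma family_replacement:
  assumes adequate: "adequate TYPE('u) V M" and ct: "\<exists>g :: 's \<Rightarrow> nat. inj g"
    and N: "is_family V (b :: 's) R N"
  obtains A L e where "cofibrant_family b A L" "e \<in> family_homs V b A L R N" "\<And>x. e x \<in> TF"
proof -
  obtain c :: "nat \<Rightarrow> 'u" where c: "inj c" using universe_code[OF univ] by blast
  obtain gs :: "'s \<Rightarrow> nat" where gs: "inj gs" using ct by blast
  define col where "col = c \<circ> gs"
  \<comment> \<open>Lists over the countable type \<open>'s\<close> are first numbered and then
    placed in the infinite type \<open>'u\<close>.\<close>
  define opn where "opn = c \<circ> to_nat \<circ> (\<lambda>(cs, t). (map gs cs, gs t))"
  have col: "inj col" unfolding col_def by (rule inj_compose[OF c gs])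
  have "inj (\<lambda>(cs, t). (map gs cs, gs t))" using gs by (auto simp: inj_def inj_map_eq_map)
  then have opn: "inj opn" unfolding opn_def by (intro inj_compose c inj_to_nat)
  interpret path_algebras V col opn b
    using col opn by unfold_locales
  have model_Alg: "model_category TYPE('u) (Alg V P) (Alg_model V M P)"
    using adequate small_path_operad[OF univ ct] by (simp add: adequate_def)
  then interpret Alg: category "Alg V P" by (simp add: model_category_def)
  let ?ZN = "family_algebra R N"
  have Z0: "is_algebra V P ?ZN" by (rule is_algebra_family_algebra[OF N])
  have Obj_Alg: "Z \<in> Obj (Alg V P) \<longleftrightarrow> is_algebra V P Z" for Z by (simp add: Alg_def)
  obtain E where E: "initial (Alg V P) E"
    using cocomplete_initial[OF univ, of "Alg V P"] model_Alg by (auto simp: model_category_def)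
  have "?ZN \<in> Obj (Alg V P)" using Z0 by (simp add: Obj_Alg)
  then obtain F where F: "F \<in> homs (Alg V P) E ?ZN" using E unfolding initial_def by blast
  let ?M = "Alg_model V M P"
  \<comment> \<open>The middle object of this factorization is cofibrant, since \<open>i\<close> is
    a cofibration out of the initial algebra, and \<open>q\<close> is a trivial fibration onto the
    given family.\<close>
  obtain i q where i: "i \<in> Cof ?M" and q: "q \<in> Fib ?M \<inter> Weq ?M"
    and iq: "Dom (Alg V P) q = Cod (Alg V P) i" "F = q \<cdot>\<^bsub>Alg V P\<^esub> i"
    using model_Alg F unfolding model_category_def Alg.in_homs by blast
  let ?Z = "Cod (Alg V P) i"
  have arr: "i \<in> Arr (Alg V P)" "q \<in> Arr (Alg V P)" using i q model_Alg by (auto simp: model_category_def)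
  have F': "Dom (Alg V P) F = Dom (Alg V P) i" "Cod (Alg V P) F = Cod (Alg V P) q"
    using Alg.Comp_arr(2,3)[OF arr iq(1)] by (simp_all only: iq(2))
  have i': "i \<in> homs (Alg V P) E ?Z"
    using F arr(1) unfolding Alg.in_homs F' by blast
  have q': "q \<in> homs (Alg V P) ?Z ?ZN"
    using F arr(2) iq(1) unfolding Alg.in_homs F' by blast
  have cof: "cofibrant (Alg V P) ?M ?Z"
    using E i' i unfolding cofibrant_def by blast
  define Z where "Z = ?Z"
  have Z: "is_algebra V P Z" using Alg.homs_Obj[OF i'] by (simp add: Obj_Alg Z_def)
  obtain f where f: "f \<in> algebra_homs V P Z ?ZN" "q = (Z, ?ZN, f)"
    using q' by (auto simp: Alg_def homs_struct_cat Z_def)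
  define e where "e s = f (col s)" for s
  have e: "e \<in> family_homs V b (algebra_monoid Z) (algebra_module Z) R N"
    using family_hom_of_algebra_hom[OF Z Z0 f(1)]
    by (simp only: algebra_monoid_family_algebra[OF N] algebra_module_family_algebra[OF N] e_def[abs_def])
  let ?T = "{f \<in> Arr (Alg V P). (\<lambda>(A, B, f). f ` Colours P) f \<subseteq> Weq M} \<inter>
      {f \<in> Arr (Alg V P). (\<lambda>(A, B, f). f ` Colours P) f \<subseteq> Fib M}"
  have e_TF: "e s \<in> TF" for s
  proof -
    have "q \<in> ?T"
      using q TF_transferred[of "Alg V P" "\<lambda>(A, B, f). f ` Colours P" M] unfolding Alg_model_def by blast
    then have "(Z, ?ZN, f) \<in> ?T" by (simp only: f(2))
    then have "f ` range col \<subseteq> Weq M" "f ` range col \<subseteq> Fib M" by simp_all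
    then show ?thesis unfolding e_def by blast
  qed
  have "\<exists>h \<in> family_homs V b (algebra_monoid Z) (algebra_module Z) C X. \<forall>x. p x \<cdot> h x = g x"
    if X: "is_family V b C X" and Y: "is_family V b B Y" and p: "p \<in> family_homs V b C X B Y" "\<forall>x. p x \<in> TF"
      and g: "g \<in> family_homs V b (algebra_monoid Z) (algebra_module Z) B Y" for C X B Y p g
  proof -
    note ZX = is_algebra_family_algebra[OF X] and ZY = is_algebra_family_algebra[OF Y]
    let ?r = "\<lambda>p. \<lambda>c \<in> range col. p (inv col c)"
    have p': "?r p \<in> algebra_homs V P (family_algebra C X) (family_algebra B Y)"
      by (rule algebra_hom_of_family_hom[OF ZX ZY])
        (simp only: algebra_monoid_family_algebra[OF X] algebra_module_family_algebra[OF X]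
          algebra_monoid_family_algebra[OF Y] algebra_module_family_algebra[OF Y] p)
    have g': "?r g \<in> algebra_homs V P Z (family_algebra B Y)"
      by (rule algebra_hom_of_family_hom[OF Z ZY])
        (simp only: algebra_monoid_family_algebra[OF Y] algebra_module_family_algebra[OF Y] g)
    have pT: "(family_algebra C X, family_algebra B Y, ?r p) \<in> ?T"
      using ZX ZY p' p(2) by (auto simp: Alg_def)
    have ph: "(family_algebra C X, family_algebra B Y, ?r p) \<in> homs (Alg V P) (family_algebra C X) (family_algebra B Y)"
      using ZX ZY p' by (simp add: Alg_def homs_struct_cat)
    have gh: "(Z, family_algebra B Y, ?r g) \<in> homs (Alg V P) Z (family_algebra B Y)"
      using Z ZY g' by (simp add: Alg_def homs_struct_cat)
    obtain k where k: "k \<in> homs (Alg V P) Z (family_algebra C X)"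
      "(family_algebra C X, family_algebra B Y, ?r p) \<cdot>\<^bsub>Alg V P\<^esub> k = (Z, family_algebra B Y, ?r g)"
      using Alg.cofibrant_lift[OF cof[folded Z_def] Cof_transferred[of "Alg V P" "\<lambda>(A, B, f). f ` Colours P" M, folded Alg_model_def] pT ph gh]
      by blast
    obtain h where h: "h \<in> algebra_homs V P Z (family_algebra C X)" "k = (Z, family_algebra C X, h)"
      using k(1) by (auto simp: Alg_def homs_struct_cat)
    have "(\<lambda>c \<in> Colours P. ?r p c \<cdot> h c) = ?r g"
      using k(2) by (simp add: h(2) Alg_def)
    then have "(\<lambda>c \<in> Colours P. ?r p c \<cdot> h c) (col s) = ?r g (col s)" for s by (rule fun_cong)
    then have "p s \<cdot> h (col s) = g s" for s
      by (simp add: inv_f_f[OF col])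
    moreover have "(\<lambda>s. h (col s)) \<in> family_homs V b (algebra_monoid Z) (algebra_module Z) C X"
      using family_hom_of_algebra_hom[OF Z ZX h(1)]
      by (simp only: algebra_monoid_family_algebra[OF X] algebra_module_family_algebra[OF X])
    ultimately show ?thesis by (intro bexI[of _ "\<lambda>s. h (col s)"]) auto
  qed
  then have "cofibrant_family b (algebra_monoid Z) (algebra_module Z)"
    using algebra_family[OF Z] unfolding cofibrant_family_def by blast
  then show thesis using e e_TF by (rule that)
qed

lemma family_b:
  assumes "is_family V b R N"
  shows "Car (N b) = MCar R" "Act (N b) = MMul R"
  using assms by (simp_all add: is_family_def regular_def)

text \<open>A lifting problem of modules becomes one of families when \<open>L x\<close> is replaced
  by \<open>Z\<close> and \<open>W\<close> and all other components are identities. As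
  \<open>x\<close> differs from \<open>b\<close>, the monoid is kept; the lift is then the identity
  at \<open>b\<close>, and so its component at \<open>x\<close> is linear over \<open>A\<close>
  itself.\<close>

lemma cofibrant_module_of_family:
  assumes L: "cofibrant_family b A L" and x: "x \<noteq> b"
  shows "cofibrant_module A (L x)"
  unfolding cofibrant_module_def
proof (intro allI impI)
  fix Z W r l assume Z: "is_left_module V A Z" and W: "is_left_module V A W"
    and r: "r \<in> left_module_homs V A Z W" "r \<in> TF" and l: "l \<in> left_module_homs V A (L x) W"
  have fam: "is_family V b A L" using L by (simp add: cofibrant_family_def)
  have A: "is_monoid V A" and Ly: "is_left_module V A (L y)" for y using fam by (simp_all add: is_family_def)
  note [simp] = is_monoidD[OF A] is_left_moduleD[OF Ly] is_left_moduleD[OF Z] is_left_moduleD[OF W]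
    left_module_homsD(1-3)[OF r(1)] left_module_homsD(1-3)[OF l] family_b[OF fam]
  have fX: "is_family V b A (L(x := Z))" and fY: "is_family V b A (L(x := W))"
    using fam Z W x by (simp_all add: is_family_def)
  have "(\<lambda>y. if y = x then r else \<iota> (Car (L y))) \<in> family_homs V b A (L(x := Z)) A (L(x := W))"
    using x left_module_homsD(4)[OF r(1)] by (auto simp: family_homs_def in_homs)
  moreover have "\<forall>y. (if y = x then r else \<iota> (Car (L y))) \<in> TF" using r(2) TF_Ident by auto
  moreover have "(\<lambda>y. if y = x then l else \<iota> (Car (L y))) \<in> family_homs V b A L A (L(x := W))"
    using x left_module_homsD(4)[OF l] by (auto simp: family_homs_def in_homs)
  ultimately obtain h where h: "h \<in> family_homs V b A L A (L(x := Z))"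
    "\<forall>y. (if y = x then r else \<iota> (Car (L y))) \<cdot> h y = (if y = x then l else \<iota> (Car (L y)))"
    using L fX fY unfolding cofibrant_family_def by blast
  have "h b \<in> Arr V" "Cod V (h b) = MCar A"
    using family_homsD(1,3)[OF h(1), of b] x by simp_all
  then have hb: "h b = \<iota> (MCar A)" using h(2)[rule_format, of b] x by simp
  have "h x \<in> left_module_homs V A (L x) Z"
    using family_homsD(1-4)[OF h(1), of x] hb by (simp add: left_module_homs_def in_homs)
  moreover have "r \<cdot> h x = l" using h(2)[rule_format, of x] by simp
  ultimately show "\<exists>l' \<in> left_module_homs V A (L x) Z. r \<cdot> l' = l" by blast
qed

text \<open>The regular module is free on the unit object: a lift is the same as a lift of the image
  of the unit, and this exists because the unit object is cofibrant.\<close>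

lemma cofibrant_regular:
  assumes I: "cofibrant V M (Unit V)" and R: "is_monoid V R"
  shows "cofibrant_module R (regular R)"
  unfolding cofibrant_module_def
proof (intro allI impI)
  let ?R = "MCar R" and ?I = "Unit V"
  fix Z W r l assume Z: "is_left_module V R Z" and W: "is_left_module V R W"
    and r: "r \<in> left_module_homs V R Z W" "r \<in> TF" and l: "l \<in> left_module_homs V R (regular R) W"
  have reg: "Car (regular R) = ?R" "Act (regular R) = MMul R" by (simp_all add: regular_def)
  note [simp] = is_monoidD[OF R] is_left_moduleD[OF Z] is_left_moduleD[OF W]
    left_module_homsD(1-3)[OF r(1)] left_module_homsD(1-3)[OF l, unfolded reg]
  obtain X0 j where j: "initial V X0" "j \<in> homs V X0 ?I" "j \<in> Cof M"
    using I by (auto simp: cofibrant_def)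
  note [simp] = j(2)[unfolded in_homs]
  obtain u where u: "u \<in> homs V X0 (Car Z)" using j(1) is_left_moduleD(1)[OF Z] unfolding initial_def by blast
  note [simp] = u[unfolded in_homs]
  have "r \<cdot> u = (l \<cdot> MOne R) \<cdot> j"
    by (rule initial_eqI[OF j(1), of _ "Car W"]) (simp_all add: in_homs)
  then obtain z where z: "z \<in> homs V ?I (Car Z)" "r \<cdot> z = l \<cdot> MOne R"
    by (rule TF_lift[OF j(3) r(2), of u "l \<cdot> MOne R", rotated 2]) (simp_all add: in_homs)
  note [simp] = z(1)[unfolded in_homs]
  \<comment> \<open>The linear extension of the element \<open>z\<close>: a scalar is sent to its
    action on \<open>z\<close>.\<close>
  define k where "k = Act Z \<cdot> (\<iota> ?R \<boxtimes> z) \<cdot> inverse_arr (RUnit V ?R)"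
  have [simp]: "k \<in> Arr V" "Dom V k = ?R" "Cod V k = Car Z" by (simp_all add: k_def)
  have kR: "k \<cdot> RUnit V ?R = Act Z \<cdot> (\<iota> ?R \<boxtimes> z)" by (simp add: k_def)
  have "k \<cdot> MMul R = Act Z \<cdot> (\<iota> ?R \<boxtimes> k)"
  proof (rule iso_epi)
    have "(k \<cdot> MMul R) \<cdot> RUnit V (?R \<otimes> ?R) = (k \<cdot> RUnit V ?R) \<cdot> (MMul R \<boxtimes> \<iota> ?I)"
      by (simp add: RUnit_nat')
    also have "\<dots> = (Act Z \<cdot> (MMul R \<boxtimes> \<iota> (Car Z))) \<cdot> (\<iota> (?R \<otimes> ?R) \<boxtimes> z)" by (simp only: kR) simp
    also have "\<dots> = Act Z \<cdot> (\<iota> ?R \<boxtimes> Act Z) \<cdot> (Assoc V ?R ?R (Car Z) \<cdot> ((\<iota> ?R \<boxtimes> \<iota> ?R) \<boxtimes> z))"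
      by (simp add: left_module_assoc[OF Z])
    also have "\<dots> = Act Z \<cdot> (\<iota> ?R \<boxtimes> (Act Z \<cdot> (\<iota> ?R \<boxtimes> z))) \<cdot> Assoc V ?R ?R ?I"
      by (subst Assoc_nat') auto
    also have "\<dots> = Act Z \<cdot> (\<iota> ?R \<boxtimes> k) \<cdot> ((\<iota> ?R \<boxtimes> RUnit V ?R) \<cdot> Assoc V ?R ?R ?I)"
      by (simp only: kR[symmetric]) simp
    also have "\<dots> = (Act Z \<cdot> (\<iota> ?R \<boxtimes> k)) \<cdot> RUnit V (?R \<otimes> ?R)"
      by (simp add: RUnit_Tens)
    finally show "(k \<cdot> MMul R) \<cdot> RUnit V (?R \<otimes> ?R) = \<dots>" .
  qed simp_all
  then have k_hom: "k \<in> left_module_homs V R (regular R) Z"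
    by (simp add: left_module_homs_def in_homs reg)
  have "r \<cdot> k = l"
  proof (rule iso_epi)
    have "(r \<cdot> k) \<cdot> RUnit V ?R = r \<cdot> (k \<cdot> RUnit V ?R)" by simp
    also have "\<dots> = (r \<cdot> Act Z) \<cdot> (\<iota> ?R \<boxtimes> z)" by (simp only: kR) simp
    also have "\<dots> = Act W \<cdot> (\<iota> ?R \<boxtimes> (l \<cdot> MOne R))" by (simp add: left_module_homsD(4)[OF r(1)] z(2))
    also have "\<dots> = (l \<cdot> MMul R) \<cdot> (\<iota> ?R \<boxtimes> MOne R)" by (simp add: left_module_homsD(4)[OF l, unfolded reg])
    also have "\<dots> = l \<cdot> RUnit V ?R" using R by (simp add: is_monoid_def)
    finally show "(r \<cdot> k) \<cdot> RUnit V ?R = l \<cdot> RUnit V ?R" .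
  qed simp_all
  then show "\<exists>l' \<in> left_module_homs V R (regular R) Z. r \<cdot> l' = l" using k_hom by blast
qed

text \<open>The family of hom-objects into \<open>b\<close> is a retract of its cofibrant replacement.\<close>

lemma cofibrant_hom_family:
  assumes adequate: "adequate TYPE('u) V M" and I: "cofibrant V M (Unit V)"
    and ct: "\<exists>g :: 's \<Rightarrow> nat. inj g"
    and H: "is_vcat V (H :: ('s, 'o, 'm) vcat)" "has_sections H"
  shows "cofibrant_family b (endo_monoid H b) (\<lambda>x. hom_left_module H x b)"
proof -
  let ?R = "endo_monoid H b" and ?N = "\<lambda>x. hom_left_module H x b"
  have N: "is_family V b ?R ?N" by (rule hom_family[OF H(1)])
  obtain A L e where L: "cofibrant_family b A L" and e: "e \<in> family_homs V b A L ?R ?N" "\<And>x. e x \<in> TF"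
    using family_replacement[OF adequate ct N] by blast
  have L': "is_family V b A L" using L by (simp add: cofibrant_family_def)
  have "cofibrant_module A (L x)" for x
  proof (cases "x = b")
    case True
    then show ?thesis using cofibrant_regular[OF I, of A] L' by (simp add: is_family_def)
  qed (rule cofibrant_module_of_family[OF L])
  then obtain t where t: "t \<in> family_homs V b ?R ?N A L" "\<And>x. e x \<cdot> t x = \<iota> (Hom H x b)"
    using family_section[OF H L' _ e] by blast
  have "\<exists>h \<in> family_homs V b ?R ?N C X. \<forall>x. p x \<cdot> h x = g x"
    if X: "is_family V b C X" and Y: "is_family V b B Y" and p: "p \<in> family_homs V b C X B Y" "\<forall>x. p x \<in> TF"
      and g: "g \<in> family_homs V b ?R ?N B Y" for C X B Y p g
  proof -
    \<comment> \<open>The retract argument: \<open>g\<close> composed with \<open>e\<close> lifts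
      out of the cofibrant family \<open>L\<close>, and precomposing that lift with the section
      \<open>t\<close> solves the original problem.\<close>
    obtain k where k: "k \<in> family_homs V b A L C X" "\<forall>x. p x \<cdot> k x = g x \<cdot> e x"
      using L X Y p family_homs_Comp[OF L' N Y e(1) g] unfolding cofibrant_family_def by blast
    have "p x \<cdot> (k x \<cdot> t x) = g x" for x
    proof -
      note [simp] = family_homsD(1-3)[OF k(1)] family_homsD(1-3)[OF t(1)] family_homsD(1-3)[OF p(1)]
        family_homsD(1-3)[OF g] family_homsD(1-3)[OF e(1)]
      have "p x \<cdot> (k x \<cdot> t x) = (p x \<cdot> k x) \<cdot> t x" by simp
      also have "\<dots> = g x \<cdot> (e x \<cdot> t x)" by (simp only: k(2)) simp
      also have "\<dots> = g x" using family_homsD(2)[OF g, of x] by (simp only: t(2)) (simp add: hom_left_module_def)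
      finally show ?thesis .
    qed
    then show ?thesis
      by (intro bexI[OF _ family_homs_Comp[OF N L' X t(1) k(1)]] allI)
  qed
  then show ?thesis using N unfolding cofibrant_family_def by blast
qed

end

section \<open>The opposite enriched category\<close>

definition op_vcat :: "('o, 'm) smcat \<Rightarrow> ('s, 'o, 'm) vcat \<Rightarrow> ('s, 'o, 'm) vcat" where
  "op_vcat V H = \<lparr>Hom = (\<lambda>x y. Hom H y x),
     VComp = (\<lambda>x y z. VComp H z y x \<cdot>\<^bsub>V\<^esub> Braid V (Hom H z y) (Hom H y x)),
     VUnit = VUnit H\<rparr>"

definition op_monoid :: "('o, 'm) smcat \<Rightarrow> ('o, 'm) mon \<Rightarrow> ('o, 'm) mon" where
  "op_monoid V R = R\<lparr>MMul := MMul R \<cdot>\<^bsub>V\<^esub> Braid V (MCar R) (MCar R)\<rparr>"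

definition op_module :: "('o, 'm) smcat \<Rightarrow> ('o, 'm) mon \<Rightarrow> ('o, 'm) module \<Rightarrow> ('o, 'm) module" where
  "op_module V R N = N\<lparr>Act := Act N \<cdot>\<^bsub>V\<^esub> Braid V (MCar R) (Car N)\<rparr>"

context closed_symmetric_monoidal_category
begin

text \<open>Both sides of the associativity square are compared after reversing the triple tensor product,
  which can be done in two ways by the hexagon.\<close>

lemma op_assoc:
  assumes obs [simp]: "X \<in> Obj V" "Y \<in> Obj V" "Z \<in> Obj V" "P \<in> Obj V" "Q \<in> Obj V" "W \<in> Obj V"
    and a: "a \<in> homs V (X \<otimes> Y) P" and g: "g \<in> homs V (P \<otimes> Z) Q"
    and c: "c \<in> homs V (Y \<otimes> Z) W" and d: "d \<in> homs V (X \<otimes> W) Q"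
    and eq: "g \<cdot> (a \<boxtimes> \<iota> Z) = d \<cdot> (\<iota> X \<boxtimes> c) \<cdot> Assoc V X Y Z"
  shows "(d \<cdot> Braid V W X) \<cdot> ((c \<cdot> Braid V Z Y) \<boxtimes> \<iota> X)
    = (g \<cdot> Braid V Z P) \<cdot> (\<iota> Z \<boxtimes> (a \<cdot> Braid V Y X)) \<cdot> Assoc V Z Y X"
proof -
  note [simp] = a[unfolded in_homs] g[unfolded in_homs] c[unfolded in_homs] d[unfolded in_homs]
  let ?B = "Braid V" and ?A = "Assoc V"
  \<comment> \<open>The hexagon for X, Y, Z with every braiding inverted, which by symmetry replaces
    it by the braiding in the opposite order.\<close>
  have hex: "(?A X Y Z \<cdot> (?B Y X \<boxtimes> \<iota> Z)) \<cdot> (inverse_arr (?A Y X Z) \<cdot> (\<iota> Y \<boxtimes> ?B Z X) \<cdot> ?A Y Z X) = ?B (Y \<otimes> Z) X"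
  proof (rule iso_epi[where f = "?B X (Y \<otimes> Z) \<cdot> ?A X Y Z"])
    have "((?A X Y Z \<cdot> (?B Y X \<boxtimes> \<iota> Z)) \<cdot> (inverse_arr (?A Y X Z) \<cdot> (\<iota> Y \<boxtimes> ?B Z X) \<cdot> ?A Y Z X)) \<cdot> (?B X (Y \<otimes> Z) \<cdot> ?A X Y Z)
      = ?A X Y Z \<cdot> (?B Y X \<boxtimes> \<iota> Z) \<cdot> inverse_arr (?A Y X Z) \<cdot> (\<iota> Y \<boxtimes> ?B Z X) \<cdot> (?A Y Z X \<cdot> ?B X (Y \<otimes> Z) \<cdot> ?A X Y Z)"
      by simp
    also have "\<dots> = ?A X Y Z \<cdot> (?B Y X \<boxtimes> \<iota> Z) \<cdot> inverse_arr (?A Y X Z) \<cdot> (\<iota> Y \<boxtimes> ?B Z X) \<cdot>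
        ((\<iota> Y \<boxtimes> ?B X Z) \<cdot> ?A Y X Z \<cdot> (?B X Y \<boxtimes> \<iota> Z))"
      by (simp only: hexagon obs)
    also have "\<dots> = ?A X Y Z" by (simp add: symmetry)
    also have "\<dots> = ?B (Y \<otimes> Z) X \<cdot> (?B X (Y \<otimes> Z) \<cdot> ?A X Y Z)"
      by (simp add: Comp_cong_left[OF symmetry])
    finally show "((?A X Y Z \<cdot> (?B Y X \<boxtimes> \<iota> Z)) \<cdot> (inverse_arr (?A Y X Z) \<cdot> (\<iota> Y \<boxtimes> ?B Z X) \<cdot> ?A Y Z X)) \<cdot> (?B X (Y \<otimes> Z) \<cdot> ?A X Y Z) = \<dots>" .
  qed (simp_all add: iso_Comp)
  have "(g \<cdot> ?B Z P) \<cdot> (\<iota> Z \<boxtimes> (a \<cdot> ?B Y X)) \<cdot> ?A Z Y X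
      = g \<cdot> (?B Z P \<cdot> (\<iota> Z \<boxtimes> (a \<cdot> ?B Y X))) \<cdot> ?A Z Y X" by simp
  also have "\<dots> = (g \<cdot> (a \<boxtimes> \<iota> Z)) \<cdot> (?B Y X \<boxtimes> \<iota> Z) \<cdot> ?B Z (Y \<otimes> X) \<cdot> ?A Z Y X"
    by (simp add: Braid_nat')
  also have "\<dots> = d \<cdot> (\<iota> X \<boxtimes> c) \<cdot> ?A X Y Z \<cdot> (?B Y X \<boxtimes> \<iota> Z) \<cdot> inverse_arr (?A Y X Z) \<cdot>
      (?A Y X Z \<cdot> ?B Z (Y \<otimes> X) \<cdot> ?A Z Y X)"
    by (simp only: eq) simp
  also have "\<dots> = d \<cdot> (\<iota> X \<boxtimes> c) \<cdot> ?A X Y Z \<cdot> (?B Y X \<boxtimes> \<iota> Z) \<cdot> inverse_arr (?A Y X Z) \<cdot>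
      ((\<iota> Y \<boxtimes> ?B Z X) \<cdot> ?A Y Z X \<cdot> (?B Z Y \<boxtimes> \<iota> X))"
    by (simp only: hexagon obs)
  also have "\<dots> = d \<cdot> (\<iota> X \<boxtimes> c) \<cdot> ((?A X Y Z \<cdot> (?B Y X \<boxtimes> \<iota> Z)) \<cdot>
      (inverse_arr (?A Y X Z) \<cdot> (\<iota> Y \<boxtimes> ?B Z X) \<cdot> ?A Y Z X)) \<cdot> (?B Z Y \<boxtimes> \<iota> X)"
    by simp
  also have "\<dots> = d \<cdot> ((\<iota> X \<boxtimes> c) \<cdot> ?B (Y \<otimes> Z) X) \<cdot> (?B Z Y \<boxtimes> \<iota> X)"
    by (simp only: hex) simp
  also have "\<dots> = d \<cdot> (?B W X \<cdot> (c \<boxtimes> \<iota> X)) \<cdot> (?B Z Y \<boxtimes> \<iota> X)"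
    by (simp add: Braid_nat')
  also have "\<dots> = (d \<cdot> ?B W X) \<cdot> ((c \<cdot> ?B Z Y) \<boxtimes> \<iota> X)" by simp
  finally show ?thesis by simp
qed

lemma op_left_unit:
  assumes u: "u \<in> homs V (Unit V) R" and a: "a \<in> homs V (X \<otimes> R) Y" and X: "X \<in> Obj V"
    and eq: "a \<cdot> (\<iota> X \<boxtimes> u) = RUnit V X"
  shows "(a \<cdot> Braid V R X) \<cdot> (u \<boxtimes> \<iota> X) = LUnit V X"
proof -
  have [simp]: "R \<in> Obj V" "X \<in> Obj V" using homs_Obj[OF u] X by auto
  note [simp] = u[unfolded in_homs] a[unfolded in_homs]
  have "(a \<cdot> Braid V R X) \<cdot> (u \<boxtimes> \<iota> X) = (a \<cdot> (\<iota> X \<boxtimes> u)) \<cdot> Braid V (Unit V) X"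
    by (simp add: Braid_nat')
  then show ?thesis by (simp only: eq RUnit_Braid X)
qed

lemma op_right_unit:
  assumes u: "u \<in> homs V (Unit V) R" and a: "a \<in> homs V (R \<otimes> X) Y" and X: "X \<in> Obj V"
    and eq: "a \<cdot> (u \<boxtimes> \<iota> X) = LUnit V X"
  shows "(a \<cdot> Braid V X R) \<cdot> (\<iota> X \<boxtimes> u) = RUnit V X"
proof -
  have [simp]: "R \<in> Obj V" "X \<in> Obj V" using homs_Obj[OF u] X by auto
  note [simp] = u[unfolded in_homs] a[unfolded in_homs]
  have "(a \<cdot> Braid V X R) \<cdot> (\<iota> X \<boxtimes> u) = (a \<cdot> (u \<boxtimes> \<iota> X)) \<cdot> Braid V X (Unit V)"
    by (simp add: Braid_nat')
  then show ?thesis by (simp only: eq LUnit_Braid X)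
qed

lemma op_vcat:
  assumes H: "is_vcat V H"
  shows "is_vcat V (op_vcat V H)"
proof -
  note [simp] = is_vcatD[OF H]
  have "(VComp H z x w \<cdot> Braid V (Hom H z x) (Hom H x w)) \<cdot> ((VComp H z y x \<cdot> Braid V (Hom H z y) (Hom H y x)) \<boxtimes> \<iota> (Hom H x w))
    = (VComp H z y w \<cdot> Braid V (Hom H z y) (Hom H y w)) \<cdot> (\<iota> (Hom H z y) \<boxtimes> (VComp H y x w \<cdot> Braid V (Hom H y x) (Hom H x w))) \<cdot>
      Assoc V (Hom H z y) (Hom H y x) (Hom H x w)" for w x y z
    by (rule op_assoc[where Q = "Hom H z w"]) (simp_all add: in_homs vcat_assoc[OF H])
  moreover have "(VComp H y y x \<cdot> Braid V (Hom H y y) (Hom H y x)) \<cdot> (VUnit H y \<boxtimes> \<iota> (Hom H y x)) = LUnit V (Hom H y x)" for x y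
    by (rule op_left_unit[where Y = "Hom H y x"]) (simp_all add: in_homs vcat_unit[OF H])
  moreover have "(VComp H y x x \<cdot> Braid V (Hom H y x) (Hom H x x)) \<cdot> (\<iota> (Hom H y x) \<boxtimes> VUnit H x) = RUnit V (Hom H y x)" for x y
    by (rule op_right_unit[where Y = "Hom H y x"]) (simp_all add: in_homs vcat_unit[OF H])
  ultimately show ?thesis
    by (simp add: is_vcat_def op_vcat_def in_homs)
qed

lemma op_monoid:
  assumes R: "is_monoid V R"
  shows "is_monoid V (op_monoid V R)"
proof -
  let ?R = "MCar R"
  note [simp] = is_monoidD[OF R]
  have "(MMul R \<cdot> Braid V ?R ?R) \<cdot> ((MMul R \<cdot> Braid V ?R ?R) \<boxtimes> \<iota> ?R)
    = (MMul R \<cdot> Braid V ?R ?R) \<cdot> (\<iota> ?R \<boxtimes> (MMul R \<cdot> Braid V ?R ?R)) \<cdot> Assoc V ?R ?R ?R"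
    using R by (intro op_assoc[where Q = ?R]) (simp_all add: in_homs is_monoid_def)
  moreover have "(MMul R \<cdot> Braid V ?R ?R) \<cdot> (MOne R \<boxtimes> \<iota> ?R) = LUnit V ?R"
    using R by (intro op_left_unit[where Y = ?R]) (simp_all add: in_homs is_monoid_def)
  moreover have "(MMul R \<cdot> Braid V ?R ?R) \<cdot> (\<iota> ?R \<boxtimes> MOne R) = RUnit V ?R"
    using R by (intro op_right_unit[where Y = ?R]) (simp_all add: in_homs is_monoid_def)
  ultimately show ?thesis
    by (simp add: is_monoid_def op_monoid_def in_homs)
qed

lemma op_right_module:
  assumes R: "is_monoid V R" and N: "is_right_module V R N"
  shows "is_left_module V (op_monoid V R) (op_module V R N)"
proof -
  let ?R = "MCar R" and ?N = "Car N"
  note [simp] = is_monoidD[OF R] is_right_moduleD(1-4)[OF N]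
  have "(Act N \<cdot> Braid V ?R ?N) \<cdot> ((MMul R \<cdot> Braid V ?R ?R) \<boxtimes> \<iota> ?N)
    = (Act N \<cdot> Braid V ?R ?N) \<cdot> (\<iota> ?R \<boxtimes> (Act N \<cdot> Braid V ?R ?N)) \<cdot> Assoc V ?R ?R ?N"
    using is_right_moduleD(5)[OF N] by (intro op_assoc[where Q = ?N]) (simp_all add: in_homs)
  moreover have "(Act N \<cdot> Braid V ?R ?N) \<cdot> (MOne R \<boxtimes> \<iota> ?N) = LUnit V ?N"
    using is_right_moduleD(6)[OF N] by (intro op_left_unit[where Y = ?N]) (simp_all add: in_homs)
  ultimately show ?thesis
    by (simp add: is_left_module_def op_monoid_def op_module_def in_homs)
qed

lemma op_vfunctor:
  assumes H: "is_vcat V H" and K: "is_vcat V K" and F: "F \<in> vfunctors V H K"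
  shows "(\<lambda>x y. F y x) \<in> vfunctors V (op_vcat V H) (op_vcat V K)"
proof -
  note [simp] = is_vcatD[OF H] is_vcatD[OF K] vfunctorsD(1-3)[OF F]
  have "F z x \<cdot> VComp H z y x \<cdot> Braid V (Hom H z y) (Hom H y x)
      = (VComp K z y x \<cdot> Braid V (Hom K z y) (Hom K y x)) \<cdot> (F z y \<boxtimes> F y x)" for x y z
  proof -
    have "F z x \<cdot> VComp H z y x \<cdot> Braid V (Hom H z y) (Hom H y x)
        = (F z x \<cdot> VComp H z y x) \<cdot> Braid V (Hom H z y) (Hom H y x)" by simp
    also have "\<dots> = VComp K z y x \<cdot> (F y x \<boxtimes> F z y) \<cdot> Braid V (Hom H z y) (Hom H y x)"
      by (simp add: vfunctorsD(4)[OF F])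
    also have "\<dots> = (VComp K z y x \<cdot> Braid V (Hom K z y) (Hom K y x)) \<cdot> (F z y \<boxtimes> F y x)"
      by (simp add: Braid_nat')
    finally show ?thesis .
  qed
  then show ?thesis
    by (simp add: vfunctors_def op_vcat_def in_homs vfunctorsD(5)[OF F])
qed

text \<open>Symmetry of the braiding makes the opposite an involution on the nose, so enriched
  functors can be moved to the opposite and back.\<close>

lemma op_op_vcat:
  assumes H: "is_vcat V H"
  shows "op_vcat V (op_vcat V H) = H"
proof -
  note [simp] = is_vcatD[OF H]
  have "(VComp H x y z \<cdot> Braid V (Hom H x y) (Hom H y z)) \<cdot> Braid V (Hom H y z) (Hom H x y) = VComp H x y z" for x y z
    by (simp add: symmetry)
  then show ?thesis by (simp add: op_vcat_def)
qed

end

section \<open>From families to monoids, left modules and right modules\<close>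

context monoidal_model
begin

lemma op_has_sections:
  assumes H: "is_vcat V H" "has_sections H"
  shows "has_sections (op_vcat V H)"
  unfolding has_sections_def
proof (intro allI impI)
  fix K F assume K: "is_vcat V K" and F: "F \<in> vfunctors V K (op_vcat V H)" "\<forall>x y. F x y \<in> TF"
  have "(\<lambda>x y. F y x) \<in> vfunctors V (op_vcat V K) H"
    using op_vfunctor[OF K op_vcat[OF H(1)] F(1)] by (simp add: op_op_vcat[OF H(1)])
  then obtain S where S: "S \<in> vfunctors V H (op_vcat V K)" "\<forall>x y. F y x \<cdot> S x y = \<iota> (Hom H x y)"
    using H(2) op_vcat[OF K] F(2) unfolding has_sections_def by blast
  have "(\<lambda>x y. S y x) \<in> vfunctors V (op_vcat V H) K"
    using op_vfunctor[OF H(1) op_vcat[OF K] S(1)] by (simp add: op_op_vcat[OF K])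
  moreover have "\<forall>x y. F x y \<cdot> S y x = \<iota> (Hom (op_vcat V H) x y)"
    using S(2) by (simp add: op_vcat_def)
  ultimately show "\<exists>S \<in> vfunctors V (op_vcat V H) K. \<forall>x y. F x y \<cdot> S x y = \<iota> (Hom (op_vcat V H) x y)"
    by (intro bexI[of _ "\<lambda>x y. S y x"])
qed

text \<open>A section is a lift of the identity of \<open>H\<close> along a trivial
  fibration.\<close>

lemma has_sections_of_cofibrant:
  assumes "cofibrant (VCat V) (VCat_model V M) H"
  shows "is_vcat V H \<and> has_sections H"
proof
  interpret C: category "VCat V :: (('s, 'o, 'm) vcat, _) cat" by (rule category_VCat)
  obtain H0 f where "f \<in> homs (VCat V) H0 H" using assms by (auto simp: cofibrant_def)
  then show H: "is_vcat V H" by (simp add: VCat_def homs_struct_cat)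
  show "has_sections H"
    unfolding has_sections_def
  proof (intro allI impI)
    fix K F assume K: "is_vcat V K" and F: "F \<in> vfunctors V K H" "\<forall>x y. F x y \<in> TF"
    let ?u = "\<lambda>(H, K, F). {F x y | x y. True}"
    have p: "(K, H, F) \<in> homs (VCat V) K H" using K H F by (simp add: VCat_def homs_struct_cat)
    have "(K, H, F) \<in> {f \<in> Arr (VCat V). ?u f \<subseteq> Weq M} \<inter> {f \<in> Arr (VCat V). ?u f \<subseteq> Fib M}"
      using K H F by (auto simp: VCat_def)
    from C.cofibrant_lift[OF assms Cof_transferred[of "VCat V" ?u M, folded VCat_model_def] this p C.Ident_homs[of H]]
    obtain k where k: "k \<in> homs (VCat V) H K" "(K, H, F) \<cdot>\<^bsub>VCat V\<^esub> k = Ident (VCat V) H"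
      using H by (auto simp: VCat_def)
    then obtain S where S: "S \<in> vfunctors V H K" "k = (H, K, S)" by (auto simp: VCat_def homs_struct_cat)
    have "(\<lambda>x y. F x y \<cdot> S x y) = (\<lambda>x y. \<iota> (Hom H x y))"
      using k(2) by (simp add: S(2) VCat_def)
    then have "F x y \<cdot> S x y = \<iota> (Hom H x y)" for x y by (metis (no_types))
    then show "\<exists>S \<in> vfunctors V H K. \<forall>x y. F x y \<cdot> S x y = \<iota> (Hom H x y)"
      using S(1) by blast
  qed
qed

text \<open>Maps into a terminal object are unique, so it is a module over every monoid. It serves
  to extend a monoid to a family.\<close>

lemma terminal_module:
  obtains Z where "Z \<in> Obj V" "\<forall>Y \<in> Obj V. \<exists>!f. f \<in> homs V Y Z"
    "\<forall>R. is_monoid V R \<longrightarrow> (\<exists>N. is_left_module V R N \<and> Car N = Z)"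
proof -
  obtain Z where Z [simp]: "Z \<in> Obj V" and un: "\<And>Y. Y \<in> Obj V \<Longrightarrow> \<exists>!f. f \<in> homs V Y Z"
    using complete_terminal[OF univ V_complete] by blast
  have "\<exists>N. is_left_module V R N \<and> Car N = Z" if R: "is_monoid V R" for R
  proof -
    note [simp] = is_monoidD[OF R]
    obtain a where a: "a \<in> homs V (MCar R \<otimes> Z) Z" using un[of "MCar R \<otimes> Z"] by auto
    note [simp] = a[unfolded in_homs]
    have "a \<cdot> (MMul R \<boxtimes> \<iota> Z) = a \<cdot> (\<iota> (MCar R) \<boxtimes> a) \<cdot> Assoc V (MCar R) (MCar R) Z"
      by (rule ex1_eqI[OF un[of "(MCar R \<otimes> MCar R) \<otimes> Z"]]) (simp_all add: in_homs)
    moreover have "a \<cdot> (MOne R \<boxtimes> \<iota> Z) = LUnit V Z"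
      by (rule ex1_eqI[OF un[of "Unit V \<otimes> Z"]]) (simp_all add: in_homs)
    ultimately have "is_left_module V R \<lparr>Car = Z, Act = a\<rparr>"
      using a by (simp add: is_left_module_def)
    then show ?thesis by (intro exI[of _ "\<lparr>Car = Z, Act = a\<rparr>"]) simp
  qed
  then show thesis using un by (intro that[OF Z]) blast+
qed

text \<open>A lifting problem of monoids becomes one of families by placing the terminal module at
  every object other than \<open>b\<close>. There the equations hold by uniqueness, and the identity
  of the terminal object is a trivial fibration.\<close>

lemma monoid_lift:
  assumes L: "cofibrant_family b A L" and C: "is_monoid V C" and B: "is_monoid V B"
    and p: "p \<in> monoid_homs V C B" "p \<in> TF" and g: "g \<in> monoid_homs V A B"
  shows "\<exists>h \<in> monoid_homs V A C. p \<cdot> h = g"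
proof -
  obtain Z where Z [simp]: "Z \<in> Obj V" and un': "\<forall>Y \<in> Obj V. \<exists>!f. f \<in> homs V Y Z"
    and mod: "\<forall>R. is_monoid V R \<longrightarrow> (\<exists>N. is_left_module V R N \<and> Car N = Z)"
    by (rule terminal_module)
  note un = un'[rule_format]
  obtain TC TB where T: "is_left_module V C TC" "is_left_module V B TB" and Car_T [simp]: "Car TC = Z" "Car TB = Z"
    using mod C B by blast
  have fam: "is_family V b A L" using L by (simp add: cofibrant_family_def)
  have A: "is_monoid V A" and Ly: "is_left_module V A (L y)" for y using fam by (simp_all add: is_family_def)
  have C_reg: "is_left_module V C (regular C)" and B_reg: "is_left_module V B (regular B)"
    using C B by (simp_all add: is_monoid_def is_left_module_def regular_def)
  have reg: "Car (regular R) = MCar R" "Act (regular R) = MMul R" for R :: "('o, 'm) mon"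
    by (simp_all add: regular_def)
  define X where "X y = (if y = b then regular C else TC)" for y
  define Y where "Y y = (if y = b then regular B else TB)" for y
  have X: "is_family V b C X" and Y: "is_family V b B Y"
    using T C_reg B_reg C B by (simp_all add: is_family_def X_def Y_def)
  note [simp] = is_monoidD[OF A] is_monoidD[OF C] is_monoidD[OF B] is_left_moduleD[OF Ly] family_b[OF fam]
    is_left_moduleD(2-4)[OF T(1)] is_left_moduleD(2-4)[OF T(2)] monoid_homsD(1-3)[OF p(1)] monoid_homsD(1-3)[OF g]
  define t where "t y = (THE f. f \<in> homs V (Car (L y)) Z)" for y
  have t: "t y \<in> homs V (Car (L y)) Z" for y
    unfolding t_def by (rule theI'[OF un]) simp
  note t' [simp] = t[unfolded in_homs, THEN conjunct1] t[unfolded in_homs, THEN conjunct2, THEN conjunct1]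
    t[unfolded in_homs, THEN conjunct2, THEN conjunct2]
  define p' where "p' y = (if y = b then p else \<iota> Z)" for y
  define g' where "g' y = (if y = b then g else t y)" for y
  have "\<iota> Z \<cdot> Act TC = Act TB \<cdot> (p \<boxtimes> \<iota> Z)"
    by (rule ex1_eqI[OF un[of "MCar C \<otimes> Z"]]) (simp_all add: in_homs)
  then have p'_hom: "p' \<in> family_homs V b C X B Y"
    using monoid_homsD(4,5)[OF p(1)] by (simp add: family_homs_def p'_def X_def Y_def in_homs reg)
  have p'_TF: "\<forall>y. p' y \<in> TF" using p(2) TF_Ident[OF Z] by (simp add: p'_def)
  have "t y \<cdot> Act (L y) = Act TB \<cdot> (g \<boxtimes> t y)" for y
    by (rule ex1_eqI[OF un[of "MCar A \<otimes> Car (L y)"]]) (simp_all add: in_homs)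
  then have g'_hom: "g' \<in> family_homs V b A L B Y"
    using monoid_homsD(4,5)[OF g] by (simp add: family_homs_def g'_def Y_def in_homs reg)
  obtain h where h: "h \<in> family_homs V b A L C X" "\<forall>y. p' y \<cdot> h y = g' y"
    using L X Y p'_hom p'_TF g'_hom unfolding cofibrant_family_def by blast
  have "h b \<in> monoid_homs V A C"
    using family_homsD(1-4)[OF h(1), of b] family_homsD(5)[OF h(1)]
    by (simp add: monoid_homs_def in_homs X_def reg)
  moreover have "p \<cdot> h b = g" using h(2)[rule_format, of b] by (simp add: p'_def g'_def)
  ultimately show ?thesis by blast
qed

text \<open>Naturality of the braiding carries one linearity condition to the other, and its
  invertibility makes this an equivalence.\<close>

lemma op_right_module_homs:
  assumes R: "is_monoid V R" and N: "is_right_module V R N" and N': "is_right_module V R N'"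
  shows "f \<in> left_module_homs V (op_monoid V R) (op_module V R N) (op_module V R N')
    \<longleftrightarrow> f \<in> right_module_homs V R N N'"
proof -
  let ?R = "MCar R"
  note [simp] = is_monoidD[OF R] is_right_moduleD(1-4)[OF N] is_right_moduleD(1-4)[OF N']
  have "f \<cdot> Act N \<cdot> Braid V ?R (Car N) = (Act N' \<cdot> Braid V ?R (Car N')) \<cdot> (\<iota> ?R \<boxtimes> f)
      \<longleftrightarrow> f \<cdot> Act N = Act N' \<cdot> (f \<boxtimes> \<iota> ?R)" if f: "f \<in> homs V (Car N) (Car N')"
  proof -
    note [simp] = f[unfolded in_homs]
    have 1: "(Act N' \<cdot> Braid V ?R (Car N')) \<cdot> (\<iota> ?R \<boxtimes> f) = (Act N' \<cdot> (f \<boxtimes> \<iota> ?R)) \<cdot> Braid V ?R (Car N)"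
      by (simp add: Braid_nat')
    have 2: "f \<cdot> Act N \<cdot> Braid V ?R (Car N) = (f \<cdot> Act N) \<cdot> Braid V ?R (Car N)" by simp
    show ?thesis
    proof
      assume "f \<cdot> Act N \<cdot> Braid V ?R (Car N) = (Act N' \<cdot> Braid V ?R (Car N')) \<cdot> (\<iota> ?R \<boxtimes> f)"
      then have "(f \<cdot> Act N) \<cdot> Braid V ?R (Car N) = (Act N' \<cdot> (f \<boxtimes> \<iota> ?R)) \<cdot> Braid V ?R (Car N)"
        by (simp only: 1 2)
      then show "f \<cdot> Act N = Act N' \<cdot> (f \<boxtimes> \<iota> ?R)" by (rule iso_epi) simp_all
    next
      assume "f \<cdot> Act N = Act N' \<cdot> (f \<boxtimes> \<iota> ?R)"
      then show "f \<cdot> Act N \<cdot> Braid V ?R (Car N) = (Act N' \<cdot> Braid V ?R (Car N')) \<cdot> (\<iota> ?R \<boxtimes> f)"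
        by (simp only: 1 2)
    qed
  qed
  then show ?thesis
    by (auto simp: left_module_homs_def right_module_homs_def op_monoid_def op_module_def)
qed

lemma initial_V: obtains E where "initial V E"
  using cocomplete_initial[OF univ V_cocomplete] .

lemma cofibrant_Mon:
  assumes L: "cofibrant_family b A L"
  shows "cofibrant (Mon V) (Mon_model V M) A"
proof -
  interpret C: category "Mon V" by (rule category_Mon)
  let ?u = "\<lambda>(R, S, f). {f}"
  have A: "is_monoid V A" using L by (simp add: cofibrant_family_def is_family_def)
  show ?thesis
    unfolding Mon_model_def
  proof (rule C.cofibrantI[OF initial_Mon _ Cof_transferred])
    show "A \<in> Obj (Mon V)" using A by (simp add: Mon_def)
    fix P g
    assume P: "P \<in> {f \<in> Arr (Mon V). ?u f \<subseteq> Weq M} \<inter> {f \<in> Arr (Mon V). ?u f \<subseteq> Fib M}"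
      and g: "g \<in> homs (Mon V) A (Cod (Mon V) P)"
    obtain C B p where p: "P = (C, B, p)" by (cases P)
    have CB: "is_monoid V C" "is_monoid V B" "p \<in> monoid_homs V C B" "p \<in> TF"
      using P by (simp_all add: p Mon_def)
    obtain f where f: "f \<in> monoid_homs V A B" "g = (A, B, f)"
      using g by (auto simp: p Mon_def homs_struct_cat)
    obtain h where h: "h \<in> monoid_homs V A C" "p \<cdot> h = f"
      using monoid_lift[OF L CB f(1)] by blast
    show "\<exists>k \<in> homs (Mon V) A (Dom (Mon V) P). P \<cdot>\<^bsub>Mon V\<^esub> k = g"
      by (rule bexI[of _ "(A, C, h)"]) (simp_all add: p f(2) h A CB Mon_def homs_struct_cat)
  qed blast
qed

lemma cofibrant_LMod:
  assumes A: "is_monoid V A" and L: "is_left_module V A L" "cofibrant_module A L"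
  shows "cofibrant (LMod V A) (LMod_model V M A) L"
proof -
  interpret C: category "LMod V A" by (rule category_LMod[OF A])
  let ?u = "\<lambda>(R, S, f). {f}"
  obtain E where "initial V E" by (rule initial_V)
  then obtain N where N: "initial (LMod V A) N" by (rule initial_LMod[OF A])
  show ?thesis
    unfolding LMod_model_def
  proof (rule C.cofibrantI[OF N _ Cof_transferred])
    show "L \<in> Obj (LMod V A)" using L(1) by (simp add: LMod_def)
    fix P g
    assume P: "P \<in> {f \<in> Arr (LMod V A). ?u f \<subseteq> Weq M} \<inter> {f \<in> Arr (LMod V A). ?u f \<subseteq> Fib M}"
      and g: "g \<in> homs (LMod V A) L (Cod (LMod V A) P)"
    obtain X Y p where p: "P = (X, Y, p)" by (cases P)
    have XY: "is_left_module V A X" "is_left_module V A Y" "p \<in> left_module_homs V A X Y" "p \<in> TF"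
      using P by (simp_all add: p LMod_def)
    obtain f where f: "f \<in> left_module_homs V A L Y" "g = (L, Y, f)"
      using g by (auto simp: p LMod_def homs_struct_cat)
    obtain h where h: "h \<in> left_module_homs V A L X" "p \<cdot> h = f"
      using L(2) XY f(1) unfolding cofibrant_module_def by blast
    show "\<exists>k \<in> homs (LMod V A) L (Dom (LMod V A) P). P \<cdot>\<^bsub>LMod V A\<^esub> k = g"
      by (rule bexI[of _ "(L, X, h)"]) (simp_all add: p f(2) h L(1) XY LMod_def homs_struct_cat)
  qed blast
qed

text \<open>The lifting problem is solved among left modules over the opposite monoid: the
  underlying maps, and with them the trivial fibrations, are the same.\<close>

lemma cofibrant_RMod:
  assumes A: "is_monoid V A" and L: "is_right_module V A L" "cofibrant_module (op_monoid V A) (op_module V A L)"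
  shows "cofibrant (RMod V A) (RMod_model V M A) L"
proof -
  interpret C: category "RMod V A" by (rule category_RMod[OF A])
  let ?u = "\<lambda>(R, S, f). {f}"
  obtain E where "initial V E" by (rule initial_V)
  then obtain N where N: "initial (RMod V A) N" by (rule initial_RMod[OF A])
  show ?thesis
    unfolding RMod_model_def
  proof (rule C.cofibrantI[OF N _ Cof_transferred])
    show "L \<in> Obj (RMod V A)" using L(1) by (simp add: RMod_def)
    fix P g
    assume P: "P \<in> {f \<in> Arr (RMod V A). ?u f \<subseteq> Weq M} \<inter> {f \<in> Arr (RMod V A). ?u f \<subseteq> Fib M}"
      and g: "g \<in> homs (RMod V A) L (Cod (RMod V A) P)"
    obtain X Y p where p: "P = (X, Y, p)" by (cases P)
    have XY: "is_right_module V A X" "is_right_module V A Y" "p \<in> right_module_homs V A X Y" "p \<in> TF"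
      using P by (simp_all add: p RMod_def)
    obtain f where f: "f \<in> right_module_homs V A L Y" "g = (L, Y, f)"
      using g by (auto simp: p RMod_def homs_struct_cat)
    have "\<exists>h \<in> left_module_homs V (op_monoid V A) (op_module V A L) (op_module V A X). p \<cdot> h = f"
      using L(2) op_right_module[OF A XY(1)] op_right_module[OF A XY(2)] XY(3,4) f(1)
        op_right_module_homs[OF A XY(1,2)] op_right_module_homs[OF A L(1) XY(2)]
      unfolding cofibrant_module_def by blast
    then obtain h where h: "h \<in> right_module_homs V A L X" "p \<cdot> h = f"
      using op_right_module_homs[OF A L(1) XY(1)] by blast
    show "\<exists>k \<in> homs (RMod V A) L (Dom (RMod V A) P). P \<cdot>\<^bsub>RMod V A\<^esub> k = g"
      by (rule bexI[of _ "(L, X, h)"]) (simp_all add: p f(2) h L(1) XY RMod_def homs_struct_cat)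
  qed blast
qed

lemma hom_right_module:
  assumes H: "is_vcat V H"
  shows "is_right_module V (endo_monoid H x) (hom_right_module H x y)"
  using is_vcatD[OF H] vcat_assoc[OF H] vcat_unit[OF H]
  by (simp add: is_right_module_def endo_monoid_def hom_right_module_def in_homs)

text \<open>Left modules are read off from the family of maps into \<open>y\<close>, and right
  modules from the maps into \<open>x\<close> in the opposite category, which are the maps out of
  \<open>x\<close> in \<open>H\<close>.\<close>

theorem cofibrant_endo_monoid_and_modules:
  assumes adequate: "adequate TYPE('u) V M" and I: "cofibrant V M (Unit V)"
    and ct: "\<exists>g :: 's \<Rightarrow> nat. inj g" and H: "cofibrant (VCat V) (VCat_model V M) (H :: ('s, 'o, 'm) vcat)"
  shows "cofibrant (Mon V) (Mon_model V M) (endo_monoid H x)"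
    and "x \<noteq> y \<Longrightarrow> cofibrant (LMod V (endo_monoid H y)) (LMod_model V M (endo_monoid H y)) (hom_left_module H x y)"
    and "x \<noteq> y \<Longrightarrow> cofibrant (RMod V (endo_monoid H x)) (RMod_model V M (endo_monoid H x)) (hom_right_module H x y)"
proof -
  have vH: "is_vcat V H" and sH: "has_sections H" using has_sections_of_cofibrant[OF H] by auto
  have fam: "cofibrant_family z (endo_monoid H z) (\<lambda>x. hom_left_module H x z)" for z
    by (rule cofibrant_hom_family[OF adequate I ct vH sH])
  have op_fam: "cofibrant_family z (endo_monoid (op_vcat V H) z) (\<lambda>x. hom_left_module (op_vcat V H) x z)" for z
    by (rule cofibrant_hom_family[OF adequate I ct op_vcat[OF vH] op_has_sections[OF vH sH]])
  have mon: "is_monoid V (endo_monoid H z)" and mod: "is_left_module V (endo_monoid H z) (hom_left_module H w z)" for w z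
    using hom_family[OF vH, of z] by (simp_all add: is_family_def)
  show "cofibrant (Mon V) (Mon_model V M) (endo_monoid H x)" by (rule cofibrant_Mon[OF fam])
  show "cofibrant (LMod V (endo_monoid H y)) (LMod_model V M (endo_monoid H y)) (hom_left_module H x y)" if "x \<noteq> y"
    by (rule cofibrant_LMod[OF mon mod cofibrant_module_of_family[OF fam that]])
  \<comment> \<open>Both passages to the opposite insert the same braiding, so these are equalities
    and not merely isomorphisms.\<close>
  have op: "endo_monoid (op_vcat V H) z = op_monoid V (endo_monoid H z)"
    "hom_left_module (op_vcat V H) w z = op_module V (endo_monoid H z) (hom_right_module H z w)" for w z
    by (simp_all add: endo_monoid_def op_vcat_def op_monoid_def hom_left_module_def op_module_def hom_right_module_def)
  show "cofibrant (RMod V (endo_monoid H x)) (RMod_model V M (endo_monoid H x)) (hom_right_module H x y)" if "x \<noteq> y"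
    using cofibrant_module_of_family[OF op_fam that[symmetric]]
    by (intro cofibrant_RMod[OF mon hom_right_module[OF vH]]) (simp only: op)
qed

end

theorem theorem1p15:
  fixes V :: "('o, 'm) smcat" and M :: "'m model_str" and \<H> :: "(two, 'o, 'm) vcat"
  assumes "universe TYPE('u)"
    and "monoidal_model_category TYPE('u) V M"
    and "adequate TYPE('u) V M"
    and "cofibrant V M (Unit V)"
    and "cofibrant (VCat V) (VCat_model V M) \<H>"
  shows "(cofibrant (Mon V) (Mon_model V M) (endo_monoid \<H> Zero) \<and>
          cofibrant (Mon V) (Mon_model V M) (endo_monoid \<H> One)) \<and>
         (cofibrant (LMod V (endo_monoid \<H> One)) (LMod_model V M (endo_monoid \<H> One))
            (hom_left_module \<H> Zero One) \<and>
          cofibrant (RMod V (endo_monoid \<H> Zero)) (RMod_model V M (endo_monoid \<H> Zero))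
            (hom_right_module \<H> Zero One)) \<and>
         (cofibrant (LMod V (endo_monoid \<H> Zero)) (LMod_model V M (endo_monoid \<H> Zero))
            (hom_left_module \<H> One Zero) \<and>
          cofibrant (RMod V (endo_monoid \<H> One)) (RMod_model V M (endo_monoid \<H> One))
            (hom_right_module \<H> One Zero))"
proof -
  have "closed_symmetric_monoidal_category V"
    using assms(2) by (simp add: monoidal_model_category_def)
  then interpret closed_symmetric_monoidal_category V .
  interpret monoidal_model V "TYPE('u)" M
    by unfold_locales (fact assms(1,2))+
  have "inj (\<lambda>x. if x = Zero then 0 else 1 :: nat)"
    by (rule injI) (metis two.exhaust zero_neq_one)
  then have "\<exists>g :: two \<Rightarrow> nat. inj g" by blast
  note * = cofibrant_endo_monoid_and_modules[OF assms(3,4) this assms(5)]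
  show ?thesis
    by (intro conjI *) simp_all
qed

end
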